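(* Let $K$ be an imaginary quadratic number field whose discriminant satisfies $D_K\equiv 0 \bmod 4$. Let $\alpha\in\,]0,\frac12[$ and $\beta\in\,]0,1+\frac{\alpha}{2}[$. For a renormalizing function $\psi$ from the positive integers to $]0,+\infty[$, let $$\mathcal R_N^{\alpha,\beta}=\frac{1}{\psi(N)}\sum_{a,b\in\mathbb N:\ a\neq b,\ 0<a,b\le N^2} r_{K,\alpha}(a,b,N)\,\Delta_{N^\beta(\ln a-\ln b)}$$ be the empirical pair correlation measure for the power scaling $\phi(N)=N^\beta$. Then, as $N\to+\infty$, the measures $\mathcal R_N^{\alpha,\beta}$ converge, for the weak-star convergence of measures on $\mathbb R$, to the measure $m_{\alpha,\beta}$ given by $$m_{\alpha,\beta}=\begin{cases}\dfrac{4\pi^2}{|D_K|}\,\Delta_0 & \text{if } \beta\in\,]0,1-\alpha[ \text{ and } \psi(N)=N^{2+2\alpha},\\[2mm] \rho_{1-\alpha}\,\mathrm{Leb}_{\mathbb R} & \text{if } \beta=1-\alpha \text{ and } \psi(N)=N^{2+2\alpha}=N^{3+\alpha-\beta},\\[2mm] \dfrac{8\pi}{3|D_K|}\,\mathrm{Leb}_{\mathbb R} & \text{if } \beta\in\,]1-\alpha,1+\frac{\alpha}{2}[,\ \alpha\le\frac16 \text{ and } \psi(N)=N^{3+\alpha-\beta}.\end{cases}$$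
   Context: $\mathcal O_K$ is the ring of integers of $K$ (with $K\subset\mathbb C$), and $\mathtt n(z)=z\overline z$ is the norm. For nonzero $a,b,N\in\mathbb N$, $$r_{K,\alpha}(a,b,N)=\mathrm{Card}\{(w,z)\in\mathcal O_K\times\mathcal O_K:\ \mathtt n(w)=a,\ \mathtt n(z)=b,\ \mathtt n(z-w)\le N^{2\alpha}\}.$$ $\Delta_x$ is the unit Dirac mass at $x$, and $\mathrm{Leb}_{\mathbb R}$ is Lebesgue measure on $\mathbb R$. Weak-star convergence means convergence of the integrals of every continuous compactly supported function on $\mathbb R$. The notation $]x,y[$ denotes an open interval. The even function $\rho_{1-\alpha}:\mathbb R\to[0,+\infty[$ is defined by $$\rho_{1-\alpha}(t)=\begin{cases}\dfrac{8\pi}{3|D_K|} & \text{if } t=0,\\[2mm] \dfrac{8\pi}{|D_K|\,t^3}\Big(\arcsin\big(\tfrac t2\big)-\tfrac t2\big(1-\tfrac{t^2}{2}\big)\sqrt{1-\tfrac{t^2}{4}}\Big) & \text{if } 0<|t|\le 2,\\[2mm] \dfrac{4\pi^2}{|D_K|\,|t|^3} & \text{if } |t|>2.\end{cases}$$ *)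

theory Defs
  imports
    "HOL-Probability.Probability"
    "HOL-Number_Theory.Cong"
    "HOL-Computational_Algebra.Polynomial"
begin

definition subfield_of_complex :: "complex set \<Rightarrow> bool" where
  "subfield_of_complex K \<longleftrightarrow>
     0 \<in> K \<and> 1 \<in> K \<and>
     (\<forall>x\<in>K. \<forall>y\<in>K. x + y \<in> K \<and> x * y \<in> K) \<and>
     (\<forall>x\<in>K. - x \<in> K \<and> inverse x \<in> K)"

definition rat_scale :: "rat \<Rightarrow> complex \<Rightarrow> complex" where
  "rat_scale q z = of_rat q * z"

lemma vector_space_rat_scale: "vector_space rat_scale"
  by unfold_locales (simp_all add: rat_scale_def algebra_simps of_rat_add of_rat_mult)

definition imaginary_quadratic_field :: "complex set \<Rightarrow> bool" where
  "imaginary_quadratic_field K \<longleftrightarrow>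
     subfield_of_complex K \<and> vector_space.dim rat_scale K = 2 \<and> \<not> K \<subseteq> \<real>"

definition ring_of_integers :: "complex set \<Rightarrow> complex set" where
  "ring_of_integers K = {z \<in> K. algebraic_int z}"

definition integral_basis :: "complex set \<Rightarrow> complex \<Rightarrow> complex \<Rightarrow> bool" where
  "integral_basis K \<omega>\<^sub>1 \<omega>\<^sub>2 \<longleftrightarrow>
     bij_betw (\<lambda>(m::int, n::int). of_int m * \<omega>\<^sub>1 + of_int n * \<omega>\<^sub>2) UNIV (ring_of_integers K)"

(* The embeddings of an imaginary quadratic field into the complex numbers are the inclusion
   and complex conjugation, so this is det (sigma_i omega_j) squared, for any Z-basis of the
   ring of integers. *)
definition discriminant :: "complex set \<Rightarrow> int" where
  "discriminant K =
     (THE D. \<exists>\<omega>\<^sub>1 \<omega>\<^sub>2. integral_basis K \<omega>\<^sub>1 \<omega>\<^sub>2 \<and>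
        of_int D = (\<omega>\<^sub>1 * cnj \<omega>\<^sub>2 - \<omega>\<^sub>2 * cnj \<omega>\<^sub>1)\<^sup>2)"

(* z * cnj z is real, so taking the real part loses nothing. *)
definition norm_form :: "complex \<Rightarrow> real" where
  "norm_form z = Re (z * cnj z)"

definition pair_count :: "complex set \<Rightarrow> real \<Rightarrow> nat \<Rightarrow> nat \<Rightarrow> nat \<Rightarrow> nat" where
  "pair_count K \<alpha> a b N =
     card {(w, z). w \<in> ring_of_integers K \<and> z \<in> ring_of_integers K \<and>
                   norm_form w = real a \<and> norm_form z = real b \<and>
                   norm_form (z - w) \<le> real N powr (2 * \<alpha>)}"

definition pair_index :: "nat \<Rightarrow> (nat \<times> nat) set" where
  "pair_index N = {(a, b). a \<noteq> b \<and> 0 < a \<and> a \<le> N\<^sup>2 \<and> 0 < b \<and> b \<le> N\<^sup>2}"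

(* A finite sum of weighted Dirac masses is encoded as the image of a weighted counting measure
   on the index set; emeasure_empirical_measure below gives the sum explicitly. *)
definition empirical_measure ::
    "complex set \<Rightarrow> real \<Rightarrow> real \<Rightarrow> (nat \<Rightarrow> real) \<Rightarrow> nat \<Rightarrow> real measure" where
  "empirical_measure K \<alpha> \<beta> \<psi> N =
     distr (point_measure (pair_index N)
              (\<lambda>(a, b). ennreal (1 / \<psi> N * real (pair_count K \<alpha> a b N))))
           borel
           (\<lambda>(a, b). real N powr \<beta> * (ln (real a) - ln (real b)))"

lemma finite_pair_index: "finite (pair_index N)"
  by (rule finite_subset[of _ "{..N\<^sup>2} \<times> {..N\<^sup>2}"]) (auto simp: pair_index_def)

lemma emeasure_empirical_measure:
  assumes "A \<in> sets borel"
  shows "emeasure (empirical_measure K \<alpha> \<beta> \<psi> N) A =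
     (\<Sum>(a, b)\<in>pair_index N. ennreal (1 / \<psi> N * real (pair_count K \<alpha> a b N)) *
        emeasure (return borel (real N powr \<beta> * (ln (real a) - ln (real b)))) A)"
proof -
  let ?g = "\<lambda>(a, b). real N powr \<beta> * (ln (real a) - ln (real b))"
  let ?f = "\<lambda>(a, b). ennreal (1 / \<psi> N * real (pair_count K \<alpha> a b N))"
  have "emeasure (empirical_measure K \<alpha> \<beta> \<psi> N) A =
      emeasure (point_measure (pair_index N) ?f) (?g -` A \<inter> pair_index N)"
    unfolding empirical_measure_def using assms
    by (subst emeasure_distr) (simp_all add: space_point_measure measurable_point_measure_eq1)
  also have "\<dots> = (\<Sum>x\<in>?g -` A \<inter> pair_index N. ?f x)"
    by (rule emeasure_point_measure_finite) (auto simp: finite_pair_index)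
  also have "\<dots> = (\<Sum>x\<in>pair_index N. ?f x * indicator A (?g x))"
    using finite_pair_index
    by (intro sum.mono_neutral_cong_left) (auto simp: indicator_def)
  finally show ?thesis
    using assms by (simp add: case_prod_unfold)
qed

definition weak_star_tendsto :: "(nat \<Rightarrow> real measure) \<Rightarrow> real measure \<Rightarrow> bool" where
  "weak_star_tendsto M m \<longleftrightarrow>
     (\<forall>f :: real \<Rightarrow> real. continuous_on UNIV f \<and> compact (closure {x. f x \<noteq> 0}) \<longrightarrow>
        (\<lambda>N. \<integral>x. f x \<partial>M N) \<longlonglongrightarrow> (\<integral>x. f x \<partial>m))"

definition pair_density :: "complex set \<Rightarrow> real \<Rightarrow> real" where
  "pair_density K t =
     (if t = 0 then 8 * pi / (3 * \<bar>real_of_int (discriminant K)\<bar>)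
      else if \<bar>t\<bar> \<le> 2 then
        8 * pi / (\<bar>real_of_int (discriminant K)\<bar> * t ^ 3) *
          (arcsin (t / 2) - t / 2 * (1 - t\<^sup>2 / 2) * sqrt (1 - t\<^sup>2 / 4))
      else 4 * pi\<^sup>2 / (\<bar>real_of_int (discriminant K)\<bar> * \<bar>t\<bar> ^ 3))"

end

theory Submission
  imports Defs
begin

text \<open>
  Write \<open>w = z + h\<close>. Integrating a test function \<open>f\<close> against the empirical measure gives, up to the
  factor \<open>1 / \<psi> N\<close>, the sum of \<open>f (N^\<beta> ln (|z + h|^2 / |z|^2))\<close> over pairs \<open>(z, h)\<close> of ring elements with
  \<open>0 < |h| \<le> N^\<alpha>\<close>, \<open>0 < |z|, |z + h| \<le> N\<close> and \<open>|z + h| \<noteq> |z|\<close>. As the discriminant \<open>D\<close> is divisible by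
  4, the ring of integers is a rectangular lattice \<open>\<int> + i y \<int>\<close> with \<open>|D| = 4 y^2\<close>
  (\<open>ring_of_integers_rectangular\<close>).

  The sum over \<open>z\<close> comes first. For fixed \<open>h\<close> the argument of \<open>f\<close> is close to
  \<open>2 N^\<beta> (z \<bullet> h) / |z|^2\<close>, with an error \<open>O(N^(2 \<alpha> + \<beta> - 2))\<close> away from \<open>z = 0\<close>, and it changes by
  \<open>O(N^(\<alpha> + \<beta> - 2))\<close> when \<open>z\<close> moves within a cell of the lattice; both exponents are negative in every
  regime. The sum over \<open>z\<close> is therefore \<open>1 / y\<close> times the corresponding integral over the disc of
  radius \<open>N\<close>, which by rotation and scaling equals \<open>N^2 A(N^(\<beta> - 1) |h|)\<close> with
  \<open>A(s) = \<integral> f (2 s u_1 / |u|^2) du\<close> over the unit disc. For nonnegative \<open>f\<close> the boundary conditions on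
  \<open>z\<close> and \<open>z + h\<close> are handled by discs of radius \<open>N + O(1)\<close> from above and \<open>N - N^\<alpha> - O(1)\<close> from
  below (\<open>starts_sum_le\<close>, \<open>starts_sum_ge\<close>). The errors are counted in strips: points \<open>z\<close> with a bounded
  gap lie in a strip perpendicular to \<open>h\<close>, and a strip of half-width \<open>W / |h|\<close> contains
  \<open>O(R (W / |h| + 1))\<close> lattice points of the disc of radius \<open>R\<close> (\<open>card_strip_le\<close>). The same count with
  \<open>W = 0\<close> shows that the pairs with \<open>|z + h| = |z|\<close> are negligible.

  What remains is a sum over \<open>h\<close> of \<open>A(\<lambda> r)\<close>, where \<open>r = |h| / N^\<alpha>\<close> and \<open>\<lambda> = N^(\<alpha> + \<beta> - 1)\<close> is the
  typical size of the gap. This is a radial Riemann sum for the lattice, whose limit follows by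
  dominated convergence (\<open>radial_riemann_sum\<close>). If \<open>\<beta> < 1 - \<alpha>\<close>, then \<open>\<lambda>\<close> tends to 0 and
  \<open>A(\<lambda> r)\<close> to \<open>\<pi> f(0)\<close>. If \<open>\<beta> = 1 - \<alpha>\<close>, then \<open>\<lambda> = 1\<close>. If \<open>\<beta> > 1 - \<alpha>\<close>, then \<open>\<lambda>\<close> tends to
  infinity and \<open>\<lambda> A(\<lambda> r)\<close> to \<open>(\<integral> f) / (3 r)\<close> (\<open>mult_disc_integral_tendsto\<close>); the renormalization
  \<open>N^(3 + \<alpha> - \<beta>) = N^(2 + 2 \<alpha>) / \<lambda>\<close> accounts for the factor \<open>\<lambda>\<close>. Integrating these limits over
  \<open>|v| \<le> 1\<close> with \<open>r = |v|\<close> and dividing by \<open>y^2\<close> gives the three measures; in the critical regime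
  Fubini's theorem and the chord lengths of the disc produce the explicit density
  (\<open>nn_disc_integral_average\<close>).\<close>

section \<open>The ring of integers as a rectangular lattice\<close>

lemma quadratic_field_span:
  assumes K: "imaginary_quadratic_field K" and tK: "\<tau> \<in> K" and tR: "\<tau> \<notin> \<real>" and zK: "z \<in> K"
  shows "\<exists>p q :: rat. z = of_rat p + of_rat q * \<tau>"
proof -
  interpret Q: vector_space rat_scale by (rule vector_space_rat_scale)
  have dim: "Q.dim K = 2" and one: "1 \<in> K"
    using K by (auto simp: imaginary_quadratic_field_def subfield_of_complex_def)
  obtain B where B: "B \<subseteq> K" "Q.independent B" "K \<subseteq> Q.span B" "card B = Q.dim K"
    using Q.basis_exists[of K] by metis
  have finB: "finite B" using B(4) dim by (metis card.infinite zero_neq_numeral)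
  have span_mem: "\<exists>p q :: rat. v = of_rat p + of_rat q * \<tau>" if v: "v \<in> Q.span {1, \<tau>}" for v
  proof -
    from v obtain k where "v - rat_scale k 1 \<in> Q.span {\<tau>}"
      using Q.span_breakdown_eq by blast
    then obtain l where "v - rat_scale k 1 - rat_scale l \<tau> \<in> Q.span {}"
      using Q.span_breakdown_eq by blast
    then have "v = of_rat k + of_rat l * \<tau>" by (simp add: rat_scale_def algebra_simps)
    then show ?thesis by blast
  qed
  have ind1: "Q.independent {1}" by simp
  have ind2: "Q.independent {1, \<tau>}"
  proof -
    have "\<tau> \<notin> Q.span {1}"
    proof
      assume "\<tau> \<in> Q.span {1}"
      then obtain k where "\<tau> - rat_scale k 1 \<in> Q.span {}" using Q.span_breakdown_eq by blast
      then have "\<tau> = of_rat k" by (simp add: rat_scale_def)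
      then show False using tR by (cases k) (simp add: of_rat_rat complex_is_Real_iff)
    qed
    then show ?thesis using ind1 Q.independent_insertI[of \<tau> "{1}"] by (simp add: insert_commute)
  qed
  have "z \<in> Q.span {1, \<tau>}"
  proof (rule ccontr)
    assume nz: "z \<notin> Q.span {1, \<tau>}"
    then have ind3: "Q.independent {z, 1, \<tau>}" using Q.independent_insertI[OF nz ind2] by simp
    have "{z, 1, \<tau>} \<subseteq> Q.span B" using B(3) zK tK one by auto
    from Q.independent_span_bound[OF finB ind3 this] have "card {z, 1, \<tau>} \<le> 2" using B(4) dim by simp
    moreover have "z \<noteq> 1" "z \<noteq> \<tau>" using nz Q.span_base[of 1 "{1, \<tau>}"] Q.span_base[of \<tau> "{1, \<tau>}"] by auto
    moreover have "\<tau> \<noteq> 1" using tR by auto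
    ultimately show False by simp
  qed
  then show ?thesis by (rule span_mem)
qed

lemma of_rat_complex_of_real: "(of_rat q :: complex) = of_real (of_rat q)"
  by (cases q) (simp add: of_rat_rat)

text \<open>A non-real \<open>t\<close> in \<open>K\<close> satisfies \<open>t^2 = p + q t\<close> with rational \<open>p\<close>, \<open>q\<close>; comparing real and
  imaginary parts gives \<open>2 Re t = q\<close> and \<open>|t|^2 = - p\<close>. Both quantities are then rational for every
  rational combination of 1 and \<open>t\<close>.\<close>

lemma quadratic_field_trace_norm:
  assumes K: "imaginary_quadratic_field K" and zK: "z \<in> K"
  shows "2 * Re z \<in> \<rat>" "(cmod z)\<^sup>2 \<in> \<rat>"
proof -
  obtain t where t: "t \<in> K" "t \<notin> \<real>" using K by (auto simp: imaginary_quadratic_field_def)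
  have tt: "t * t \<in> K" using K t by (auto simp: imaginary_quadratic_field_def subfield_of_complex_def)
  obtain p q :: rat where pq: "t * t = of_rat p + of_rat q * t"
    using quadratic_field_span[OF K t tt] by auto
  have im0: "Im t \<noteq> 0" using t(2) complex_is_Real_iff by blast
  have "Im (t * t) = of_rat q * Im t" "Re (t * t) = of_rat p + of_rat q * Re t"
    unfolding pq by (simp_all add: of_rat_complex_of_real)
  then have q: "2 * Re t = of_rat q" using im0 by (simp add: field_simps)
  moreover have "Re t * Re t - Im t * Im t = of_rat p + of_rat q * Re t"
    using \<open>Re (t * t) = of_rat p + of_rat q * Re t\<close> by simp
  ultimately have n: "(cmod t)\<^sup>2 = - of_rat p"
    by (simp add: cmod_power2 power2_eq_square[of "Re t"] power2_eq_square[of "Im t"] algebra_simps flip: q)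
  obtain a b :: rat where z: "z = of_rat a + of_rat b * t"
    using quadratic_field_span[OF K t zK] by auto
  have "2 * Re z = 2 * of_rat a + of_rat b * (2 * Re t)" by (simp add: z of_rat_complex_of_real)
  also have "\<dots> = of_rat (2 * a + b * q)" by (simp add: q of_rat_add of_rat_mult)
  finally show "2 * Re z \<in> \<rat>" by simp
  have "(cmod z)\<^sup>2 = of_rat a ^ 2 + of_rat a * of_rat b * (2 * Re t) + of_rat b ^ 2 * (cmod t)\<^sup>2"
    by (simp add: z cmod_power2 of_rat_complex_of_real) (simp add: power2_eq_square algebra_simps)
  also have "\<dots> = of_rat (a ^ 2 + a * b * q + b ^ 2 * (- p))"
    by (simp add: q n of_rat_add of_rat_mult of_rat_power of_rat_minus of_rat_diff)
  finally show "(cmod z)\<^sup>2 \<in> \<rat>" by simp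
qed

lemma complex_square_trace_norm:
  "z * z = of_real (2 * Re z) * z - of_real ((cmod z)\<^sup>2)"
  by (simp add: complex_eq_iff cmod_power2) (simp add: power2_eq_square algebra_simps)

lemma of_int_linear_complex_eq_0:
  assumes "Im z \<noteq> 0" "of_int a + z * of_int b = 0"
  shows "a = 0" "b = 0"
proof -
  have "Im (of_int a + z * of_int b) = 0" using assms(2) by simp
  then show "b = 0" using assms(1) by simp
  then show "a = 0" using assms(2) by simp
qed

lemma map_poly_of_int_mult:
  "map_poly (of_int :: int \<Rightarrow> complex) (p * q) = map_poly of_int p * map_poly of_int q"
  by (rule poly_eqI) (simp add: coeff_map_poly coeff_mult)

lemma map_poly_of_int_add:
  "map_poly (of_int :: int \<Rightarrow> complex) (p + q) = map_poly of_int p + map_poly of_int q"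
  by (rule poly_eqI) (simp add: coeff_map_poly)

lemma map_poly_of_int_smult:
  "map_poly (of_int :: int \<Rightarrow> complex) (smult c q) = smult (of_int c) (map_poly of_int q)"
  by (rule poly_eqI) (simp add: coeff_map_poly)

text \<open>Gauss's lemma for a quadratic factor. The polynomial \<open>x^2 - 2 Re(z) x + |z|^2\<close> is rescaled to a
  primitive integer polynomial \<open>g\<close>. Pseudo-division of a monic integer polynomial \<open>P\<close> with root \<open>z\<close>
  by \<open>g\<close> leaves a remainder of degree at most 1 with the non-real root \<open>z\<close>, hence no remainder;
  comparing contents gives \<open>P = u g q'\<close> with a unit \<open>u\<close>, so the leading coefficient of \<open>g\<close> is a unit.\<close>

lemma algebraic_int_trace_norm:
  assumes alg: "algebraic_int z" and im: "Im z \<noteq> 0"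
    and tr: "2 * Re z \<in> \<rat>" and no: "(cmod z)\<^sup>2 \<in> \<rat>"
  shows "2 * Re z \<in> \<int>" "(cmod z)\<^sup>2 \<in> \<int>"
proof -
  obtain a b :: int where ab: "b > 0" "2 * Re z = of_int a / of_int b"
    using tr by (auto elim!: Rats_cases')
  obtain c e :: int where ce: "e > 0" "(cmod z)\<^sup>2 = of_int c / of_int e"
    using no by (auto elim!: Rats_cases')
  define g0 where "g0 = [:c * b, - (a * e), b * e:]"
  have zz: "z * z = of_int a / of_int b * z - of_int c / of_int e"
    using complex_square_trace_norm[of z] unfolding ab ce by simp
  have g0z: "poly (map_poly of_int g0) z = 0"
  proof -
    have "poly (map_poly of_int g0) z = of_int (c * b) - of_int (a * e) * z + of_int (b * e) * (z * z)"
      by (simp add: g0_def map_poly_pCons algebra_simps)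
    also have "\<dots> = 0" unfolding zz using ab(1) ce(1) by (simp add: field_simps)
    finally show ?thesis .
  qed
  have be: "b * e \<noteq> 0" using ab ce by simp
  have dg0: "degree g0 = 2" using be by (simp add: g0_def)
  then have g00: "g0 \<noteq> 0" by auto
  define g where "g = primitive_part g0"
  have g0g: "g0 = smult (content g0) g" by (simp add: g_def)
  have cg: "content g = 1" using g00 by (simp add: g_def)
  have cg0: "content g0 \<noteq> 0" using g00 by simp
  have dg: "degree g = 2" using dg0 by (simp add: g_def)
  have gz: "poly (map_poly of_int g) z = 0"
    using g0z cg0 by (subst (asm) g0g) (simp add: map_poly_of_int_smult)
  have gnz: "g \<noteq> 0" using dg by auto
  obtain P :: "int poly" where P: "poly (map_poly of_int P) z = 0" "lead_coeff P = 1"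
    using alg unfolding algebraic_int_altdef_ipoly by auto
  obtain q r where qr: "pseudo_divmod P g = (q, r)" by fastforce
  define E where "E = coeff g 2"
  define k where "k = Suc (degree P) - degree g"
  have E0: "E \<noteq> 0" using gnz dg by (metis E_def leading_coeff_0_iff)
  have eq: "smult (E ^ k) P = g * q + r"
    using pseudo_divmod(1)[OF gnz qr] by (simp add: E_def k_def dg)
  have rz: "poly (map_poly of_int r) z = 0"
    using arg_cong[OF eq, of "\<lambda>p. poly (map_poly of_int p) z"] P(1) gz
    by (simp add: map_poly_of_int_smult map_poly_of_int_add map_poly_of_int_mult)
  have r0: "r = 0"
  proof (rule ccontr)
    assume "r \<noteq> 0"
    then have "degree r \<le> 1" using pseudo_divmod(2)[OF gnz qr] dg by auto
    then have "r = [:coeff r 0, coeff r 1:]"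
      by (intro poly_eqI) (auto simp: coeff_pCons coeff_eq_0 split: nat.splits)
    then obtain r0 r1 where r: "r = [:r0, r1:]" by blast
    have "of_int r0 + z * of_int r1 = 0" using rz by (simp add: r map_poly_pCons)
    from of_int_linear_complex_eq_0[OF im this] show False using \<open>r \<noteq> 0\<close> r by simp
  qed
  have cP: "content P = 1"
  proof -
    have "content P dvd lead_coeff P" by (rule content_dvd_coeff)
    then have "is_unit (content P)" using P(2) by simp
    then have "normalize (content P) = 1" by (rule is_unit_normalize)
    then show ?thesis by (simp only: normalize_content)
  qed
  have cont: "content q = normalize (E ^ k)"
    using arg_cong[OF eq, of content] by (simp add: r0 content_mult cg cP)
  then have "content q = \<bar>E ^ k\<bar>" by simp
  then have "\<exists>u. is_unit u \<and> content q = u * E ^ k"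
    by (intro exI[of _ "if E ^ k \<ge> 0 then 1 else -1"]) auto
  then obtain u where u: "is_unit u" "content q = u * E ^ k" by auto
  have "smult (E ^ k) P = smult (E ^ k) (smult u (g * primitive_part q))"
  proof -
    have "smult (E ^ k) P = g * smult (content q) (primitive_part q)" using eq r0 by simp
    then show ?thesis unfolding u(2) by (simp add: mult_ac)
  qed
  then have "smult (E ^ k) (P - smult u (g * primitive_part q)) = 0" by (simp add: smult_diff_right)
  then have "P = smult u (g * primitive_part q)" using E0 by simp
  then have "1 = u * (lead_coeff g * lead_coeff (primitive_part q))"
    using P(2) by (metis lead_coeff_mult lead_coeff_smult)
  then have "1 = E * (u * lead_coeff (primitive_part q))" by (simp only: E_def dg mult_ac)
  then have "is_unit E" by (rule dvdI)
  then have E1: "E = 1 \<or> E = -1" by auto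
  obtain g0' g1 where g: "g = [:g0', g1, E:]"
  proof -
    have "g = [:coeff g 0, coeff g 1, coeff g 2:]"
      by (rule poly_eqI) (auto simp: coeff_pCons numeral_2_eq_2 dg coeff_eq_0 split: nat.splits)
    then show ?thesis using that E_def by metis
  qed
  have "of_int g0' + z * of_int g1 + of_int E * (z * z) = 0"
    using gz by (simp add: g map_poly_pCons algebra_simps)
  then have "of_real (of_int g0' - of_int E * (cmod z)\<^sup>2) + z * of_real (of_int g1 + of_int E * (2 * Re z)) = 0"
    unfolding complex_square_trace_norm[of z] by (simp add: algebra_simps)
  then have h1: "of_int g1 + of_int E * (2 * Re z) = 0" and h2: "of_int g0' - of_int E * (cmod z)\<^sup>2 = 0"
    using im by (auto simp: complex_eq_iff)
  have "2 * Re z = of_int (- E * g1)" using h1 E1 by auto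
  then show "2 * Re z \<in> \<int>" by (metis Ints_of_int)
  have "(cmod z)\<^sup>2 = of_int (E * g0')" using h2 E1 by auto
  then show "(cmod z)\<^sup>2 \<in> \<int>" by (metis Ints_of_int)
qed


lemma rational_square_in_Ints:
  fixes x :: real
  assumes "x \<in> \<rat>" "x\<^sup>2 \<in> \<int>"
  shows "x \<in> \<int>"
proof -
  obtain m :: int where m: "x\<^sup>2 = of_int m" using assms(2) by (auto elim: Ints_cases)
  have "algebraic_int x"
    by (rule algebraic_int.intros[of "[:- of_int m, 0, 1:]"])
       (use m in \<open>auto simp: coeff_pCons power2_eq_square split: nat.splits\<close>)
  then show ?thesis using assms(1) rational_algebraic_int_is_int by blast
qed

lemma ring_of_integers_iff:
  assumes K: "imaginary_quadratic_field K"
  shows "z \<in> ring_of_integers K \<longleftrightarrow> z \<in> K \<and> 2 * Re z \<in> \<int> \<and> (cmod z)\<^sup>2 \<in> \<int>"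
proof safe
  assume "z \<in> ring_of_integers K"
  then have z: "z \<in> K" "algebraic_int z" by (auto simp: ring_of_integers_def)
  show "z \<in> K" by fact
  note r = quadratic_field_trace_norm[OF K z(1)]
  have *: "2 * Re z \<in> \<int> \<and> (cmod z)\<^sup>2 \<in> \<int>"
  proof (cases "Im z = 0")
    case False
    then show ?thesis using algebraic_int_trace_norm[OF z(2) _ r] by auto
  next
    case True
    then have zr: "z = of_real (Re z)" by (simp add: complex_eq_iff)
    have "algebraic_int (of_real (Re z) :: complex)" using z(2) zr by simp
    then have "algebraic_int (Re z)" by simp
    moreover have "Re z \<in> \<rat>"
    proof -
      have "(2 * Re z) / 2 \<in> \<rat>" using r(1) by (intro Rats_divide) auto
      then show ?thesis by simp
    qed
    ultimately have "Re z \<in> \<int>" using rational_algebraic_int_is_int by blast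
    then show ?thesis using True by (auto simp: cmod_power2)
  qed
  show "2 * Re z \<in> \<int>" "(cmod z)\<^sup>2 \<in> \<int>" using * by auto
next
  assume z: "z \<in> K" "2 * Re z \<in> \<int>" "(cmod z)\<^sup>2 \<in> \<int>"
  then obtain t n :: int where tn: "2 * Re z = of_int t" "(cmod z)\<^sup>2 = of_int n"
    by (auto elim!: Ints_cases)
  have zz: "z * z = of_int t * z - of_int n"
    using complex_square_trace_norm[of z] unfolding tn by simp
  have "algebraic_int z"
    by (rule algebraic_int.intros[of "[:of_int n, - of_int t, 1:]"])
       (use zz in \<open>auto simp: coeff_pCons algebra_simps split: nat.splits\<close>)
  then show "z \<in> ring_of_integers K" using z by (simp add: ring_of_integers_def)
qed

text \<open>This is what closes the ring of integers under addition. Half of \<open>2 Re (z cnj w)\<close> is built from the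
  traces \<open>t\<close>, \<open>u\<close> and from \<open>k = 4 Im z Im w\<close>. The number \<open>k\<close> is rational because \<open>Im z\<close> is a rational
  multiple of \<open>Im w\<close>, and \<open>k^2 = (4n - t^2)(4m - u^2)\<close> is an integer, so \<open>k\<close> is an integer; the same
  identity modulo 2 shows that \<open>t u + k\<close> is even.\<close>

lemma trace_form_in_Ints:
  assumes K: "imaginary_quadratic_field K"
    and z: "z \<in> ring_of_integers K" and w: "w \<in> ring_of_integers K"
  shows "2 * Re (z * cnj w) \<in> \<int>"
proof -
  have z': "z \<in> K" "2 * Re z \<in> \<int>" "(cmod z)\<^sup>2 \<in> \<int>" using z ring_of_integers_iff[OF K] by auto
  have w': "w \<in> K" "2 * Re w \<in> \<int>" "(cmod w)\<^sup>2 \<in> \<int>" using w ring_of_integers_iff[OF K] by auto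
  obtain t n :: int where tn: "2 * Re z = of_int t" "(cmod z)\<^sup>2 = of_int n"
    using z' by (auto elim!: Ints_cases)
  obtain u m :: int where um: "2 * Re w = of_int u" "(cmod w)\<^sup>2 = of_int m"
    using w' by (auto elim!: Ints_cases)
  define k where "k = 4 * Im z * Im w"
  have iz: "4 * (Im z)\<^sup>2 = of_int (4 * n - t\<^sup>2)"
    using tn by (simp add: cmod_power2 flip: tn)
  have iw: "4 * (Im w)\<^sup>2 = of_int (4 * m - u\<^sup>2)"
    using um by (simp add: cmod_power2 flip: um)
  have "k\<^sup>2 = (4 * (Im z)\<^sup>2) * (4 * (Im w)\<^sup>2)" by (simp add: k_def power2_eq_square)
  then have k2: "k\<^sup>2 = of_int ((4 * n - t\<^sup>2) * (4 * m - u\<^sup>2))" unfolding iz iw by simp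
  have "k \<in> \<rat>"
  proof (cases "w \<in> \<real>")
    case True
    then show ?thesis by (simp add: k_def complex_is_Real_iff)
  next
    case False
    obtain p q :: rat where pq: "z = of_rat p + of_rat q * w"
      using quadratic_field_span[OF K w'(1) False z'(1)] by auto
    have "k = of_rat q * (4 * (Im w)\<^sup>2)"
      by (simp add: k_def pq of_rat_complex_of_real power2_eq_square)
    then show ?thesis unfolding iw by simp
  qed
  then have "k \<in> \<int>" using rational_square_in_Ints k2 by (metis Ints_of_int)
  then obtain l where l: "k = of_int l" by (auto elim: Ints_cases)
  have "of_int (l\<^sup>2) = (of_int ((4 * n - t\<^sup>2) * (4 * m - u\<^sup>2)) :: real)" using k2 by (simp add: l)
  then have "l\<^sup>2 = (4 * n - t\<^sup>2) * (4 * m - u\<^sup>2)" by linarith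
  then have "even (l\<^sup>2) \<longleftrightarrow> even (t\<^sup>2 * u\<^sup>2)" by simp
  then have "even (t * u + l)" by simp
  then obtain j where j: "t * u + l = 2 * j" unfolding dvd_def by blast
  have "2 * (2 * Re (z * cnj w)) = (2 * Re z) * (2 * Re w) + k" by (simp add: k_def)
  also have "\<dots> = of_int (t * u + l)" unfolding tn um l by simp
  also have "\<dots> = 2 * of_int j" unfolding j by simp
  finally have "2 * Re (z * cnj w) = of_int j" by linarith
  then show ?thesis by (metis Ints_of_int)
qed

lemma ring_of_integers_add:
  assumes K: "imaginary_quadratic_field K"
    and z: "z \<in> ring_of_integers K" and w: "w \<in> ring_of_integers K"
  shows "z + w \<in> ring_of_integers K"
proof -
  have "(cmod (z + w))\<^sup>2 = (cmod z)\<^sup>2 + (cmod w)\<^sup>2 + 2 * Re (z * cnj w)"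
    by (simp add: cmod_power2) (simp add: power2_eq_square algebra_simps)
  moreover have "z + w \<in> K"
    using K z w by (auto simp: imaginary_quadratic_field_def subfield_of_complex_def ring_of_integers_def)
  ultimately show ?thesis
    using trace_form_in_Ints[OF K z w] z w unfolding ring_of_integers_iff[OF K]
    by (auto simp: algebra_simps)
qed

lemma of_int_in_field:
  assumes K: "imaginary_quadratic_field K"
  shows "of_int m \<in> K"
proof -
  have S: "0 \<in> K" "1 \<in> K" "\<And>x y. x \<in> K \<Longrightarrow> y \<in> K \<Longrightarrow> x + y \<in> K" "\<And>x. x \<in> K \<Longrightarrow> - x \<in> K"
    using K by (auto simp: imaginary_quadratic_field_def subfield_of_complex_def)
  have nat: "of_nat n \<in> K" for n by (induction n) (use S in auto)
  show ?thesis
  proof (cases m)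
    case (nonneg n)
    then show ?thesis using nat by simp
  next
    case (neg n)
    then show ?thesis using S(4)[OF nat[of "Suc n"]] by (simp del: of_nat_Suc)
  qed
qed

lemma ring_of_integers_scale:
  assumes K: "imaginary_quadratic_field K" and z: "z \<in> ring_of_integers K"
  shows "of_int m * z \<in> ring_of_integers K"
proof -
  have "of_int m * z \<in> K"
    using K of_int_in_field[OF K, of m] z
    by (auto simp: imaginary_quadratic_field_def subfield_of_complex_def ring_of_integers_def)
  moreover have "2 * Re (of_int m * z) = of_int m * (2 * Re z)" by simp
  moreover have "(cmod (of_int m * z))\<^sup>2 = (of_int m)\<^sup>2 * (cmod z)\<^sup>2"
    by (simp add: norm_mult power_mult_distrib)
  ultimately show ?thesis
    using z unfolding ring_of_integers_iff[OF K] by (metis Ints_mult Ints_of_int Ints_power)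
qed

lemma of_int_in_ring_of_integers:
  assumes K: "imaginary_quadratic_field K"
  shows "of_int m \<in> ring_of_integers K"
  using of_int_in_field[OF K] by (simp add: ring_of_integers_def)

lemma ring_of_integers_real:
  assumes K: "imaginary_quadratic_field K" and z: "z \<in> ring_of_integers K" and "Im z = 0"
  shows "\<exists>m. z = of_int m"
proof -
  have re: "Re z = 2 * Re z / 2" by simp
  have "2 * Re z \<in> \<int>" using z unfolding ring_of_integers_iff[OF K] by blast
  then have "2 * Re z \<in> \<rat>" using Ints_subset_Rats by blast
  then have "Re z \<in> \<rat>" by (subst re) (rule Rats_divide, assumption, rule Rats_number_of)
  moreover have "(Re z)\<^sup>2 \<in> \<int>"
    using z assms(3) unfolding ring_of_integers_iff[OF K] by (simp add: cmod_power2)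
  ultimately have "Re z \<in> \<int>" by (rule rational_square_in_Ints)
  then show ?thesis using assms(3) by (auto elim!: Ints_cases simp: complex_eq_iff)
qed

lemma ring_of_integers_nonreal:
  assumes K: "imaginary_quadratic_field K"
  shows "\<exists>z\<in>ring_of_integers K. Im z > 0"
proof -
  obtain t where t: "t \<in> K" "t \<notin> \<real>" using K by (auto simp: imaginary_quadratic_field_def)
  have im: "Im t \<noteq> 0" using t complex_is_Real_iff by blast
  obtain a b :: int where ab: "b > 0" "2 * Re t = of_int a / of_int b"
    using quadratic_field_trace_norm(1)[OF K t(1)] by (auto elim!: Rats_cases')
  obtain c e :: int where ce: "e > 0" "(cmod t)\<^sup>2 = of_int c / of_int e"
    using quadratic_field_trace_norm(2)[OF K t(1)] by (auto elim!: Rats_cases')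
  \<comment> \<open>A common denominator, with the sign that puts the multiple into the upper half-plane.\<close>
  define E where "E = (if Im t > 0 then b * e else - (b * e))"
  have E: "\<bar>E\<bar> = b * e" using ab ce by (simp add: E_def)
  have "b dvd E" "e dvd E" by (auto simp: E_def)
  then obtain b' e' where be: "E = b * b'" "E = e * e'" unfolding dvd_def by blast
  define z where "z = of_int E * t"
  have "z \<in> K"
    using K of_int_in_field[OF K, of E] t
    by (auto simp: imaginary_quadratic_field_def subfield_of_complex_def z_def)
  moreover have "2 * Re z = of_int E * (2 * Re t)" by (simp add: z_def)
  then have "2 * Re z = of_int (b' * a)" unfolding ab(2) be(1) using ab(1) by simp
  moreover have "(cmod z)\<^sup>2 = of_int E * of_int E * (cmod t)\<^sup>2"
    by (simp add: z_def norm_mult power_mult_distrib power2_eq_square)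
  then have "(cmod z)\<^sup>2 = of_int E * of_int e' * of_int c" unfolding ce(2) using be(2) ce(1) by simp
  then have "(cmod z)\<^sup>2 = of_int (E * e' * c)" by simp
  ultimately have "z \<in> ring_of_integers K"
    unfolding ring_of_integers_iff[OF K] by (metis Ints_of_int)
  moreover have "Im z > 0"
  proof -
    have "real_of_int (b * e) > 0" using ab ce by simp
    then show ?thesis using im by (auto simp: z_def E_def not_less mult_less_0_iff)
  qed
  ultimately show ?thesis by blast
qed

text \<open>The squares \<open>4 (Im z)^2\<close> are integers, so some integral \<open>\<omega>\<close> has the least positive imaginary part.
  Subtracting a multiple of \<open>\<omega>\<close> from an integral \<open>z\<close> makes its imaginary part vanish, and a real
  integral element of the field is a rational integer.\<close>

lemma ring_of_integers_monogenic:
  assumes K: "imaginary_quadratic_field K"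
  obtains \<omega> where "\<omega> \<in> ring_of_integers K" "Im \<omega> > 0" "integral_basis K 1 \<omega>"
proof -
  have int4: "4 * (Im z)\<^sup>2 \<in> \<int>" if "z \<in> ring_of_integers K" for z
  proof -
    have "4 * (Im z)\<^sup>2 = 4 * (cmod z)\<^sup>2 - (2 * Re z)\<^sup>2" by (simp add: cmod_power2)
    moreover have "4 * (cmod z)\<^sup>2 - (2 * Re z)\<^sup>2 \<in> \<int>"
      using that Ints_power[of "2 * Re z" 2] unfolding ring_of_integers_iff[OF K]
      by (intro Ints_diff Ints_mult) auto
    ultimately show ?thesis by simp
  qed
  define P where "P k \<longleftrightarrow> (\<exists>z\<in>ring_of_integers K. Im z > 0 \<and> 4 * (Im z)\<^sup>2 = real k)" for k :: nat
  have Pz: "P (nat \<lfloor>4 * (Im z)\<^sup>2\<rfloor>)" if "z \<in> ring_of_integers K" "Im z > 0" for z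
  proof -
    have "4 * (Im z)\<^sup>2 \<in> \<int>" by (rule int4[OF that(1)])
    then obtain j where j: "4 * (Im z)\<^sup>2 = of_int j" by (auto elim: Ints_cases)
    then have "real (nat j) = of_int j" by (metis of_nat_nat of_int_0_le_iff zero_le_mult_iff zero_le_numeral zero_le_power2 of_int_of_nat_eq)
    then show ?thesis unfolding P_def using that j by (intro bexI[of _ z]) auto
  qed
  then have "\<exists>k. P k" using ring_of_integers_nonreal[OF K] by blast
  then have "P (LEAST k. P k)" by (rule LeastI_ex)
  then obtain w where w: "w \<in> ring_of_integers K" "Im w > 0" "4 * (Im w)\<^sup>2 = real (LEAST k. P k)"
    unfolding P_def by blast
  have min: "Im w \<le> Im z" if z: "z \<in> ring_of_integers K" "Im z > 0" for z
  proof -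
    have "(LEAST k. P k) \<le> nat \<lfloor>4 * (Im z)\<^sup>2\<rfloor>" using Pz[OF z] by (rule Least_le)
    then have "real (LEAST k. P k) \<le> real (nat \<lfloor>4 * (Im z)\<^sup>2\<rfloor>)" by (simp only: of_nat_le_iff)
    also have "\<dots> \<le> 4 * (Im z)\<^sup>2" by (rule of_nat_floor) simp
    finally have "4 * (Im w)\<^sup>2 \<le> 4 * (Im z)\<^sup>2" unfolding w(3) .
    then have "(Im w)\<^sup>2 \<le> (Im z)\<^sup>2" by simp
    then show ?thesis by (rule power2_le_imp_le) (rule less_imp_le[OF z(2)])
  qed
  have "\<exists>m n. z = of_int m * 1 + of_int n * w" if z: "z \<in> ring_of_integers K" for z
  proof -
    define n where "n = \<lfloor>Im z / Im w\<rfloor>"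
    define v where "v = z + of_int (- n) * w"
    have v: "v \<in> ring_of_integers K"
      unfolding v_def by (intro ring_of_integers_add[OF K] z ring_of_integers_scale[OF K] w)
    have "of_int n \<le> Im z / Im w" "Im z / Im w < of_int n + 1" unfolding n_def by linarith+
    then have "0 \<le> Im v" "Im v < Im w" using w(2) by (auto simp: v_def field_simps)
    then have "Im v = 0" using min[OF v] by linarith
    then obtain m where "v = of_int m" using ring_of_integers_real[OF K v] by auto
    then have "z = of_int m * 1 + of_int n * w" by (simp add: v_def algebra_simps)
    then show ?thesis by blast
  qed
  then have sur: "ring_of_integers K \<subseteq> range (\<lambda>(m::int, n::int). of_int m * 1 + of_int n * w)" by fastforce
  have "range (\<lambda>(m::int, n::int). of_int m * 1 + of_int n * w) \<subseteq> ring_of_integers K"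
    using ring_of_integers_add[OF K] of_int_in_ring_of_integers[OF K] ring_of_integers_scale[OF K] w(1) by auto
  moreover have "inj (\<lambda>(m::int, n::int). of_int m * 1 + of_int n * w)"
    using w(2) by (auto simp: inj_def complex_eq_iff)
  ultimately have "integral_basis K 1 w"
    unfolding integral_basis_def bij_betw_def using sur by blast
  then show ?thesis using that w by blast
qed

text \<open>Well-definedness of the discriminant: the determinants of two integral bases are integer multiples
  of each other, and the two multipliers have product 1, so they are signs.\<close>

lemma discriminant_eq:
  assumes B: "integral_basis K \<omega>\<^sub>1 \<omega>\<^sub>2"
    and D: "of_int D = (\<omega>\<^sub>1 * cnj \<omega>\<^sub>2 - \<omega>\<^sub>2 * cnj \<omega>\<^sub>1)\<^sup>2" and D0: "D \<noteq> 0"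
  shows "discriminant K = D"
  unfolding discriminant_def
proof (rule the_equality)
  show "\<exists>\<omega>\<^sub>1 \<omega>\<^sub>2. integral_basis K \<omega>\<^sub>1 \<omega>\<^sub>2 \<and> of_int D = (\<omega>\<^sub>1 * cnj \<omega>\<^sub>2 - \<omega>\<^sub>2 * cnj \<omega>\<^sub>1)\<^sup>2"
    using B D by blast
next
  let ?det = "\<lambda>x y :: complex. x * cnj y - y * cnj x"
  have change: "\<exists>d::int. ?det y1 y2 = of_int d * ?det x1 x2"
    if x: "integral_basis K x1 x2" and y: "integral_basis K y1 y2" for x1 x2 y1 y2
  proof -
    have ry: "y1 \<in> ring_of_integers K" "y2 \<in> ring_of_integers K"
      using y unfolding integral_basis_def bij_betw_def
      using rangeI[of "\<lambda>(m::int, n::int). of_int m * y1 + of_int n * y2" "(1, 0)"]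
        rangeI[of "\<lambda>(m::int, n::int). of_int m * y1 + of_int n * y2" "(0, 1)"] by auto
    have coord: "\<exists>a b :: int. v = of_int a * x1 + of_int b * x2" if "v \<in> ring_of_integers K" for v
    proof -
      have "v \<in> range (\<lambda>(m::int, n::int). of_int m * x1 + of_int n * x2)"
        using that x by (simp add: integral_basis_def bij_betw_def)
      then show ?thesis by auto
    qed
    from coord[OF ry(1)] coord[OF ry(2)] obtain a b c d :: int
      where "y1 = of_int a * x1 + of_int b * x2" "y2 = of_int c * x1 + of_int d * x2" by blast
    then have "?det y1 y2 = of_int (a * d - b * c) * ?det x1 x2" by (simp add: algebra_simps)
    then show ?thesis by blast
  qed
  fix D' assume "\<exists>\<omega>\<^sub>1 \<omega>\<^sub>2. integral_basis K \<omega>\<^sub>1 \<omega>\<^sub>2 \<and> of_int D' = (\<omega>\<^sub>1 * cnj \<omega>\<^sub>2 - \<omega>\<^sub>2 * cnj \<omega>\<^sub>1)\<^sup>2"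
  then obtain v1 v2 where v: "integral_basis K v1 v2" "of_int D' = (?det v1 v2)\<^sup>2" by blast
  obtain d where d: "?det v1 v2 = of_int d * ?det \<omega>\<^sub>1 \<omega>\<^sub>2" using change[OF B v(1)] by blast
  obtain e where e: "?det \<omega>\<^sub>1 \<omega>\<^sub>2 = of_int e * ?det v1 v2" using change[OF v(1) B] by blast
  have nz: "?det \<omega>\<^sub>1 \<omega>\<^sub>2 \<noteq> 0" using D D0 by auto
  have "?det \<omega>\<^sub>1 \<omega>\<^sub>2 = of_int (e * d) * ?det \<omega>\<^sub>1 \<omega>\<^sub>2"
    by (subst e, subst d) simp
  then have "of_int (e * d) = (1::complex)" using nz by simp
  then have "e * d = 1" by (simp only: of_int_eq_1_iff)
  then have "d\<^sup>2 = 1" by (auto simp: zmult_eq_1_iff)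
  then have "of_int D' = (of_int D :: complex)"
    unfolding v(2) D d by (simp add: power_mult_distrib flip: of_int_power)
  then show "D' = D" by simp
qed

text \<open>
  The parity of the discriminant is that of the trace of a generator \<open>\<omega>\<close>: when it is even, \<open>\<omega>\<close> can
  be translated by an integer to a purely imaginary number, and the ring of integers becomes a
  rectangular lattice.\<close>

lemma ring_of_integers_rectangular:
  assumes K: "imaginary_quadratic_field K" and D: "[discriminant K = 0] (mod 4)"
  obtains y :: real where "0 < y" "\<bar>real_of_int (discriminant K)\<bar> = 4 * y\<^sup>2"
    "bij_betw (\<lambda>(m::int, n::int). Complex (of_int m) (y * of_int n)) UNIV (ring_of_integers K)"
proof -
  obtain w where w: "w \<in> ring_of_integers K" "Im w > 0" "integral_basis K 1 w"
    using ring_of_integers_monogenic[OF K] by blast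
  obtain t n :: int where tn: "2 * Re w = of_int t" "(cmod w)\<^sup>2 = of_int n"
    using w unfolding ring_of_integers_iff[OF K] by (auto elim!: Ints_cases)
  have im: "4 * (Im w)\<^sup>2 = of_int (4 * n - t\<^sup>2)"
    using tn by (simp add: cmod_power2 flip: tn)
  have "1 * cnj w - w * cnj 1 = Complex 0 (- 2 * Im w)" by (simp add: complex_eq_iff)
  then have "(1 * cnj w - w * cnj 1)\<^sup>2 = - of_real (4 * (Im w)\<^sup>2)"
    by (simp add: complex_eq_iff power2_eq_square)
  then have det: "of_int (t\<^sup>2 - 4 * n) = (1 * cnj w - w * cnj 1)\<^sup>2" unfolding im by simp
  have neg: "real_of_int (t\<^sup>2 - 4 * n) < 0" proof -
    have "0 < 4 * (Im w)\<^sup>2" using w(2) by simp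
    then show ?thesis unfolding im by simp
  qed
  then have neg': "t\<^sup>2 - 4 * n < 0" by linarith
  have disc: "discriminant K = t\<^sup>2 - 4 * n"
    by (rule discriminant_eq[OF w(3) det]) (use neg' in simp)
  have "even (t\<^sup>2 - 4 * n)" using D unfolding disc cong_0_iff by (rule dvd_trans[rotated]) simp
  then have "even t" by simp
  then obtain s where s: "t = 2 * s" by (auto elim: evenE)
  have re: "Re w = of_int s" using tn(1) s by simp
  \<comment> \<open>The change of basis from \<open>1, \<omega>\<close> to \<open>1, \<omega> - s\<close>, where \<open>\<omega> - s\<close> is purely imaginary.\<close>
  define g where "g = (\<lambda>(m::int, k::int). (m - s * k, k))"
  have "bij_betw g UNIV UNIV"
    by (rule bij_betwI[where g = "\<lambda>(m, k). (m + s * k, k)"]) (auto simp: g_def)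
  then have "bij_betw ((\<lambda>(m::int, n::int). of_int m * 1 + of_int n * w) \<circ> g) UNIV (ring_of_integers K)"
    using w(3) unfolding integral_basis_def by (rule bij_betw_trans)
  moreover have "(\<lambda>(m::int, n::int). of_int m * 1 + of_int n * w) \<circ> g
      = (\<lambda>(m, n). Complex (of_int m) (Im w * of_int n))"
    by (auto simp: fun_eq_iff g_def complex_eq_iff re)
  moreover have "\<bar>real_of_int (discriminant K)\<bar> = 4 * (Im w)\<^sup>2" using im neg disc by simp
  ultimately show ?thesis using that w(2) by metis
qed

section \<open>Integration in the plane\<close>

abbreviation unit_disc :: "(real \<times> real) set" where
  "unit_disc \<equiv> cball 0 1"

lemma nn_integral_plane:
  fixes f :: "real \<times> real \<Rightarrow> ennreal"
  assumes [measurable]: "f \<in> borel_measurable borel"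
  shows "(\<integral>\<^sup>+u. f u \<partial>lborel) = (\<integral>\<^sup>+y. \<integral>\<^sup>+x. f (x, y) \<partial>lborel \<partial>lborel)"
    and "(\<integral>\<^sup>+u. f u \<partial>lborel) = (\<integral>\<^sup>+x. \<integral>\<^sup>+y. f (x, y) \<partial>lborel \<partial>lborel)"
proof -
  have f: "f \<in> borel_measurable (lborel \<Otimes>\<^sub>M lborel)" by (simp add: lborel_prod)
  show "(\<integral>\<^sup>+u. f u \<partial>lborel) = (\<integral>\<^sup>+y. \<integral>\<^sup>+x. f (x, y) \<partial>lborel \<partial>lborel)"
    using lborel_pair.nn_integral_snd[OF f] by (simp add: lborel_prod)
  show "(\<integral>\<^sup>+u. f u \<partial>lborel) = (\<integral>\<^sup>+x. \<integral>\<^sup>+y. f (x, y) \<partial>lborel \<partial>lborel)"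
    using lborel.nn_integral_fst[OF f] by (simp add: lborel_prod)
qed

lemma nn_integral_shear_fst:
  fixes f :: "real \<times> real \<Rightarrow> ennreal"
  assumes [measurable]: "f \<in> borel_measurable borel"
  shows "(\<integral>\<^sup>+u. f (fst u + a * snd u, snd u) \<partial>lborel) = (\<integral>\<^sup>+u. f u \<partial>lborel)"
proof -
  have [measurable]: "(\<lambda>u::real \<times> real. (fst u + a * snd u, snd u)) \<in> borel \<rightarrow>\<^sub>M borel"
    by (intro borel_measurable_continuous_onI continuous_intros)
  have "(\<integral>\<^sup>+x. f (x + a * y, y) \<partial>lborel) = (\<integral>\<^sup>+x. f (x, y) \<partial>lborel)" for y
    using nn_integral_real_affine[of "\<lambda>x. f (x, y)" 1 "a * y"] by (simp add: add.commute)
  then show ?thesis by (simp add: nn_integral_plane(1))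
qed

lemma nn_integral_shear_snd:
  fixes f :: "real \<times> real \<Rightarrow> ennreal"
  assumes [measurable]: "f \<in> borel_measurable borel"
  shows "(\<integral>\<^sup>+u. f (fst u, snd u + a * fst u) \<partial>lborel) = (\<integral>\<^sup>+u. f u \<partial>lborel)"
proof -
  have [measurable]: "(\<lambda>u::real \<times> real. (fst u, snd u + a * fst u)) \<in> borel \<rightarrow>\<^sub>M borel"
    by (intro borel_measurable_continuous_onI continuous_intros)
  have "(\<integral>\<^sup>+y. f (x, y + a * x) \<partial>lborel) = (\<integral>\<^sup>+y. f (x, y) \<partial>lborel)" for x
    using nn_integral_real_affine[of "\<lambda>y. f (x, y)" 1 "a * x"] by (simp add: add.commute)
  then show ?thesis by (simp add: nn_integral_plane(2))
qed

lemma nn_integral_plane_scale: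
  fixes f :: "real \<times> real \<Rightarrow> ennreal"
  assumes [measurable]: "f \<in> borel_measurable borel" and "r \<noteq> 0"
  shows "(\<integral>\<^sup>+u. f u \<partial>lborel) = ennreal (r\<^sup>2) * (\<integral>\<^sup>+u. f (r *\<^sub>R u) \<partial>lborel)"
  by (subst lborel_affine[OF assms(2), of "0 :: real \<times> real"])
     (simp add: nn_integral_density nn_integral_distr nn_integral_cmult power2_eq_square)

text \<open>A rotation by an angle other than \<open>\<pi>\<close> is a product of three shears, and a shear preserves Lebesgue
  measure by Fubini and translation invariance on the line.\<close>

lemma nn_integral_rotate:
  fixes f :: "real \<times> real \<Rightarrow> ennreal"
  assumes [measurable]: "f \<in> borel_measurable borel" and cs: "c\<^sup>2 + s\<^sup>2 = 1"
  shows "(\<integral>\<^sup>+u. f (c * fst u - s * snd u, s * fst u + c * snd u) \<partial>lborel) = (\<integral>\<^sup>+u. f u \<partial>lborel)"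
proof (cases "s = 0")
  case True
  then have "c = 1 \<or> c = -1" using cs by (simp add: power2_eq_1_iff)
  then show ?thesis
  proof
    assume "c = -1"
    then show ?thesis using True nn_integral_plane_scale[of f "-1"]
      by (simp add: uminus_prod_def scaleR_prod_def flip: uminus_prod_def)
  qed (simp add: True)
next
  case False
  \<comment> \<open>The horizontal shear factor: \<open>a = - tan (\<theta> / 2)\<close> for \<open>c = cos \<theta>\<close>, \<open>s = sin \<theta>\<close>.\<close>
  define a where "a = (c - 1) / s"
  have as: "a * s = c - 1" using False by (simp add: a_def)
  have ac: "a * (1 + c) = - s"
  proof -
    have "s * (a * (1 + c)) = (c - 1) * (1 + c)" using as by (simp add: mult_ac)
    also have "\<dots> = s * (- s)" using cs by (simp add: power2_eq_square algebra_simps)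
    finally show ?thesis using False mult_left_cancel by blast
  qed
  define g where "g u = f (fst u + a * snd u, snd u)" for u
  define h where "h u = g (fst u, snd u + s * fst u)" for u
  have [measurable]: "(\<lambda>u::real \<times> real. (fst u + a * snd u, snd u)) \<in> borel \<rightarrow>\<^sub>M borel"
    "(\<lambda>u::real \<times> real. (fst u, snd u + s * fst u)) \<in> borel \<rightarrow>\<^sub>M borel"
    by (intro borel_measurable_continuous_onI continuous_intros)+
  have [measurable]: "g \<in> borel_measurable borel" unfolding g_def by measurable
  have [measurable]: "h \<in> borel_measurable borel" unfolding h_def by measurable
  have "h (fst u + a * snd u, snd u) = f (c * fst u - s * snd u, s * fst u + c * snd u)" for u
  proof -
    have e1: "snd u + s * (fst u + a * snd u) = s * fst u + c * snd u"
      using as by (simp add: algebra_simps) (metis (no_types, opaque_lifting) mult.left_commute distrib_left mult.commute mult_1 diff_add_cancel add.commute)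
    have "fst u + a * snd u + a * (s * fst u + c * snd u) = fst u * (1 + a * s) + snd u * (a * (1 + c))"
      by (simp add: algebra_simps)
    also have "\<dots> = c * fst u - s * snd u" unfolding as ac by simp
    finally show ?thesis by (simp add: h_def g_def e1)
  qed
  then have "(\<integral>\<^sup>+u. f (c * fst u - s * snd u, s * fst u + c * snd u) \<partial>lborel)
      = (\<integral>\<^sup>+u. h (fst u + a * snd u, snd u) \<partial>lborel)" by simp
  also have "\<dots> = (\<integral>\<^sup>+u. h u \<partial>lborel)" by (rule nn_integral_shear_fst) simp
  also have "\<dots> = (\<integral>\<^sup>+u. g u \<partial>lborel)" unfolding h_def by (rule nn_integral_shear_snd) simp
  also have "\<dots> = (\<integral>\<^sup>+u. f u \<partial>lborel)" unfolding g_def by (rule nn_integral_shear_fst) simp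
  finally show ?thesis .
qed

text \<open>Rotating \<open>h\<close> onto the first axis: an integral over \<open>u\<close> that sees only \<open>|u|\<close> and \<open>u \<bullet> h\<close> depends on
  \<open>h\<close> through \<open>|h|\<close> alone.\<close>

lemma nn_integral_norm_inner:
  fixes F :: "real \<times> real \<Rightarrow> ennreal" and h :: "real \<times> real"
  assumes [measurable]: "F \<in> borel_measurable borel"
  shows "(\<integral>\<^sup>+u. F (norm u, u \<bullet> h) \<partial>lborel) = (\<integral>\<^sup>+u. F (norm u, norm h * fst (u :: real \<times> real)) \<partial>lborel)"
proof (cases "h = 0")
  case False
  define c where "c = fst h / norm h"
  define s where "s = snd h / norm h"
  have nh: "norm h > 0" using False by simp
  have nh2: "(norm h)\<^sup>2 = (fst h)\<^sup>2 + (snd h)\<^sup>2" by (simp add: norm_prod_def)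
  have cs: "c\<^sup>2 + s\<^sup>2 = 1" using nh by (simp add: c_def s_def power_divide nh2[symmetric] flip: add_divide_distrib)
  let ?r = "\<lambda>u::real \<times> real. (c * fst u - s * snd u, s * fst u + c * snd u)"
  have m: "(\<lambda>u :: real \<times> real. (norm u, u \<bullet> h)) \<in> borel \<rightarrow>\<^sub>M borel"
    by (intro borel_measurable_continuous_onI continuous_intros)
  have "(c * x - s * y)\<^sup>2 + (s * x + c * y)\<^sup>2 = (c\<^sup>2 + s\<^sup>2) * (x\<^sup>2 + y\<^sup>2)" for x y
    by (simp add: power2_eq_square algebra_simps)
  then have n: "norm (?r u) = norm u" for u by (simp add: norm_prod_def cs)
  have "fst h * c + snd h * s = norm h"
    using nh nh2 by (simp add: c_def s_def field_simps power2_eq_square)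
  moreover have "snd h * c = fst h * s" by (simp add: c_def s_def)
  moreover have "?r u \<bullet> h = fst u * (fst h * c + snd h * s) + snd u * (snd h * c - fst h * s)" for u
    by (simp add: inner_prod_def algebra_simps)
  ultimately have i: "?r u \<bullet> h = norm h * fst u" for u by simp
  have "(\<integral>\<^sup>+u. F (norm u, u \<bullet> h) \<partial>lborel) = (\<integral>\<^sup>+u. F (norm (?r u), ?r u \<bullet> h) \<partial>lborel)"
    by (rule nn_integral_rotate[OF _ cs, symmetric]) (use m in measurable)
  then show ?thesis unfolding n i .
qed simp

text \<open>Polar coordinates for radial functions. The image of the area measure on the unit disc under the
  norm and the measure \<open>2 \<pi> r dr\<close> on \<open>[0, 1]\<close> give the same mass \<open>\<pi> - \<pi> x^2\<close> to each half-line.\<close>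

lemma nn_integral_radial:
  fixes g :: "real \<Rightarrow> ennreal"
  assumes [measurable]: "g \<in> borel_measurable borel"
  shows "(\<integral>\<^sup>+u. g (norm (u :: real \<times> real)) * indicator unit_disc u \<partial>lborel)
    = (\<integral>\<^sup>+r. g r * (ennreal (2 * pi * r) * indicator {0..1} r) \<partial>lborel)"
proof -
  define M where "M = distr (density lborel (indicator unit_disc)) borel norm"
  define N where "N = density lborel (\<lambda>r. ennreal (2 * pi * r) * indicator {0..1::real} r)"
  have ind: "(indicator unit_disc :: _ \<Rightarrow> ennreal) \<in> borel_measurable lborel"
    by (intro borel_measurable_indicator) simp
  have ball: "emeasure lborel (cball (0 :: real \<times> real) r) = ennreal (pi * r\<^sup>2)" if "0 \<le> r" for r
    using emeasure_cball[of r "0 :: real \<times> real"] that by (simp add: unit_ball_vol_2 power2_eq_square)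
  have M1: "emeasure M {x<..} = emeasure lborel (cball (0 :: real \<times> real) 1 \<inter> {u. norm u > x})" for x
  proof -
    have [measurable]: "{u :: real \<times> real. x < norm u} \<in> sets borel"
      by (intro borel_open open_Collect_less continuous_intros)
    have "emeasure M {x<..} = (\<integral>\<^sup>+u. indicator unit_disc u * indicator {u :: real \<times> real. norm u > x} u \<partial>lborel)"
      by (simp add: M_def emeasure_distr emeasure_density[OF ind] vimage_def)
    also have "\<dots> = (\<integral>\<^sup>+u. indicator (cball 0 1 \<inter> {u :: real \<times> real. norm u > x}) u \<partial>lborel)"
      by (intro nn_integral_cong) (auto simp: indicator_def)
    also have "\<dots> = emeasure lborel (cball (0 :: real \<times> real) 1 \<inter> {u. norm u > x})"
      by (rule nn_integral_indicator) simp
    finally show ?thesis .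
  qed
  have M2: "emeasure M {x<..} = ennreal (pi - pi * (max 0 x)\<^sup>2)" if "x \<le> 1" for x
  proof (cases "x < 0")
    case True
    then have "cball (0 :: real \<times> real) 1 \<inter> {u. norm u > x} = cball 0 1"
      by (auto intro: less_le_trans)
    then show ?thesis using True by (simp add: M1 ball)
  next
    case False
    then have "cball (0 :: real \<times> real) 1 \<inter> {u. norm u > x} = cball 0 1 - cball 0 x" by auto
    moreover have "emeasure lborel (cball (0 :: real \<times> real) 1 - cball 0 x)
        = emeasure lborel (cball (0 :: real \<times> real) 1) - emeasure lborel (cball (0 :: real \<times> real) x)"
      by (rule emeasure_Diff) (use that False in \<open>auto simp: ball\<close>)
    ultimately show ?thesis using False by (simp add: M1 ball ennreal_minus)
  qed
  have M3: "emeasure M {x<..} = 0" if "x > 1" for x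
  proof -
    have "cball (0 :: real \<times> real) 1 \<inter> {u. norm u > x} = {}" using that by auto
    then show ?thesis by (simp add: M1)
  qed
  have N1: "emeasure N {x<..} = (\<integral>\<^sup>+r. ennreal (2 * pi * r) * indicator {max 0 x..1} r \<partial>lborel)" for x
  proof -
    have "emeasure N {x<..} = (\<integral>\<^sup>+r. ennreal (2 * pi * r) * indicator {0..1} r * indicator {x<..} r \<partial>lborel)"
      by (simp add: N_def emeasure_density)
    also have "\<dots> = (\<integral>\<^sup>+r. ennreal (2 * pi * r) * indicator {max 0 x..1} r \<partial>lborel)"
      by (rule nn_integral_cong_AE) (use AE_lborel_singleton[of x] in \<open>eventually_elim; auto simp: indicator_def\<close>)
    finally show ?thesis .
  qed
  have N2: "emeasure N {x<..} = ennreal (pi - pi * (max 0 x)\<^sup>2)" if "x \<le> 1" for x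
  proof -
    have "(\<integral>\<^sup>+r. ennreal (2 * pi * r) * indicator {max 0 x..1} r \<partial>lborel) = ennreal (pi * 1\<^sup>2 - pi * (max 0 x)\<^sup>2)"
      by (rule nn_integral_FTC_Icc) (use that in \<open>auto intro!: derivative_eq_intros\<close>)
    then show ?thesis by (simp add: N1)
  qed
  have N3: "emeasure N {x<..} = 0" if "x > 1" for x
    using that by (simp add: N1)
  have "M = N"
  proof (rule measure_eqI_lessThan)
    show "emeasure M {x<..} < \<infinity>" for x using M2[of x] M3[of x] by (cases "x \<le> 1") auto
    show "emeasure M {x<..} = emeasure N {x<..}" for x using M2[of x] M3[of x] N2[of x] N3[of x] by (cases "x \<le> 1") auto
  qed (auto simp: M_def N_def)
  then have "(\<integral>\<^sup>+r. g r \<partial>M) = (\<integral>\<^sup>+r. g r \<partial>N)" by simp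
  then show ?thesis
    by (simp add: M_def N_def nn_integral_distr nn_integral_density[OF ind] nn_integral_density mult_ac)
qed

lemma nn_integral_radial_const_over:
  assumes "0 \<le> c"
  shows "(\<integral>\<^sup>+v. ennreal (c / norm v) * indicator unit_disc v \<partial>lborel) = ennreal (2 * pi * c)"
proof -
  have "(\<integral>\<^sup>+v. ennreal (c / norm v) * indicator unit_disc v \<partial>lborel)
     = (\<integral>\<^sup>+r. ennreal (c / r) * (ennreal (2 * pi * r) * indicator {0..1} r) \<partial>lborel)"
    by (rule nn_integral_radial) measurable
  also have "\<dots> = (\<integral>\<^sup>+r. ennreal (2 * pi * c) * indicator {0..1::real} r \<partial>lborel)"
  proof (rule nn_integral_cong_AE, rule AE_mp[OF AE_lborel_singleton[of 0]], rule AE_I2, rule impI)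
    fix r :: real assume "r \<noteq> 0"
    show "ennreal (c / r) * (ennreal (2 * pi * r) * indicator {0..1} r) = ennreal (2 * pi * c) * indicator {0..1} r"
    proof (cases "0 < r \<and> r \<le> 1")
      case True
      then have "ennreal (c / r) * ennreal (2 * pi * r) = ennreal (c / r * (2 * pi * r))"
        using assms by (intro ennreal_mult'[symmetric]) simp
      also have "c / r * (2 * pi * r) = 2 * pi * c" using True by simp
      finally show ?thesis using True by simp
    qed (use \<open>r \<noteq> 0\<close> in \<open>auto simp: indicator_def\<close>)
  qed
  also have "\<dots> = ennreal (2 * pi * c)" by (subst nn_integral_cmult_indicator) simp_all
  finally show ?thesis .
qed

section \<open>Integrals of a test function over the unit disc\<close>

text \<open>
  The test functions are nonnegative, which allows sums and integrals to be compared by enlarging or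
  shrinking their domains. The bound \<open>B\<close> and the support radius \<open>M\<close> are kept as explicit parameters
  because they enter the constants below.\<close>

locale test_function =
  fixes f :: "real \<Rightarrow> real" and M B :: real
  assumes continuous: "continuous_on UNIV f"
    and nonneg: "0 \<le> f x" and bounded: "f x \<le> B"
    and support: "M < \<bar>x\<bar> \<Longrightarrow> f x = 0"
    and M_pos: "0 < M"
begin

lemma B_nonneg: "0 \<le> B"
  using nonneg[of 0] bounded[of 0] by simp

lemma measurable_f [measurable]: "f \<in> borel_measurable borel"
  using continuous by (rule borel_measurable_continuous_onI)

lemma tendsto_f:
  assumes "(g \<longlongrightarrow> l) F"
  shows "((\<lambda>n. f (g n)) \<longlongrightarrow> f l) F"
  using continuous assms by (rule continuous_on_tendsto_compose) auto

text \<open>This function governs the whole asymptotics: \<open>2 s u_1 / |u|^2\<close> is the linearized logarithmic gap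
  at a point \<open>u\<close> of the unit disc for a shift along the first axis, in units in which the size of the
  gap is \<open>s\<close>. At \<open>u = 0\<close> the quotient has the value 0, which affects a null set only.\<close>

definition disc_integral :: "real \<Rightarrow> real" where
  "disc_integral s = (LINT u|lborel. indicator unit_disc u * f (2 * s * fst u / (norm (u :: real \<times> real))\<^sup>2))"

lemma measurable_disc [measurable]:
  "(\<lambda>u :: real \<times> real. f (a * fst u / (norm u)\<^sup>2)) \<in> borel_measurable borel"
proof -
  have [measurable]: "(fst :: real \<times> real \<Rightarrow> real) \<in> borel_measurable borel"
    "(norm :: real \<times> real \<Rightarrow> real) \<in> borel_measurable borel"
    by (intro borel_measurable_continuous_onI continuous_intros)+
  show ?thesis by measurable
qed

lemma emeasure_unit_disc: "emeasure lborel (cball (0 :: real \<times> real) 1) = ennreal pi"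
  using emeasure_cball[of 1 "0 :: real \<times> real"] by (simp add: unit_ball_vol_2)

lemma integrable_disc:
  "integrable lborel (\<lambda>u. indicator unit_disc u * f (a * fst u / (norm (u :: real \<times> real))\<^sup>2))"
proof -
  have "integrable lborel (\<lambda>u :: real \<times> real. indicator unit_disc u * B)"
    using emeasure_unit_disc by (intro integrable_mult_left) (auto intro!: integrable_real_indicator)
  then show ?thesis
    by (rule Bochner_Integration.integrable_bound) (auto simp: indicator_def nonneg bounded B_nonneg)
qed

lemma integrable_bound_disc: "integrable lborel (\<lambda>u :: real \<times> real. indicator unit_disc u * B)"
  using emeasure_unit_disc by (intro integrable_mult_left) (auto intro!: integrable_real_indicator)

lemma disc_integral_nonneg: "0 \<le> disc_integral s"
  unfolding disc_integral_def by (rule integral_nonneg_AE) (simp add: nonneg)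

lemma disc_integral_le: "disc_integral s \<le> pi * B"
proof -
  have "disc_integral s \<le> (LINT u|lborel. indicator (cball (0 :: real \<times> real) 1) u * B)"
    unfolding disc_integral_def
    by (rule integral_mono[OF integrable_disc integrable_bound_disc])
       (auto simp: indicator_def bounded)
  also have "\<dots> = pi * B" using emeasure_unit_disc by (simp add: measure_def)
  finally show ?thesis .
qed

lemma nn_disc_integral:
  "(\<integral>\<^sup>+u. ennreal (f (2 * s * fst u / (norm (u :: real \<times> real))\<^sup>2)) * indicator unit_disc u \<partial>lborel) = ennreal (disc_integral s)"
proof -
  have "(\<integral>\<^sup>+u. ennreal (indicator unit_disc u * f (2 * s * fst u / (norm (u :: real \<times> real))\<^sup>2)) \<partial>lborel) = ennreal (disc_integral s)"
    unfolding disc_integral_def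
    by (rule nn_integral_eq_integral[OF integrable_disc]) (simp add: nonneg)
  then show ?thesis by (simp add: ennreal_mult'' nonneg ennreal_indicator mult.commute)
qed

lemma disc_integral_tendsto:
  assumes "s \<longlonglongrightarrow> l"
  shows "(\<lambda>n. disc_integral (s n)) \<longlonglongrightarrow> disc_integral l"
  unfolding disc_integral_def
proof (rule integral_dominated_convergence[OF _ _ integrable_bound_disc])
  show "AE u :: real \<times> real in lborel. (\<lambda>n. indicator unit_disc u * f (2 * s n * fst u / (norm u)\<^sup>2))
      \<longlonglongrightarrow> indicator unit_disc u * f (2 * l * fst u / (norm u)\<^sup>2)"
    by (auto intro!: AE_I2 tendsto_mult tendsto_f assms simp: divide_inverse)
  show "AE u in lborel. norm (indicator unit_disc u * f (2 * s n * fst u / (norm (u :: real \<times> real))\<^sup>2)) \<le> indicator unit_disc u * B" for n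
    by (intro AE_I2) (auto simp: indicator_def bounded nonneg)
qed (use borel_measurable_integrable[OF integrable_disc] in simp_all)

lemma disc_integral_0: "disc_integral 0 = pi * f 0"
  unfolding disc_integral_def using emeasure_unit_disc by (simp add: measure_def)

lemma nn_integral_disc_inner:
  assumes "0 < R"
  shows "(\<integral>\<^sup>+u. ennreal (f (k * (u \<bullet> h) / (norm u)\<^sup>2)) * indicator (cball 0 R) (u :: real \<times> real) \<partial>lborel)
    = ennreal (R\<^sup>2 * disc_integral (k * norm h / (2 * R)))"
proof -
  let ?F = "\<lambda>p. ennreal (f (k * snd p / (fst p)\<^sup>2)) * indicator {..R} (fst p)"
  have [measurable]: "(fst :: real \<times> real \<Rightarrow> real) \<in> borel_measurable borel"
    "(snd :: real \<times> real \<Rightarrow> real) \<in> borel_measurable borel"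
    "(norm :: real \<times> real \<Rightarrow> real) \<in> borel_measurable borel"
    by (intro borel_measurable_continuous_onI continuous_intros)+
  have "(\<integral>\<^sup>+u. ennreal (f (k * (u \<bullet> h) / (norm u)\<^sup>2)) * indicator (cball 0 R) (u :: real \<times> real) \<partial>lborel)
      = (\<integral>\<^sup>+u. ?F (norm u, u \<bullet> h) \<partial>lborel)"
    by (intro nn_integral_cong) (auto simp: indicator_def)
  also have "\<dots> = (\<integral>\<^sup>+u. ?F (norm u, norm h * fst (u :: real \<times> real)) \<partial>lborel)"
    by (rule nn_integral_norm_inner[of ?F]) measurable
  also have "\<dots> = ennreal (R\<^sup>2) * (\<integral>\<^sup>+u. ?F (norm (R *\<^sub>R u), norm h * fst (R *\<^sub>R u :: real \<times> real)) \<partial>lborel)"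
    by (rule nn_integral_plane_scale[of "\<lambda>u. ?F (norm u, norm h * fst u)"]) (use assms in \<open>measurable, simp\<close>)
  also have "(\<lambda>u. ?F (norm (R *\<^sub>R u), norm h * fst (R *\<^sub>R u :: real \<times> real)))
    = (\<lambda>u. ennreal (f (2 * (k * norm h / (2 * R)) * fst u / (norm u)\<^sup>2)) * indicator unit_disc u)"
    using assms by (auto simp: fun_eq_iff indicator_def power_mult_distrib power2_eq_square divide_simps mult_ac)
  also have "ennreal (R\<^sup>2) * (\<integral>\<^sup>+u. ennreal (f (2 * (k * norm h / (2 * R)) * fst u / (norm u)\<^sup>2)) * indicator unit_disc u \<partial>lborel)
     = ennreal (R\<^sup>2 * disc_integral (k * norm h / (2 * R)))"
    unfolding nn_disc_integral by (simp add: ennreal_mult' disc_integral_nonneg)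
  finally show ?thesis .
qed

text \<open>For large \<open>s\<close> the integrand of \<open>disc_integral s\<close> lives in a strip of width about \<open>1 / s\<close> around the
  second axis. Substituting \<open>x / s\<close> for the first coordinate turns \<open>s * disc_integral s\<close> into the
  integral of the function below, which converges pointwise and stays inside a fixed box.\<close>

definition stretched :: "real \<Rightarrow> real \<times> real \<Rightarrow> real" where
  "stretched s u = indicator {u. (fst u / s)\<^sup>2 + (snd u)\<^sup>2 \<le> 1} u * f (2 * fst u / ((fst u / s)\<^sup>2 + (snd u)\<^sup>2))"

definition stretched_limit :: "real \<times> real \<Rightarrow> real" where
  "stretched_limit u = indicator {u. \<bar>snd u\<bar> \<le> 1} u * f (2 * fst u / (snd u)\<^sup>2)"

lemma measurable_stretched [measurable]: "stretched s \<in> borel_measurable borel"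
  "stretched_limit \<in> borel_measurable borel"
proof -
  have [measurable]: "(fst :: real \<times> real \<Rightarrow> real) \<in> borel_measurable borel"
    "(snd :: real \<times> real \<Rightarrow> real) \<in> borel_measurable borel"
    by (intro borel_measurable_continuous_onI continuous_intros)+
  show "stretched s \<in> borel_measurable borel" unfolding stretched_def by measurable
  show "stretched_limit \<in> borel_measurable borel" unfolding stretched_limit_def by measurable
qed

lemma nn_stretched:
  assumes s: "0 < s"
  shows "(\<integral>\<^sup>+u. ennreal (stretched s u) \<partial>lborel) = ennreal (s * disc_integral s)"
proof -
  have n2: "(norm (x, y))\<^sup>2 = x\<^sup>2 + y\<^sup>2" for x y :: real by (simp add: norm_prod_def)
  have c: "norm (x, y) \<le> 1 \<longleftrightarrow> x\<^sup>2 + y\<^sup>2 \<le> 1" for x y :: real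
    by (simp add: norm_prod_def)
  have aff: "(\<integral>\<^sup>+x. ennreal (stretched s (x, y)) \<partial>lborel) =
      ennreal s * (\<integral>\<^sup>+x. ennreal (f (2 * s * x / (norm (x, y))\<^sup>2)) * indicator unit_disc (x, y) \<partial>lborel)" for y
  proof -
    have "(\<integral>\<^sup>+x. ennreal (stretched s (x, y)) \<partial>lborel) = ennreal \<bar>s\<bar> * (\<integral>\<^sup>+x. ennreal (stretched s (0 + s * x, y)) \<partial>lborel)"
      by (rule nn_integral_real_affine) (use s in auto)
    also have "(\<lambda>x. ennreal (stretched s (0 + s * x, y))) =
       (\<lambda>x. ennreal (f (2 * s * x / (norm (x, y))\<^sup>2)) * indicator unit_disc (x, y))"
      using s by (auto simp: fun_eq_iff stretched_def n2 c indicator_def mult_ac)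
    finally show ?thesis using s by simp
  qed
  define g where "g u = ennreal (f (2 * s * fst u / (norm u)\<^sup>2)) * indicator unit_disc u" for u :: "real \<times> real"
  have [measurable]: "g \<in> borel_measurable borel"
    unfolding g_def
    by (intro borel_measurable_times_ennreal measurable_compose[OF measurable_disc measurable_ennreal]
        borel_measurable_indicator) simp
  have aff': "(\<integral>\<^sup>+x. ennreal (stretched s (x, y)) \<partial>lborel) = ennreal s * (\<integral>\<^sup>+x. g (x, y) \<partial>lborel)" for y
    unfolding aff g_def by simp
  have "(\<integral>\<^sup>+u. ennreal (stretched s u) \<partial>lborel) = (\<integral>\<^sup>+y. \<integral>\<^sup>+x. ennreal (stretched s (x, y)) \<partial>lborel \<partial>lborel)"
    by (rule nn_integral_plane) simp
  also have "\<dots> = ennreal s * (\<integral>\<^sup>+y. \<integral>\<^sup>+x. g (x, y) \<partial>lborel \<partial>lborel)"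
    unfolding aff' by (rule nn_integral_cmult) measurable
  also have "(\<integral>\<^sup>+y. \<integral>\<^sup>+x. g (x, y) \<partial>lborel \<partial>lborel) = (\<integral>\<^sup>+u. g u \<partial>lborel)"
    by (rule nn_integral_plane(1)[symmetric]) simp
  also have "ennreal s * \<dots> = ennreal (s * disc_integral s)"
    unfolding g_def nn_disc_integral using s by (simp add: ennreal_mult' disc_integral_nonneg)
  finally show ?thesis .
qed

text \<open>On the support, \<open>q = (x / s)^2 + y^2\<close> is at most 1 and \<open>|2 x| \<le> M q\<close>, so the support lies in a box
  that does not depend on \<open>s\<close>. This gives both the domination for the limit and the bound
  \<open>s * disc_integral s \<le> 4 M B\<close>.\<close>

lemma stretched_bounds:
  assumes "s \<noteq> 0"
  shows "0 \<le> stretched s u" "stretched s u \<le> B * indicator (cbox (- M, -1) (M, 1)) u"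
proof -
  show "0 \<le> stretched s u" by (simp add: stretched_def nonneg)
  show "stretched s u \<le> B * indicator (cbox (- M, -1) (M, 1)) u"
  proof (cases "u \<in> cbox (- M, -1) (M, 1)")
    case True
    then show ?thesis by (simp add: stretched_def indicator_def bounded B_nonneg)
  next
    case False
    have "stretched s u = 0"
    proof (rule ccontr)
      assume "stretched s u \<noteq> 0"
      then have le: "(fst u / s)\<^sup>2 + (snd u)\<^sup>2 \<le> 1" and nz: "f (2 * fst u / ((fst u / s)\<^sup>2 + (snd u)\<^sup>2)) \<noteq> 0"
        by (auto simp: stretched_def indicator_def split: if_splits)
      define q where "q = (fst u / s)\<^sup>2 + (snd u)\<^sup>2"
      have q: "0 \<le> q" "q \<le> 1" using le by (simp_all add: q_def)
      have "\<bar>2 * fst u / q\<bar> \<le> M" using nz support[of "2 * fst u / q"] by (fold q_def) (rule ccontr, simp)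
      have "(snd u)\<^sup>2 \<le> 1" using q zero_le_power2[of "fst u / s"] unfolding q_def by linarith
      then have y: "\<bar>snd u\<bar> \<le> 1" by (simp add: abs_square_le_1)
      have x: "\<bar>fst u\<bar> \<le> M"
      proof (cases "q = 0")
        case True
        then have "fst u = 0" using assms by (simp add: q_def sum_power2_eq_zero_iff)
        then show ?thesis using M_pos by simp
      next
        case False
        then have "2 * \<bar>fst u\<bar> \<le> M * q" using \<open>\<bar>2 * fst u / q\<bar> \<le> M\<close> q by (simp add: abs_mult field_simps)
        also have "\<dots> \<le> M" using q M_pos by simp
        finally show ?thesis by simp
      qed
      show False using False x y by (cases u) (auto simp: cbox_Pair_eq abs_le_iff)
    qed
    then show ?thesis using B_nonneg by simp
  qed
qed

lemma integrable_f: "integrable lborel f"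
proof -
  have "integrable lborel (\<lambda>x. indicator {- M..M} x * B)"
    using emeasure_lborel_cbox_finite[of "- M" M]
    by (intro integrable_mult_left) (auto intro!: integrable_real_indicator simp: less_top[symmetric])
  then show ?thesis
    by (rule Bochner_Integration.integrable_bound)
       (use support in \<open>auto simp: indicator_def nonneg bounded abs_le_iff abs_of_nonneg[OF B_nonneg] intro!: AE_I2\<close>)
qed

lemma nn_integral_f: "(\<integral>\<^sup>+x. ennreal (f x) \<partial>lborel) = ennreal (LINT x|lborel. f x)"
  by (rule nn_integral_eq_integral[OF integrable_f]) (simp add: nonneg)

lemma integral_f_nonneg: "0 \<le> (LINT x|lborel. f x)"
  by (rule integral_nonneg_AE) (simp add: nonneg)

lemma emeasure_box_support: "emeasure lborel (cbox (- M, -1) (M, 1 :: real)) = ennreal (4 * M)"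
proof -
  have "emeasure lborel (cbox (- M, -1) (M, 1 :: real)) = emeasure (lborel \<Otimes>\<^sub>M lborel) ({- M..M} \<times> {-1..1::real})"
    by (simp add: lborel_prod cbox_Pair_eq)
  also have "\<dots> = emeasure lborel {- M..M} * emeasure lborel {-1..1::real}"
    by (rule lborel.emeasure_pair_measure_Times) auto
  also have "\<dots> = ennreal (M - - M) * ennreal (1 - -1)" using M_pos by (subst (1 2) emeasure_lborel_Icc) simp_all
  also have "\<dots> = ennreal (4 * M)" using M_pos by (subst ennreal_mult'[symmetric]) simp_all
  finally show ?thesis .
qed

lemma nn_stretched_bound:
  "(\<integral>\<^sup>+u. ennreal (B * indicator (cbox (- M, -1) (M, 1)) (u :: real \<times> real)) \<partial>lborel) = ennreal (4 * M * B)"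
proof -
  have "(\<integral>\<^sup>+u. ennreal (B * indicator (cbox (- M, -1) (M, 1)) (u :: real \<times> real)) \<partial>lborel)
     = (\<integral>\<^sup>+u. ennreal B * indicator (cbox (- M, -1) (M, 1)) (u :: real \<times> real) \<partial>lborel)"
    by (intro nn_integral_cong) (auto simp: indicator_def)
  also have "\<dots> = ennreal B * ennreal (4 * M)"
    by (subst nn_integral_cmult_indicator) (simp_all add: emeasure_box_support)
  also have "\<dots> = ennreal (4 * M * B)" using M_pos B_nonneg by (simp add: mult.commute flip: ennreal_mult'')
  finally show ?thesis .
qed

lemma mult_disc_integral_le:
  assumes "0 < s"
  shows "s * disc_integral s \<le> 4 * M * B"
proof -
  have "ennreal (s * disc_integral s) \<le> ennreal (4 * M * B)"
    unfolding nn_stretched[OF assms, symmetric] nn_stretched_bound[symmetric]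
    by (intro nn_integral_mono ennreal_leI stretched_bounds) (use assms in simp)
  then show ?thesis using M_pos B_nonneg by simp
qed

lemma AE_snd_neq: "AE u in lborel. snd (u :: real \<times> real) \<noteq> c"
proof (rule AE_I)
  have [measurable]: "{u :: real \<times> real. snd u = c} \<in> sets borel"
    by (intro borel_closed closed_Collect_eq continuous_intros)
  show "{u \<in> space lborel. \<not> snd u \<noteq> c} \<subseteq> {u :: real \<times> real. snd u = c}" by auto
  show "{u :: real \<times> real. snd u = c} \<in> sets lborel" by simp
  have "emeasure lborel {u :: real \<times> real. snd u = c} = (\<integral>\<^sup>+u. indicator {u :: real \<times> real. snd u = c} u \<partial>lborel)" by simp
  also have "\<dots> = (\<integral>\<^sup>+x. \<integral>\<^sup>+y. indicator {u :: real \<times> real. snd u = c} (x, y) \<partial>lborel \<partial>lborel)"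
    by (rule nn_integral_plane) simp
  also have "(\<lambda>x y. indicator {u :: real \<times> real. snd u = c} (x, y) :: ennreal) = (\<lambda>x. indicator {c})"
    by (auto simp: fun_eq_iff indicator_def)
  finally show "emeasure lborel {u :: real \<times> real. snd u = c} = 0" by simp
qed

text \<open>On the horizontal line at height \<open>y\<close> the substitution \<open>t = 2 x / y^2\<close> contributes the factor
  \<open>y^2 / 2\<close>, whose integral over \<open>[-1, 1]\<close> is \<open>1 / 3\<close>.\<close>

lemma nn_stretched_limit:
  "(\<integral>\<^sup>+u. ennreal (stretched_limit u) \<partial>lborel) = ennreal ((LINT x|lborel. f x) / 3)"
proof -
  let ?I = "LINT x|lborel. f x"
  have x: "(\<integral>\<^sup>+x. ennreal (stretched_limit (x, y)) \<partial>lborel) = ennreal (?I * (y\<^sup>2 / 2)) * indicator {-1..1} y"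
    if "y \<noteq> 0" for y
  proof (cases "\<bar>y\<bar> \<le> 1")
    case True
    have "ennreal ?I = ennreal \<bar>2 / y\<^sup>2\<bar> * (\<integral>\<^sup>+x. ennreal (f (0 + 2 / y\<^sup>2 * x)) \<partial>lborel)"
      unfolding nn_integral_f[symmetric] by (rule nn_integral_real_affine) (use that in auto)
    then have "ennreal (y\<^sup>2 / 2) * ennreal ?I = (ennreal (y\<^sup>2 / 2) * ennreal (2 / y\<^sup>2)) * (\<integral>\<^sup>+x. ennreal (f (2 / y\<^sup>2 * x)) \<partial>lborel)"
      by (simp add: mult.assoc)
    also have "ennreal (y\<^sup>2 / 2) * ennreal (2 / y\<^sup>2) = 1"
      using that by (simp flip: ennreal_mult'')
    finally have "(\<integral>\<^sup>+x. ennreal (f (2 / y\<^sup>2 * x)) \<partial>lborel) = ennreal (?I * (y\<^sup>2 / 2))"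
      using ennreal_mult'[OF integral_f_nonneg, of "y\<^sup>2 / 2"] by (simp only: mult_1 mult.commute)
    moreover have "(\<lambda>x. ennreal (stretched_limit (x, y))) = (\<lambda>x. ennreal (f (2 / y\<^sup>2 * x)))"
      using True by (auto simp: stretched_limit_def)
    ultimately show ?thesis using True by (simp add: indicator_def abs_le_iff)
  next
    case False
    then show ?thesis by (auto simp: stretched_limit_def indicator_def)
  qed
  have "(\<integral>\<^sup>+u. ennreal (stretched_limit u) \<partial>lborel) = (\<integral>\<^sup>+y. \<integral>\<^sup>+x. ennreal (stretched_limit (x, y)) \<partial>lborel \<partial>lborel)"
    by (rule nn_integral_plane) simp
  also have "\<dots> = (\<integral>\<^sup>+y. ennreal (?I * (y\<^sup>2 / 2)) * indicator {-1..1} y \<partial>lborel)"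
    by (rule nn_integral_cong_AE) (use AE_lborel_singleton[of 0] x in \<open>auto elim!: eventually_mono\<close>)
  also have "\<dots> = ennreal (?I * (1 ^ 3 / 6) - ?I * ((-1) ^ 3 / 6))"
    by (rule nn_integral_FTC_Icc)
       (auto intro!: derivative_eq_intros simp: integral_f_nonneg power2_eq_square)
  finally show ?thesis by simp
qed

lemma stretched_tendsto:
  assumes s: "filterlim s at_top sequentially" and u: "snd u \<noteq> 0" "snd u \<noteq> 1" "snd u \<noteq> -1"
  shows "(\<lambda>n. stretched (s n) u) \<longlonglongrightarrow> stretched_limit u"
proof -
  let ?q = "\<lambda>n. (fst u / s n)\<^sup>2 + (snd u)\<^sup>2"
  have "(\<lambda>n. fst u / s n) \<longlonglongrightarrow> 0"
    using s by (intro tendsto_divide_0[OF tendsto_const] filterlim_at_top_imp_at_infinity)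
  then have q: "?q \<longlonglongrightarrow> 0\<^sup>2 + (snd u)\<^sup>2" by (intro tendsto_add tendsto_power tendsto_const)
  then have "(\<lambda>n. 2 * fst u / ?q n) \<longlonglongrightarrow> 2 * fst u / (snd u)\<^sup>2"
    using u by (intro tendsto_divide tendsto_const) auto
  then have fq: "(\<lambda>n. f (2 * fst u / ?q n)) \<longlonglongrightarrow> f (2 * fst u / (snd u)\<^sup>2)" by (rule tendsto_f)
  show ?thesis
  proof (cases "\<bar>snd u\<bar> \<le> 1")
    case True
    then have "\<bar>snd u\<bar> < 1" using u by auto
    then have "(snd u)\<^sup>2 < 1" by (simp add: abs_square_less_1)
    then have "\<forall>\<^sub>F n in sequentially. ?q n < 1" using order_tendstoD(2)[OF q, of 1] by simp
    then have "\<forall>\<^sub>F n in sequentially. f (2 * fst u / ?q n) = stretched (s n) u"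
      by eventually_elim (simp add: stretched_def)
    then show ?thesis using fq True by (simp add: stretched_limit_def tendsto_cong)
  next
    case False
    then have "(snd u)\<^sup>2 > 1" by (simp add: abs_square_le_1 not_le flip: not_le)
    then have "?q n > 1" for n by (smt (verit) zero_le_power2)
    then have "stretched (s n) u = 0" for n by (simp add: stretched_def indicator_def not_le)
    then show ?thesis using False by (simp add: stretched_limit_def)
  qed
qed

lemma mult_disc_integral_tendsto:
  assumes s: "filterlim s at_top sequentially"
  shows "(\<lambda>n. s n * disc_integral (s n)) \<longlonglongrightarrow> (LINT x|lborel. f x) / 3"
proof -
  have ev: "\<forall>\<^sub>F n in sequentially. s n > 0" using s by (simp add: filterlim_at_top_dense)
  \<comment> \<open>The bounds on the stretched functions are needed for all indices, not only eventually.\<close>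
  define t where "t n = max 1 (s n)" for n
  have ev2: "\<forall>\<^sub>F n in sequentially. s n > 1" using s by (simp add: filterlim_at_top_dense)
  then have ts: "\<forall>\<^sub>F n in sequentially. t n = s n" by eventually_elim (simp add: t_def)
  have t: "filterlim t at_top sequentially" using s ts by (simp add: filterlim_cong)
  have tp: "t n > 0" for n by (simp add: t_def)
  have "(\<lambda>n. \<integral>\<^sup>+u. ennreal (stretched (t n) u) \<partial>lborel) \<longlonglongrightarrow> (\<integral>\<^sup>+u. ennreal (stretched_limit u) \<partial>lborel)"
  proof (rule nn_integral_dominated_convergence[where w = "\<lambda>u. ennreal (B * indicator (cbox (- M, -1) (M, 1)) u)"])
    show "AE u in lborel. ennreal (stretched (t n) u) \<le> ennreal (B * indicator (cbox (- M, -1) (M, 1)) u)" for n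
      by (intro AE_I2 ennreal_leI stretched_bounds) (use tp[of n] in simp)
    show "AE u in lborel. (\<lambda>n. ennreal (stretched (t n) u)) \<longlonglongrightarrow> ennreal (stretched_limit u)"
      using AE_snd_neq[of 0] AE_snd_neq[of 1] AE_snd_neq[of "-1"]
      by eventually_elim (intro tendsto_ennrealI stretched_tendsto t)
  qed (simp_all add: nn_stretched_bound)
  then have "(\<lambda>n. ennreal (t n * disc_integral (t n))) \<longlonglongrightarrow> ennreal ((LINT x|lborel. f x) / 3)"
    by (simp add: nn_stretched[OF tp] nn_stretched_limit)
  moreover have "0 \<le> t n * disc_integral (t n)" for n
    by (rule mult_nonneg_nonneg[OF less_imp_le[OF tp] disc_integral_nonneg])
  ultimately have "(\<lambda>n. t n * disc_integral (t n)) \<longlonglongrightarrow> (LINT x|lborel. f x) / 3"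
    using integral_f_nonneg by (subst (asm) tendsto_ennreal_iff) simp_all
  moreover have "\<forall>\<^sub>F n in sequentially. t n * disc_integral (t n) = s n * disc_integral (s n)"
    using ts by eventually_elim simp
  ultimately show ?thesis by (simp add: tendsto_cong)
qed

end

section \<open>The density of the critical regime\<close>

text \<open>Up to the factor \<open>1 / y^2 = 4 / |D|\<close> this is the density of the critical regime.\<close>

definition disc_density :: "real \<Rightarrow> real" where
  "disc_density t = (if t = 0 then 2 * pi / 3
     else if \<bar>t\<bar> \<le> 2 then 2 * pi / t ^ 3 * (arcsin (t / 2) - t / 2 * (1 - t\<^sup>2 / 2) * sqrt (1 - t\<^sup>2 / 4))
     else pi\<^sup>2 / \<bar>t\<bar> ^ 3)"

definition semicircle :: "real \<Rightarrow> real" where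
  "semicircle x = sqrt (max 0 (1 - x\<^sup>2))"

lemma semicircle_nonneg: "0 \<le> semicircle x" by (simp add: semicircle_def)

lemma continuous_semicircle [continuous_intros]:
  "continuous_on S g \<Longrightarrow> continuous_on S (\<lambda>x. semicircle (g x))"
  unfolding semicircle_def by (intro continuous_intros)

lemma measurable_semicircle [measurable]: "semicircle \<in> borel_measurable borel"
  using continuous_semicircle[OF continuous_on_id] by (intro borel_measurable_continuous_onI) simp

text \<open>The antiderivative is \<open>(arcsin x - x (1 - 2 x^2) sqrt (1 - x^2)) / 8\<close>. It is differentiable only in
  the open interval, since \<open>arcsin\<close> has a vertical tangent at 1.\<close>

lemma second_moment_semicircle:
  assumes "0 \<le> a" "a \<le> 1"
  shows "(\<integral>\<^sup>+x. ennreal (x\<^sup>2 * semicircle x) * indicator {0..a} x \<partial>lborel)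
    = ennreal ((arcsin a - a * (1 - 2 * a\<^sup>2) * sqrt (1 - a\<^sup>2)) / 8)"
proof -
  let ?G = "\<lambda>x. (arcsin x - x * (1 - 2 * x\<^sup>2) * sqrt (1 - x\<^sup>2)) / 8"
  let ?g = "\<lambda>x. x\<^sup>2 * semicircle x"
  have "(?g has_integral (?G a - ?G 0)) {0..a}"
  proof (rule fundamental_theorem_of_calculus_interior)
    show "continuous_on {0..a} ?G" using assms by (intro continuous_intros) auto
    fix x assume x: "x \<in> {0<..<a}"
    define r where "r = sqrt (1 - x\<^sup>2)"
    have x2: "x\<^sup>2 < 1" using x assms by (simp add: abs_square_less_1)
    have r: "r > 0" "r\<^sup>2 = 1 - x\<^sup>2" using x2 by (simp_all add: r_def)
    have "(?G has_real_derivative (1 / r - ((1 - 6 * x\<^sup>2) * r - x * (1 - 2 * x\<^sup>2) * (x / r))) / 8) (at x)"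
      unfolding r_def using x assms x2
      by (auto intro!: derivative_eq_intros simp: field_simps power2_eq_square)
    also have "(1 / r - ((1 - 6 * x\<^sup>2) * r - x * (1 - 2 * x\<^sup>2) * (x / r))) / 8 = (1 - (1 - 6 * x\<^sup>2) * r\<^sup>2 + x\<^sup>2 * (1 - 2 * x\<^sup>2)) / (8 * r)"
      using r(1) by (simp add: field_simps power2_eq_square)
    also have "\<dots> = 8 * x\<^sup>2 * r\<^sup>2 / (8 * r)" unfolding r(2) by (simp add: algebra_simps power2_eq_square)
    also have "\<dots> = x\<^sup>2 * r" using r(1) by (simp add: power2_eq_square)
    also have "\<dots> = ?g x" using x2 by (simp add: semicircle_def r_def)
    finally show "(?G has_vector_derivative ?g x) (at x)" by (simp add: has_real_derivative_iff_has_vector_derivative)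
  qed (use assms in auto)
  then have "((\<lambda>x. indicator {0..a} x * ?g x) has_integral ?G a) UNIV"
  proof -
    assume "(?g has_integral (?G a - ?G 0)) {0..a}"
    moreover have "(\<lambda>x. indicator {0..a} x * ?g x) = (\<lambda>x. if x \<in> {0..a} then ?g x else 0)"
      by (auto simp: indicator_def)
    ultimately show ?thesis by (simp only: has_integral_restrict_UNIV) simp
  qed
  then have "(\<integral>\<^sup>+x. ennreal (indicator {0..a} x * ?g x) \<partial>lborel) = ennreal (?G a)"
    by (intro nn_integral_has_integral_lborel) (auto simp: semicircle_nonneg)
  then show ?thesis by (simp add: ennreal_mult'' semicircle_nonneg ennreal_indicator mult.commute)
qed

text \<open>In polar coordinates, with \<open>k = |t| / 2\<close>, the left-hand side is the integral of
  \<open>2 \<pi> r^2 sqrt (1 - (k r)^2)\<close> over \<open>0 \<le> r \<le> 1\<close>, \<open>k r \<le> 1\<close>. Rescaling by \<open>k\<close> gives a second moment of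
  the semicircle up to \<open>min 1 k\<close>; the two branches of the density are \<open>k \<le> 1\<close> and \<open>k > 1\<close>.\<close>

lemma nn_integral_disc_density:
  assumes t: "t \<noteq> 0"
  shows "(\<integral>\<^sup>+u. ennreal (norm u * semicircle (norm u * t / 2)) * indicator unit_disc u \<partial>lborel)
    = ennreal (disc_density t)"
proof -
  define k where "k = \<bar>t\<bar> / 2"
  define m where "m = min 1 k"
  have k: "k > 0" using t by (simp add: k_def)
  have m: "0 \<le> m" "m \<le> 1" using k by (simp_all add: m_def)
  have sc: "semicircle (r * t / 2) = semicircle (k * r)" for r
    by (simp add: semicircle_def k_def power_mult_distrib power_divide mult.commute)
  have "(\<integral>\<^sup>+u. ennreal (norm u * semicircle (norm u * t / 2)) * indicator unit_disc u \<partial>lborel)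
    = (\<integral>\<^sup>+r. ennreal (r * semicircle (r * t / 2)) * (ennreal (2 * pi * r) * indicator {0..1} r) \<partial>lborel)"
    by (rule nn_integral_radial) measurable
  also have "\<dots> = (\<integral>\<^sup>+r. ennreal (2 * pi / k\<^sup>2) * (ennreal ((0 + k * r)\<^sup>2 * semicircle (0 + k * r)) * indicator {0..m} (0 + k * r)) \<partial>lborel)"
  proof (rule nn_integral_cong)
    fix r :: real
    show "ennreal (r * semicircle (r * t / 2)) * (ennreal (2 * pi * r) * indicator {0..1} r)
      = ennreal (2 * pi / k\<^sup>2) * (ennreal ((0 + k * r)\<^sup>2 * semicircle (0 + k * r)) * indicator {0..m} (0 + k * r))"
    proof (cases "0 \<le> r \<and> r \<le> 1")
      case True
      have kr: "0 \<le> k * r" "k * r \<le> k" using True k by auto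
      have eq: "ennreal (r * semicircle (r * t / 2)) * ennreal (2 * pi * r) = ennreal (2 * pi / k\<^sup>2) * ennreal ((k * r)\<^sup>2 * semicircle (k * r))"
        using True k semicircle_nonneg[of "k * r"]
        by (simp add: sc power2_eq_square mult_ac flip: ennreal_mult'')
      show ?thesis
      proof (cases "k * r \<le> 1")
        case True': True
        then show ?thesis using eq True kr by (simp add: m_def)
      next
        case False
        then have "1 \<le> (k * r)\<^sup>2" by (simp add: one_le_power)
        then have "semicircle (k * r) = 0" by (simp add: semicircle_def)
        then show ?thesis by (simp add: sc)
      qed
    next
      case False
      then have "\<not> (0 \<le> k * r \<and> k * r \<le> m)" using k
        by (auto simp: m_def zero_le_mult_iff mult_le_cancel_left1)
      then show ?thesis using False by (auto simp: indicator_def)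
    qed
  qed
  also have "\<dots> = ennreal (2 * pi / k\<^sup>2) * (\<integral>\<^sup>+r. ennreal ((0 + k * r)\<^sup>2 * semicircle (0 + k * r)) * indicator {0..m} (0 + k * r) \<partial>lborel)"
    by (rule nn_integral_cmult) measurable
  also have "\<dots> = ennreal (2 * pi / k ^ 3) * (ennreal \<bar>k\<bar> * (\<integral>\<^sup>+r. ennreal ((0 + k * r)\<^sup>2 * semicircle (0 + k * r)) * indicator {0..m} (0 + k * r) \<partial>lborel))"
    using k by (simp add: mult.assoc[symmetric] power2_eq_square power3_eq_cube flip: ennreal_mult'')
  also have "ennreal \<bar>k\<bar> * (\<integral>\<^sup>+r. ennreal ((0 + k * r)\<^sup>2 * semicircle (0 + k * r)) * indicator {0..m} (0 + k * r) \<partial>lborel)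
    = (\<integral>\<^sup>+x. ennreal (x\<^sup>2 * semicircle x) * indicator {0..m} x \<partial>lborel)"
    by (rule nn_integral_real_affine[symmetric]) (use k in \<open>measurable, auto\<close>)
  also have "\<dots> = ennreal ((arcsin m - m * (1 - 2 * m\<^sup>2) * sqrt (1 - m\<^sup>2)) / 8)"
    by (rule second_moment_semicircle[OF m])
  also have "ennreal (2 * pi / k ^ 3) * \<dots> = ennreal (2 * pi / k ^ 3 * ((arcsin m - m * (1 - 2 * m\<^sup>2) * sqrt (1 - m\<^sup>2)) / 8))"
    by (rule ennreal_mult'[symmetric]) (use k in simp)
  also have "2 * pi / k ^ 3 * ((arcsin m - m * (1 - 2 * m\<^sup>2) * sqrt (1 - m\<^sup>2)) / 8) = disc_density t"
  proof (cases "\<bar>t\<bar> \<le> 2")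
    case True
    then have mk: "m = \<bar>t\<bar> / 2" by (simp add: m_def k_def)
    have "2 * pi / k ^ 3 * ((arcsin m - m * (1 - 2 * m\<^sup>2) * sqrt (1 - m\<^sup>2)) / 8)
        = 2 * pi / \<bar>t\<bar> ^ 3 * (arcsin (\<bar>t\<bar> / 2) - \<bar>t\<bar> / 2 * (1 - t\<^sup>2 / 2) * sqrt (1 - t\<^sup>2 / 4))"
      by (simp add: mk k_def power_divide)
    also have "\<dots> = 2 * pi / t ^ 3 * (arcsin (t / 2) - t / 2 * (1 - t\<^sup>2 / 2) * sqrt (1 - t\<^sup>2 / 4))"
    proof (cases "t > 0")
      case False
      then have t': "\<bar>t\<bar> = - t" by simp
      have "arcsin (- (t / 2)) = - arcsin (t / 2)" using True by (intro arcsin_minus) auto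
      then show ?thesis unfolding t' using t by (simp add: field_simps)
    qed simp
    finally show ?thesis using True t by (simp add: disc_density_def)
  next
    case False
    then have "m = 1" by (simp add: m_def k_def)
    then show ?thesis using False by (simp add: disc_density_def k_def power_divide power2_eq_square)
  qed
  finally show ?thesis .
qed

context test_function
begin

text \<open>Integrating out the second coordinate leaves the length \<open>2 sqrt (1 - x^2)\<close> of the chord at abscissa
  \<open>x\<close>, and \<open>t = 2 x / r\<close> is then substituted.\<close>

lemma nn_integral_chord:
  assumes r: "0 < r"
  shows "(\<integral>\<^sup>+v. ennreal (f (2 * r * fst v / r\<^sup>2)) * indicator unit_disc v \<partial>lborel)
    = (\<integral>\<^sup>+t. ennreal (f t) * ennreal (r * semicircle (r * t / 2)) \<partial>lborel)"
proof -
  have [measurable]: "(fst :: real \<times> real \<Rightarrow> real) \<in> borel_measurable borel"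
    by (intro borel_measurable_continuous_onI continuous_intros)
  have [measurable]: "(indicator unit_disc :: _ \<Rightarrow> ennreal) \<in> borel_measurable borel"
    by (intro borel_measurable_indicator) simp
  have slice: "(\<integral>\<^sup>+y. ennreal (f (2 * r * x / r\<^sup>2)) * indicator unit_disc (x, y :: real) \<partial>lborel)
      = ennreal (f (x * (2 / r))) * ennreal (2 * semicircle x)" for x :: real
  proof -
    have c: "indicator unit_disc (x, y) = (if \<bar>x\<bar> \<le> 1 then indicator {- semicircle x..semicircle x} y else 0 :: ennreal)"
      for y :: real
    proof -
      have "norm (x, y) \<le> 1 \<longleftrightarrow> x\<^sup>2 + y\<^sup>2 \<le> 1" by (simp add: norm_prod_def)
      also have "\<dots> \<longleftrightarrow> \<bar>x\<bar> \<le> 1 \<and> \<bar>y\<bar> \<le> semicircle x"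
      proof
        assume le: "x\<^sup>2 + y\<^sup>2 \<le> 1"
        then have x1: "x\<^sup>2 \<le> 1" using zero_le_power2[of y] by linarith
        have "\<bar>y\<bar> \<le> sqrt (1 - x\<^sup>2)" by (rule real_le_rsqrt) (use le in simp)
        then show "\<bar>x\<bar> \<le> 1 \<and> \<bar>y\<bar> \<le> semicircle x" using x1 by (simp add: semicircle_def abs_square_le_1)
      next
        assume a: "\<bar>x\<bar> \<le> 1 \<and> \<bar>y\<bar> \<le> semicircle x"
        then have x1: "x\<^sup>2 \<le> 1" by (simp add: abs_square_le_1)
        have "y\<^sup>2 \<le> (semicircle x)\<^sup>2" using a power_mono[of "\<bar>y\<bar>" "semicircle x" 2] by simp
        then show "x\<^sup>2 + y\<^sup>2 \<le> 1" using x1 by (simp add: semicircle_def)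
      qed
      finally show ?thesis by (auto simp: indicator_def abs_le_iff)
    qed
    have e: "2 * r * x / r\<^sup>2 = x * (2 / r)" using r by (simp add: power2_eq_square)
    show ?thesis unfolding e
    proof (cases "\<bar>x\<bar> \<le> 1")
      case True
      have "(\<integral>\<^sup>+y. ennreal (f (x * (2 / r))) * indicator unit_disc (x, y :: real) \<partial>lborel)
        = ennreal (f (x * (2 / r))) * emeasure lborel {- semicircle x..semicircle x}"
        using True unfolding c by (simp add: nn_integral_cmult_indicator)
      also have "emeasure lborel {- semicircle x..semicircle x} = ennreal (2 * semicircle x)"
        using semicircle_nonneg[of x] by (subst emeasure_lborel_Icc) auto
      finally show "(\<integral>\<^sup>+y. ennreal (f (x * (2 / r))) * indicator unit_disc (x, y :: real) \<partial>lborel)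
        = ennreal (f (x * (2 / r))) * ennreal (2 * semicircle x)" .
    next
      case False
      then have "1 < x\<^sup>2" by (simp add: abs_square_le_1 not_le flip: not_le)
      then have "semicircle x = 0" by (simp add: semicircle_def)
      then show "(\<integral>\<^sup>+y. ennreal (f (x * (2 / r))) * indicator unit_disc (x, y :: real) \<partial>lborel)
        = ennreal (f (x * (2 / r))) * ennreal (2 * semicircle x)" using False unfolding c by simp
    qed
  qed
  have "(\<integral>\<^sup>+v. ennreal (f (2 * r * fst v / r\<^sup>2)) * indicator unit_disc v \<partial>lborel)
    = (\<integral>\<^sup>+x. \<integral>\<^sup>+y. ennreal (f (2 * r * fst (x, y) / r\<^sup>2)) * indicator unit_disc (x, y :: real) \<partial>lborel \<partial>lborel)"
    by (rule nn_integral_plane(2)) measurable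
  also have "\<dots> = (\<integral>\<^sup>+x. ennreal (f (x * (2 / r))) * ennreal (2 * semicircle x) \<partial>lborel)"
    by (simp only: fst_conv slice)
  also have "\<dots> = ennreal \<bar>r / 2\<bar> * (\<integral>\<^sup>+t. ennreal (f ((0 + r / 2 * t) * (2 / r))) * ennreal (2 * semicircle (0 + r / 2 * t)) \<partial>lborel)"
    by (rule nn_integral_real_affine) (use r in \<open>measurable, auto\<close>)
  also have "\<dots> = (\<integral>\<^sup>+t. ennreal \<bar>r / 2\<bar> * (ennreal (f ((0 + r / 2 * t) * (2 / r))) * ennreal (2 * semicircle (0 + r / 2 * t))) \<partial>lborel)"
    by (rule nn_integral_cmult[symmetric]) measurable
  also have "\<dots> = (\<integral>\<^sup>+t. ennreal (f t) * ennreal (r * semicircle (r * t / 2)) \<partial>lborel)"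
    using r by (intro nn_integral_cong) (simp add: nonneg semicircle_nonneg mult_ac flip: ennreal_mult'')
  finally show ?thesis .
qed

text \<open>The left-hand side is an integral of \<open>f (2 (u \<bullet> v) / |u|^2)\<close> over two unit discs. The integral over
  \<open>v\<close> is done first, by rotating \<open>u\<close> onto the first axis and slicing the disc into chords; the
  remaining integral over \<open>u\<close> for fixed \<open>t\<close> is the density.\<close>

lemma nn_disc_integral_average:
  "(\<integral>\<^sup>+v. ennreal (disc_integral (norm v)) * indicator unit_disc v \<partial>lborel)
    = (\<integral>\<^sup>+t. ennreal (f t) * ennreal (disc_density t) \<partial>lborel)"
proof -
  let ?D = "indicator unit_disc :: _ \<Rightarrow> ennreal"
  have [measurable]: "?D \<in> borel_measurable borel"
    by (intro borel_measurable_indicator) simp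
  have [measurable]: "(norm :: real \<times> real \<Rightarrow> real) \<in> borel_measurable borel"
    by (intro borel_measurable_continuous_onI continuous_intros)
  have [measurable]: "(\<lambda>p :: (real \<times> real) \<times> (real \<times> real). fst p \<bullet> snd p) \<in> borel_measurable (borel \<Otimes>\<^sub>M borel)"
    unfolding borel_prod by (intro borel_measurable_continuous_onI continuous_intros)
  define H where "H u v = ennreal (f (2 * (u \<bullet> v) / (norm u)\<^sup>2)) * ?D u * ?D v" for u v :: "real \<times> real"
  have [measurable]: "case_prod H \<in> borel_measurable (borel \<Otimes>\<^sub>M borel)"
    unfolding H_def case_prod_unfold by measurable
  have "(\<integral>\<^sup>+v. ennreal (disc_integral (norm v)) * ?D v \<partial>lborel) = (\<integral>\<^sup>+v. \<integral>\<^sup>+u. H u v \<partial>lborel \<partial>lborel)"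
  proof (rule nn_integral_cong)
    fix v :: "real \<times> real"
    have "(\<integral>\<^sup>+u. H u v \<partial>lborel) = (\<integral>\<^sup>+u. ennreal (f (2 * (u \<bullet> v) / (norm u)\<^sup>2)) * ?D u \<partial>lborel) * ?D v"
      unfolding H_def by (rule nn_integral_multc) measurable
    then show "ennreal (disc_integral (norm v)) * ?D v = (\<integral>\<^sup>+u. H u v \<partial>lborel)"
      using nn_integral_disc_inner[of 1 2 v] by simp
  qed
  also have "\<dots> = (\<integral>\<^sup>+u. \<integral>\<^sup>+v. H u v \<partial>lborel \<partial>lborel)"
    by (rule lborel_pair.Fubini') measurable
  also have "\<dots> = (\<integral>\<^sup>+u. \<integral>\<^sup>+t. ennreal (f t) * (ennreal (norm u * semicircle (norm u * t / 2)) * ?D u) \<partial>lborel \<partial>lborel)"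
  proof (rule nn_integral_cong_AE, rule AE_mp[OF AE_lborel_singleton[of 0]], rule AE_I2, rule impI)
    fix u :: "real \<times> real" assume "u \<noteq> 0"
    then have r: "norm u > 0" by simp
    let ?F = "\<lambda>p. ennreal (f (2 * snd p / (norm u)\<^sup>2)) * indicator {..1} (fst p)"
    have [measurable]: "(fst :: real \<times> real \<Rightarrow> real) \<in> borel_measurable borel"
      "(snd :: real \<times> real \<Rightarrow> real) \<in> borel_measurable borel"
      by (intro borel_measurable_continuous_onI continuous_intros)+
    have [measurable]: "(\<lambda>v. u \<bullet> v) \<in> borel_measurable borel"
      by (intro borel_measurable_continuous_onI continuous_intros)
    have "(\<integral>\<^sup>+v. H u v \<partial>lborel) = (\<integral>\<^sup>+v. ?F (norm v, v \<bullet> u) * ?D u \<partial>lborel)"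
      by (intro nn_integral_cong) (auto simp: H_def indicator_def inner_commute)
    also have "\<dots> = (\<integral>\<^sup>+v. ?F (norm v, v \<bullet> u) \<partial>lborel) * ?D u"
      by (rule nn_integral_multc) (simp only: fst_conv snd_conv inner_commute[of _ u], measurable)
    also have "(\<integral>\<^sup>+v. ?F (norm v, v \<bullet> u) \<partial>lborel) = (\<integral>\<^sup>+v. ?F (norm v, norm u * fst (v :: real \<times> real)) \<partial>lborel)"
      by (rule nn_integral_norm_inner[of ?F]) measurable
    also have "\<dots> = (\<integral>\<^sup>+v. ennreal (f (2 * norm u * fst v / (norm u)\<^sup>2)) * ?D v \<partial>lborel)"
      by (intro nn_integral_cong) (auto simp: indicator_def mult.assoc)
    also have "\<dots> = (\<integral>\<^sup>+t. ennreal (f t) * ennreal (norm u * semicircle (norm u * t / 2)) \<partial>lborel)"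
      by (rule nn_integral_chord[OF r])
    also have "\<dots> * ?D u = (\<integral>\<^sup>+t. ennreal (f t) * ennreal (norm u * semicircle (norm u * t / 2)) * ?D u \<partial>lborel)"
      by (rule nn_integral_multc[symmetric]) measurable
    finally show "(\<integral>\<^sup>+v. H u v \<partial>lborel) = (\<integral>\<^sup>+t. ennreal (f t) * (ennreal (norm u * semicircle (norm u * t / 2)) * ?D u) \<partial>lborel)"
      by (simp add: mult.assoc)
  qed
  also have "\<dots> = (\<integral>\<^sup>+t. \<integral>\<^sup>+u. ennreal (f t) * (ennreal (norm u * semicircle (norm u * t / 2)) * ?D u) \<partial>lborel \<partial>lborel)"
    by (rule lborel_pair.Fubini'[symmetric]) measurable
  also have "\<dots> = (\<integral>\<^sup>+t. ennreal (f t) * ennreal (disc_density t) \<partial>lborel)"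
  proof (rule nn_integral_cong_AE, rule AE_mp[OF AE_lborel_singleton[of 0]], rule AE_I2, rule impI)
    fix t :: real assume t: "t \<noteq> 0"
    have "(\<integral>\<^sup>+u. ennreal (f t) * (ennreal (norm u * semicircle (norm u * t / 2)) * ?D u) \<partial>lborel)
      = ennreal (f t) * (\<integral>\<^sup>+u. ennreal (norm u * semicircle (norm u * t / 2)) * ?D u \<partial>lborel)"
      by (rule nn_integral_cmult) measurable
    then show "(\<integral>\<^sup>+u. ennreal (f t) * (ennreal (norm u * semicircle (norm u * t / 2)) * ?D u) \<partial>lborel)
      = ennreal (f t) * ennreal (disc_density t)" by (simp only: nn_integral_disc_density[OF t])
  qed
  finally show ?thesis .
qed

end

section \<open>Counting lattice points\<close>

lemma card_int_interval_le:
  fixes a b W :: real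
  assumes a: "a \<noteq> 0" and W: "0 \<le> W"
  shows "finite {m::int. \<bar>of_int m * a + b\<bar> \<le> W}"
    and "real (card {m::int. \<bar>of_int m * a + b\<bar> \<le> W}) \<le> 2 * W / \<bar>a\<bar> + 1"
proof -
  define l where "l = - b / a - W / \<bar>a\<bar>"
  define u where "u = - b / a + W / \<bar>a\<bar>"
  have sub: "{m::int. \<bar>of_int m * a + b\<bar> \<le> W} \<subseteq> {\<lceil>l\<rceil>..\<lfloor>u\<rfloor>}"
  proof safe
    fix m :: int assume m: "\<bar>of_int m * a + b\<bar> \<le> W"
    have "of_int m * a + b = a * (of_int m - (- b / a))" using a by (simp add: field_simps)
    then have "\<bar>a\<bar> * \<bar>of_int m - (- b / a)\<bar> \<le> W" using m by (simp add: abs_mult)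
    then have "\<bar>of_int m - (- b / a)\<bar> \<le> W / \<bar>a\<bar>" using a by (simp add: field_simps)
    then have "l \<le> of_int m" "of_int m \<le> u" unfolding l_def u_def by linarith+
    then show "m \<in> {\<lceil>l\<rceil>..\<lfloor>u\<rfloor>}" by (simp add: ceiling_le_iff le_floor_iff)
  qed
  then show "finite {m::int. \<bar>of_int m * a + b\<bar> \<le> W}" by (rule finite_subset) simp
  have "u - l = 2 * W / \<bar>a\<bar>" by (simp add: u_def l_def)
  moreover have "0 \<le> 2 * W / \<bar>a\<bar>" using W by simp
  moreover have "real (card {m::int. \<bar>of_int m * a + b\<bar> \<le> W}) \<le> real (nat (\<lfloor>u\<rfloor> + 1 - \<lceil>l\<rceil>))"
    using card_mono[OF _ sub] by simp
  moreover have "real (nat (\<lfloor>u\<rfloor> + 1 - \<lceil>l\<rceil>)) \<le> max 0 (u - l + 1)"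
  proof (cases "\<lfloor>u\<rfloor> + 1 - \<lceil>l\<rceil> \<ge> 0")
    case True
    then have "real (nat (\<lfloor>u\<rfloor> + 1 - \<lceil>l\<rceil>)) = of_int (\<lfloor>u\<rfloor> + 1 - \<lceil>l\<rceil>)" by simp
    then have "real (nat (\<lfloor>u\<rfloor> + 1 - \<lceil>l\<rceil>)) = of_int \<lfloor>u\<rfloor> + 1 - of_int \<lceil>l\<rceil>" by simp
    then show ?thesis using of_int_floor_le[of u] le_of_int_ceiling[of l] by linarith
  qed simp
  ultimately show "real (card {m::int. \<bar>of_int m * a + b\<bar> \<le> W}) \<le> 2 * W / \<bar>a\<bar> + 1" by simp
qed

lemma card_fibration_le:
  fixes S :: "'a set" and T :: "'a \<Rightarrow> 'b set"
  assumes "finite S" and "\<And>n. n \<in> S \<Longrightarrow> finite (T n)" and "\<And>n. n \<in> S \<Longrightarrow> real (card (T n)) \<le> t"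
    and P: "P \<subseteq> (\<Union>n\<in>S. (\<lambda>m. g m n) ` T n)"
  shows "finite P" "real (card P) \<le> real (card S) * t"
proof -
  have fin: "finite (\<Union>n\<in>S. (\<lambda>m. g m n) ` T n)" using assms by auto
  then show "finite P" using P finite_subset by blast
  have "card P \<le> card (\<Union>n\<in>S. (\<lambda>m. g m n) ` T n)" using fin P by (rule card_mono)
  also have "\<dots> \<le> (\<Sum>n\<in>S. card ((\<lambda>m. g m n) ` T n))" using assms(1) by (rule card_UN_le)
  also have "\<dots> \<le> (\<Sum>n\<in>S. card (T n))" using assms by (intro sum_mono card_image_le) auto
  finally have "real (card P) \<le> (\<Sum>n\<in>S. real (card (T n)))" by (metis of_nat_le_iff of_nat_sum)
  also have "\<dots> \<le> (\<Sum>n\<in>S. t)" using assms by (intro sum_mono) auto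
  finally show "real (card P) \<le> real (card S) * t" by simp
qed

text \<open>
  Points of the lattice \<open>\<int> \<times> y \<int>\<close> are addressed by their integer coordinates, and the plane is taken
  as a product of two lines so that Fubini applies directly.\<close>

locale rectangular_lattice =
  fixes y :: real
  assumes y_pos: "0 < y"
begin

definition point :: "int \<times> int \<Rightarrow> real \<times> real" where
  "point p = (of_int (fst p), y * of_int (snd p))"

lemma point_add: "point (p + q) = point p + point q"
  by (simp add: point_def algebra_simps)

lemma point_0 [simp]: "point 0 = 0"
  by (simp add: point_def zero_prod_def)

lemma point_eq_0_iff [simp]: "point p = 0 \<longleftrightarrow> p = 0"
  using y_pos by (cases p) (simp add: point_def zero_prod_def)

lemma abs_fst_le_norm: "\<bar>fst u\<bar> \<le> norm u" and abs_snd_le_norm: "\<bar>snd u\<bar> \<le> norm u" for u :: "real \<times> real"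
  by (auto simp: norm_prod_def intro: real_le_rsqrt)

lemma norm_le_abs: "norm u \<le> \<bar>fst u\<bar> + \<bar>snd u\<bar>" for u :: "real \<times> real"
  using sqrt_sum_squares_le_sum_abs[of "fst u" "snd u"] by (simp add: norm_prod_def)

lemma finite_disc: "finite {p. norm (point p) \<le> R}"
proof -
  have "{p. norm (point p) \<le> R} \<subseteq> {m. \<bar>of_int m * 1 + 0\<bar> \<le> max 0 R} \<times> {n. \<bar>of_int n * y + 0\<bar> \<le> max 0 R}"
  proof
    fix p assume "p \<in> {p. norm (point p) \<le> R}"
    then show "p \<in> {m. \<bar>of_int m * 1 + 0\<bar> \<le> max 0 R} \<times> {n. \<bar>of_int n * y + 0\<bar> \<le> max 0 R}"
      using abs_fst_le_norm[of "point p"] abs_snd_le_norm[of "point p"]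
      by (simp add: point_def mult.commute mem_Times_iff)
  qed
  moreover have "finite ({m::int. \<bar>of_int m * 1 + 0\<bar> \<le> max 0 R} \<times> {n::int. \<bar>of_int n * y + 0\<bar> \<le> max 0 R})"
    using y_pos by (intro finite_cartesian_product card_int_interval_le(1)) auto
  ultimately show ?thesis by (rule finite_subset)
qed

lemma norm_point_ge:
  assumes "p \<noteq> 0"
  shows "min 1 y \<le> norm (point p)"
proof (cases "fst p = 0")
  case True
  then have "snd p \<noteq> 0" using assms by (auto simp: prod_eq_iff)
  then have "1 \<le> \<bar>real_of_int (snd p)\<bar>" by linarith
  then have "y * 1 \<le> y * \<bar>real_of_int (snd p)\<bar>" using y_pos by (intro mult_left_mono) auto
  then have "y \<le> \<bar>snd (point p)\<bar>" using y_pos by (simp add: point_def abs_mult)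
  then show ?thesis using abs_snd_le_norm[of "point p"] by linarith
next
  case False
  then have "1 \<le> \<bar>real_of_int (fst p)\<bar>" by linarith
  then have "1 \<le> \<bar>fst (point p)\<bar>" by (simp add: point_def)
  then show ?thesis using abs_fst_le_norm[of "point p"] by linarith
qed

text \<open>The strip is sliced by lines parallel to the axis on which \<open>h\<close> has its larger coordinate. Each line
  meets the strip in an interval of length \<open>O(W / |h|)\<close>, and \<open>O(R)\<close> lines meet the disc. The case
  \<open>W = 0\<close> counts lattice points on a line.\<close>

lemma card_strip_le:
  assumes h: "h \<noteq> 0" and R: "1 \<le> R" and W: "0 \<le> W"
  shows "real (card {p. norm (point p) \<le> R \<and> \<bar>point p \<bullet> h - c\<bar> \<le> W}) \<le> 12 * (1 + 1 / y) * R * (W / norm h + 1)"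
    (is "real (card ?P) \<le> _")
proof -
  have nh: "norm h > 0" using h by simp
  have Wh: "0 \<le> W / norm h" using W by simp
  have e: "point p \<bullet> h - c = of_int (fst p) * fst h + (of_int (snd p) * y * snd h - c)"
     "point p \<bullet> h - c = of_int (snd p) * (y * snd h) + (of_int (fst p) * fst h - c)" for p
    by (simp_all add: point_def inner_prod_def algebra_simps)
  consider "norm h \<le> 2 * \<bar>fst h\<bar>" | "norm h \<le> 2 * \<bar>snd h\<bar>" using norm_le_abs[of h] by linarith
  then show ?thesis
  proof cases
    case 1
    let ?S = "{n::int. \<bar>of_int n * y + 0\<bar> \<le> R}"
    let ?T = "\<lambda>n. {m::int. \<bar>of_int m * fst h + (of_int n * y * snd h - c)\<bar> \<le> W}"
    have h1: "fst h \<noteq> 0" using 1 nh by auto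
    have S: "finite ?S" "real (card ?S) \<le> 2 * R / \<bar>y\<bar> + 1" using card_int_interval_le[of y R 0] y_pos R by auto
    have "real (card ?P) \<le> real (card ?S) * (2 * W / \<bar>fst h\<bar> + 1)"
    proof (rule card_fibration_le[where T = ?T and g = Pair])
      show "?P \<subseteq> (\<Union>n\<in>?S. (\<lambda>m. (m, n)) ` ?T n)"
      proof
        fix p assume p: "p \<in> ?P"
        then have "\<bar>of_int (snd p) * y + 0\<bar> \<le> R" using abs_snd_le_norm[of "point p"] by (simp add: point_def mult.commute)
        moreover have "fst p \<in> ?T (snd p)" using p e(1) by simp
        ultimately show "p \<in> (\<Union>n\<in>?S. (\<lambda>m. (m, n)) ` ?T n)" by (intro UN_I[of "snd p"] image_eqI[of _ _ "fst p"]) auto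
      qed
    qed (use S card_int_interval_le[OF h1 W] in auto)
    also have "\<dots> \<le> ((2 / y + 1) * R) * (4 * (W / norm h + 1))"
    proof (rule mult_mono)
      show "real (card ?S) \<le> (2 / y + 1) * R" using S(2) y_pos R by (simp add: algebra_simps)
      have "2 * W / \<bar>fst h\<bar> \<le> 4 * (W / norm h)"
        using divide_left_mono[of "norm h / 2" "\<bar>fst h\<bar>" W] 1 nh h1 W by simp
      then show "2 * W / \<bar>fst h\<bar> + 1 \<le> 4 * (W / norm h + 1)" by simp
    qed (use y_pos R W h1 in auto)
    also have "\<dots> = (8 / y + 4) * (R * (W / norm h + 1))"
    proof -
      have "((2 / y + 1) * R) * (4 * t) = (8 / y + 4) * (R * t)" for t by (simp add: algebra_simps)
      then show ?thesis .
    qed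
    also have "\<dots> \<le> (12 * (1 + 1 / y)) * (R * (W / norm h + 1))"
      by (intro mult_right_mono mult_nonneg_nonneg) (use y_pos R Wh in \<open>simp_all add: field_simps\<close>)
    finally show ?thesis by (simp add: mult.assoc)
  next
    case 2
    let ?S = "{n::int. \<bar>of_int n * 1 + 0\<bar> \<le> R}"
    let ?T = "\<lambda>n. {m::int. \<bar>of_int m * (y * snd h) + (of_int n * fst h - c)\<bar> \<le> W}"
    have h1: "snd h \<noteq> 0" using 2 nh by auto
    then have yh: "y * snd h \<noteq> 0" using y_pos by simp
    have S: "finite ?S" "real (card ?S) \<le> 2 * R / \<bar>1\<bar> + 1" using card_int_interval_le[of 1 R 0] R by auto
    have "real (card ?P) \<le> real (card ?S) * (2 * W / \<bar>y * snd h\<bar> + 1)"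
    proof (rule card_fibration_le[where T = ?T and g = "\<lambda>m n. (n, m)"])
      show "?P \<subseteq> (\<Union>n\<in>?S. (\<lambda>m. (n, m)) ` ?T n)"
      proof
        fix p assume p: "p \<in> ?P"
        then have "\<bar>of_int (fst p) * 1 + 0\<bar> \<le> R" using abs_fst_le_norm[of "point p"] by (simp add: point_def)
        moreover have "snd p \<in> ?T (fst p)" using p e(2) by simp
        ultimately show "p \<in> (\<Union>n\<in>?S. (\<lambda>m. (n, m)) ` ?T n)" by (intro UN_I[of "fst p"] image_eqI[of _ _ "snd p"]) auto
      qed
    qed (use S card_int_interval_le[OF yh W] in auto)
    also have "\<dots> \<le> (3 * R) * (4 * (1 + 1 / y) * (W / norm h + 1))"
    proof (rule mult_mono)
      show "real (card ?S) \<le> 3 * R" using S(2) R by simp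
      have "2 * W / \<bar>snd h\<bar> \<le> 4 * (W / norm h)"
        using divide_left_mono[of "norm h / 2" "\<bar>snd h\<bar>" W] 2 nh h1 W by simp
      then have "2 * W / \<bar>snd h\<bar> / y \<le> 4 * (W / norm h) / y" using y_pos by (intro divide_right_mono) auto
      then have "2 * W / \<bar>y * snd h\<bar> \<le> 4 / y * (W / norm h)" using y_pos by (simp add: abs_mult mult.commute)
      also have "\<dots> \<le> 4 * (1 + 1 / y) * (W / norm h)" using Wh y_pos by (intro mult_right_mono) (auto simp: field_simps)
      finally have "2 * W / \<bar>y * snd h\<bar> \<le> 4 * (1 + 1 / y) * (W / norm h)" .
      then show "2 * W / \<bar>y * snd h\<bar> + 1 \<le> 4 * (1 + 1 / y) * (W / norm h + 1)"
      proof -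
        have "1 \<le> 4 * (1 + 1 / y)" using y_pos by (simp add: add_increasing2)
        then show ?thesis using \<open>2 * W / \<bar>y * snd h\<bar> \<le> 4 * (1 + 1 / y) * (W / norm h)\<close>
          unfolding distrib_left[of "4 * (1 + 1 / y)"] by linarith
      qed
    qed (use y_pos R W h1 in auto)
    also have "\<dots> = 12 * (1 + 1 / y) * R * (W / norm h + 1)"
    proof -
      have "(3 * R) * (4 * a * t) = 12 * a * R * t" for a t by simp
      then show ?thesis .
    qed
    finally show ?thesis .
  qed
qed

lemma card_disc_le:
  assumes R: "1 \<le> R"
  shows "real (card {p. norm (point p) \<le> R}) \<le> 24 * (1 + 1 / y) * R\<^sup>2"
proof -
  have "{p. norm (point p) \<le> R} = {p. norm (point p) \<le> R \<and> \<bar>point p \<bullet> (1, 0) - 0\<bar> \<le> R}"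
  proof (intro Collect_cong iffI conjI)
    fix p assume "norm (point p) \<le> R"
    then show "\<bar>point p \<bullet> (1, 0) - 0\<bar> \<le> R"
      using abs_fst_le_norm[of "point p"] by (simp add: inner_prod_def)
  qed auto
  then have "real (card {p. norm (point p) \<le> R}) \<le> 12 * (1 + 1 / y) * R * (R / norm (1::real, 0::real) + 1)"
    using card_strip_le[of "(1, 0)" R R 0] R by (simp add: zero_prod_def)
  also have "\<dots> \<le> 12 * (1 + 1 / y) * R * (2 * R)"
    using R y_pos by (intro mult_left_mono) (auto simp: norm_prod_def)
  finally show ?thesis by (simp add: power2_eq_square mult_ac)
qed

section \<open>Radial Riemann sums over the lattice\<close>

text \<open>The half-open cells with lower left corner in the lattice tile the plane, and a sum over lattice
  points is an integral of a step function. Comparing a sum with an integral thus becomes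
  a pointwise comparison of functions of \<open>v\<close>.\<close>

definition cell_index :: "real \<times> real \<Rightarrow> int \<times> int" where
  "cell_index v = (\<lfloor>fst v\<rfloor>, \<lfloor>snd v / y\<rfloor>)"

lemma norm_cell_index: "norm (point (cell_index v) - v) \<le> 1 + y"
proof -
  have "\<bar>of_int \<lfloor>fst v\<rfloor> - fst v\<bar> \<le> 1" by linarith
  moreover have "\<bar>of_int \<lfloor>snd v / y\<rfloor> - snd v / y\<bar> \<le> 1" by linarith
  then have "y * \<bar>of_int \<lfloor>snd v / y\<rfloor> - snd v / y\<bar> \<le> y * 1" using y_pos by (intro mult_left_mono) auto
  then have "\<bar>y * (of_int \<lfloor>snd v / y\<rfloor> - snd v / y)\<bar> \<le> y" using y_pos by (simp add: abs_mult)
  then have "\<bar>y * of_int \<lfloor>snd v / y\<rfloor> - snd v\<bar> \<le> y" using y_pos by (simp add: right_diff_distrib)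
  ultimately show ?thesis using norm_le_abs[of "point (cell_index v) - v"]
    by (simp add: point_def cell_index_def)
qed

lemma cell_index_vimage:
  "cell_index -` {p} = {of_int (fst p)..<of_int (fst p) + 1} \<times> {y * of_int (snd p)..<y * of_int (snd p) + y}"
  using y_pos by (cases p) (auto simp: cell_index_def floor_eq_iff field_simps)

lemma measurable_cell_index [measurable]: "cell_index \<in> borel \<rightarrow>\<^sub>M count_space UNIV"
proof (rule measurable_count_space_eq2_countable[THEN iffD2])
  have "cell_index -` {p} \<inter> space borel \<in> sets borel" for p
    unfolding cell_index_vimage by (simp add: borel_Times)
  then show "cell_index \<in> space borel \<rightarrow> UNIV \<and> (\<forall>a\<in>UNIV. cell_index -` {a} \<inter> space borel \<in> sets borel)" by simp
qed

lemma nn_integral_cell_index: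
  assumes fin: "finite P" and z: "\<And>p. p \<notin> P \<Longrightarrow> g p = 0"
  shows "(\<integral>\<^sup>+v. g (cell_index v) \<partial>lborel) = ennreal y * (\<Sum>p\<in>P. g p)"
proof -
  have s: "cell_index -` {p} \<in> sets borel" for p
    unfolding cell_index_vimage by (intro borel_Times) simp_all
  have em: "emeasure lborel (cell_index -` {p}) = ennreal y" for p
  proof -
    have "emeasure lborel (cell_index -` {p}) = emeasure (lborel \<Otimes>\<^sub>M lborel)
      ({of_int (fst p)..<of_int (fst p) + 1 :: real} \<times> {y * of_int (snd p)..<y * of_int (snd p) + y})"
      by (simp add: lborel_prod cell_index_vimage)
    also have "\<dots> = emeasure lborel {of_int (fst p)..<of_int (fst p) + 1 :: real} * emeasure lborel {y * of_int (snd p)..<y * of_int (snd p) + y}"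
      by (rule lborel.emeasure_pair_measure_Times) auto
    also have "\<dots> = ennreal y" using y_pos by simp
    finally show ?thesis .
  qed
  have "g (cell_index v) = (\<Sum>p\<in>P. g p * indicator (cell_index -` {p}) v)" for v
  proof (cases "cell_index v \<in> P")
    case True
    have "(\<Sum>p\<in>P. g p * indicator (cell_index -` {p}) v) = (\<Sum>p\<in>P. if p = cell_index v then g p else 0)"
      by (intro sum.cong) (auto simp: indicator_def)
    then show ?thesis using True fin by simp
  next
    case False
    then have "(\<Sum>p\<in>P. g p * indicator (cell_index -` {p}) v) = 0" by (intro sum.neutral) (auto simp: indicator_def)
    then show ?thesis using z[OF False] by simp
  qed
  then have "(\<integral>\<^sup>+v. g (cell_index v) \<partial>lborel) = (\<integral>\<^sup>+v. (\<Sum>p\<in>P. g p * indicator (cell_index -` {p}) v) \<partial>lborel)" by simp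
  also have "\<dots> = (\<Sum>p\<in>P. \<integral>\<^sup>+v. g p * indicator (cell_index -` {p}) v \<partial>lborel)"
    by (rule nn_integral_sum) (use s in measurable)
  also have "\<dots> = (\<Sum>p\<in>P. g p * ennreal y)"
    by (intro sum.cong refl) (simp add: nn_integral_cmult_indicator s em)
  finally show ?thesis by (simp add: sum_distrib_left mult.commute)
qed

definition punctured_disc :: "real \<Rightarrow> (int \<times> int) set" where
  "punctured_disc X = {p. p \<noteq> 0 \<and> norm (point p) \<le> X}"

lemma finite_punctured_disc: "finite (punctured_disc X)"
  unfolding punctured_disc_def using finite_disc by (rule finite_subset[rotated]) auto

lemma nn_integral_inverse_norm:
  assumes "0 < R" "0 \<le> D"
  shows "(\<integral>\<^sup>+v. ennreal (D / norm v) * indicator (cball 0 R) (v :: real \<times> real) \<partial>lborel) < \<infinity>"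
proof -
  have m: "(\<lambda>v :: real \<times> real. ennreal (D / norm v) * indicator (cball 0 R) v) \<in> borel_measurable borel"
    by (intro borel_measurable_times_ennreal measurable_compose[OF _ measurable_ennreal]
        borel_measurable_indicator borel_measurable_divide borel_measurable_norm) simp_all
  have "(\<integral>\<^sup>+v. ennreal (D / norm v) * indicator (cball 0 R) (v :: real \<times> real) \<partial>lborel)
     = ennreal (R\<^sup>2) * (\<integral>\<^sup>+v. ennreal (D / norm (R *\<^sub>R v)) * indicator (cball 0 R) (R *\<^sub>R v :: real \<times> real) \<partial>lborel)"
    by (rule nn_integral_plane_scale[OF m]) (use assms in simp)
  also have "(\<lambda>v. ennreal (D / norm (R *\<^sub>R v)) * indicator (cball 0 R) (R *\<^sub>R v :: real \<times> real))
     = (\<lambda>v. ennreal (D / R / norm v) * indicator unit_disc v)"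
    using assms by (auto simp: fun_eq_iff indicator_def)
  also have "ennreal (R\<^sup>2) * (\<integral>\<^sup>+v. ennreal (D / R / norm v) * indicator unit_disc v \<partial>lborel)
      = ennreal (R\<^sup>2) * ennreal (2 * pi * (D / R))"
    by (simp only: nn_integral_radial_const_over[OF divide_nonneg_pos[OF assms(2,1)]])
  finally show ?thesis by (simp add: ennreal_mult_less_top)
qed

end

context rectangular_lattice
begin

lemma AE_norm_neq_1: "AE v :: real \<times> real in lborel. norm v \<noteq> 1"
proof (rule AE_I')
  from negligible_sphere[of "0 :: real \<times> real" 1] show "sphere (0 :: real \<times> real) 1 \<in> null_sets lborel"
    by (auto simp: null_sets_completion_iff negligible_iff_null_sets negligible_convex_frontier)
qed auto

text \<open>The sum is \<open>1 / y\<close> times the integral of a step function of \<open>v\<close>, constant on the cells of the lattice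
  scaled by \<open>1 / X N\<close>, and dominated convergence applies. The singularity allowed at the origin, of
  order \<open>1 / r\<close>, is integrable in the plane; a nonzero lattice point has norm at least \<open>min 1 y\<close>, so
  on its cell \<open>|v|\<close> is at most a constant multiple of the norm of the scaled lattice point. Only
  pointwise convergence away from 0 is asked for, in the form of convergence along convergent sequences.\<close>

lemma radial_riemann_sum:
  fixes X :: "nat \<Rightarrow> real" and \<phi> :: "nat \<Rightarrow> real \<Rightarrow> real" and \<phi>' :: "real \<Rightarrow> real"
  assumes X: "filterlim X at_top sequentially"
    and bound: "\<forall>\<^sub>F N in sequentially. \<forall>r. 0 < r \<and> r \<le> 1 \<longrightarrow> 0 \<le> \<phi> N r \<and> \<phi> N r \<le> D / r"
    and conv: "\<And>r s. 0 < r \<Longrightarrow> s \<longlonglongrightarrow> r \<Longrightarrow> (\<lambda>N. \<phi> N (s N)) \<longlonglongrightarrow> \<phi>' r"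
    and m [measurable]: "\<phi>' \<in> borel_measurable borel"
    and L: "(\<integral>\<^sup>+v. ennreal (\<phi>' (norm v)) * indicator unit_disc v \<partial>lborel) = ennreal L" "0 \<le> L"
    and D: "0 \<le> D"
  shows "(\<lambda>N. (\<Sum>p\<in>punctured_disc (X N). \<phi> N (norm (point p) / X N)) / (X N)\<^sup>2) \<longlonglongrightarrow> L / y"
proof -
  \<comment> \<open>Dominated convergence needs a bound for every index, so the summand is set to 0 at the
    finitely many indices without one.\<close>
  define good where "good N \<longleftrightarrow> X N \<ge> 1 \<and> (\<forall>r. 0 < r \<and> r \<le> 1 \<longrightarrow> 0 \<le> \<phi> N r \<and> \<phi> N r \<le> D / r)" for N
  have good: "\<forall>\<^sub>F N in sequentially. good N"
    unfolding good_def using bound X by (auto simp: filterlim_at_top intro: eventually_conj)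
  define c where "c N p = (if good N \<and> p \<in> punctured_disc (X N) then \<phi> N (norm (point p) / X N) else 0)" for N p
  have [measurable]: "(\<lambda>v. ennreal (c N (cell_index v))) \<in> borel_measurable borel" for N
    by (rule measurable_compose[OF measurable_cell_index]) simp
  have [measurable]: "(\<lambda>v. ennreal (c N (cell_index (X N *\<^sub>R v)))) \<in> borel_measurable borel" for N
    by (rule measurable_compose[of "\<lambda>v. X N *\<^sub>R v" borel borel]) (simp_all add: borel_measurable_continuous_onI)
  \<comment> \<open>On the cell of a nonzero lattice point \<open>p\<close>, \<open>X N * |v| \<le> |p| + 1 + y \<le> K |p|\<close>.\<close>
  define K where "K = 1 + (1 + y) / min 1 y"
  have m0: "0 < min 1 y" using y_pos by simp
  have K: "0 < K" using y_pos by (simp add: K_def add_pos_pos)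
  have ptX: "X N * norm v \<le> norm (point (cell_index (X N *\<^sub>R v))) + (1 + y)"
    "norm (point (cell_index (X N *\<^sub>R v))) \<le> X N * norm v + (1 + y)" if "0 \<le> X N" for N v
    using norm_cell_index[of "X N *\<^sub>R v"] norm_triangle_ineq3[of "point (cell_index (X N *\<^sub>R v))" "X N *\<^sub>R v"] that
    by (auto simp: abs_le_iff)
  have "(\<lambda>N. \<integral>\<^sup>+v. ennreal (c N (cell_index (X N *\<^sub>R v))) \<partial>lborel) \<longlonglongrightarrow>
      (\<integral>\<^sup>+v. ennreal (\<phi>' (norm v)) * indicator unit_disc v \<partial>lborel)"
  proof (rule nn_integral_dominated_convergence[where w = "\<lambda>v. ennreal (D * K / norm v) * indicator (cball 0 (2 + y)) v"])
    show "(\<integral>\<^sup>+v. ennreal (D * K / norm v) * indicator (cball 0 (2 + y)) (v :: real \<times> real) \<partial>lborel) < \<infinity>"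
      by (rule nn_integral_inverse_norm) (use y_pos D K in auto)
    show "(\<lambda>v :: real \<times> real. ennreal (D * K / norm v) * indicator (cball 0 (2 + y)) v) \<in> borel_measurable lborel"
      by (intro borel_measurable_times_ennreal measurable_compose[OF _ measurable_ennreal]
        borel_measurable_indicator borel_measurable_divide borel_measurable_norm) simp_all
    show "(\<lambda>v :: real \<times> real. ennreal (\<phi>' (norm v)) * indicator unit_disc v) \<in> borel_measurable lborel"
      by (intro borel_measurable_times_ennreal measurable_compose[OF _ measurable_ennreal]
        borel_measurable_indicator measurable_compose[OF _ m] borel_measurable_norm) simp_all
    show "AE v in lborel. ennreal (c N (cell_index (X N *\<^sub>R v))) \<le> ennreal (D * K / norm v) * indicator (cball 0 (2 + y)) v" for N
      using AE_lborel_singleton[of 0]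
    proof eventually_elim
      fix v :: "real \<times> real" assume v: "v \<noteq> 0"
      let ?p = "cell_index (X N *\<^sub>R v)"
      show "ennreal (c N ?p) \<le> ennreal (D * K / norm v) * indicator (cball 0 (2 + y)) v"
      proof (cases "good N \<and> ?p \<in> punctured_disc (X N)")
        case True
        then have g: "X N \<ge> 1" "\<And>r. 0 < r \<Longrightarrow> r \<le> 1 \<Longrightarrow> \<phi> N r \<le> D / r" and p: "?p \<noteq> 0" "norm (point ?p) \<le> X N"
          by (auto simp: good_def punctured_disc_def)
        have pn: "min 1 y \<le> norm (point ?p)" by (rule norm_point_ge[OF p(1)])
        then have pp: "0 < norm (point ?p)" using m0 by linarith
        have "(1 + y) / min 1 y * min 1 y \<le> (1 + y) / min 1 y * norm (point ?p)"
          using pn m0 y_pos by (intro mult_left_mono) auto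
        moreover have "(1 + y) / min 1 y * min 1 y = 1 + y" using m0 by simp
        ultimately have "X N * norm v \<le> norm (point ?p) + (1 + y) / min 1 y * norm (point ?p)"
          using ptX(1)[of N v] g(1) by linarith
        then have "X N * norm v \<le> K * norm (point ?p)" unfolding K_def distrib_right by simp
        then have q: "X N / norm (point ?p) \<le> K / norm v" using pp v by (simp add: field_simps)
        have "c N ?p = \<phi> N (norm (point ?p) / X N)" using True by (simp add: c_def)
        also have "\<dots> \<le> D / (norm (point ?p) / X N)" using g pp p by (intro g(2)) auto
        also have "\<dots> = D * (X N / norm (point ?p))" by simp
        also have "\<dots> \<le> D * (K / norm v)" by (rule mult_left_mono[OF q D])
        finally have 1: "c N ?p \<le> D * K / norm v" by simp
        have "X N * norm v \<le> X N + (1 + y)" using ptX(1)[of N v] p g by linarith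
        also have "\<dots> \<le> X N * (2 + y)"
          using mult_left_mono[OF g(1), of "1 + y"] y_pos by (simp add: algebra_simps)
        finally have "norm v \<le> 2 + y" using g(1) by simp
        then show ?thesis using 1 by (simp add: ennreal_leI)
      qed (auto simp: c_def)
    qed
    show "AE v in lborel. (\<lambda>N. ennreal (c N (cell_index (X N *\<^sub>R v)))) \<longlonglongrightarrow> ennreal (\<phi>' (norm v)) * indicator unit_disc v"
      using AE_lborel_singleton[of 0] AE_norm_neq_1
    proof eventually_elim
      fix v :: "real \<times> real" assume v: "v \<noteq> 0" "norm v \<noteq> 1"
      define s where "s N = norm (point (cell_index (X N *\<^sub>R v))) / X N" for N
      have s: "s \<longlonglongrightarrow> norm v"
      proof -
        have "((\<lambda>N. (1 + y) / X N) \<longlongrightarrow> 0) sequentially"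
          by (intro tendsto_divide_0[OF tendsto_const] filterlim_at_top_imp_at_infinity X)
        moreover have "\<forall>\<^sub>F N in sequentially. norm (s N - norm v) \<le> (1 + y) / X N"
          using good
        proof eventually_elim
          case (elim N)
          then have X1: "X N > 0" by (simp add: good_def)
          have "s N - norm v = (norm (point (cell_index (X N *\<^sub>R v))) - X N * norm v) / X N"
            using X1 by (simp add: s_def field_simps)
          moreover have "\<bar>norm (point (cell_index (X N *\<^sub>R v))) - X N * norm v\<bar> \<le> 1 + y"
            using ptX[of N v] X1 by (simp add: abs_le_iff)
          ultimately show ?case using X1 by (simp add: divide_right_mono)
        qed
        ultimately have "(\<lambda>N. s N - norm v) \<longlonglongrightarrow> 0" by (rule Lim_null_comparison[rotated])
        then show ?thesis by (simp add: LIM_zero_iff)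
      qed
      show "(\<lambda>N. ennreal (c N (cell_index (X N *\<^sub>R v)))) \<longlonglongrightarrow> ennreal (\<phi>' (norm v)) * indicator unit_disc v"
      proof (cases "norm v < 1")
        case True
        have "\<forall>\<^sub>F N in sequentially. s N > 0" "\<forall>\<^sub>F N in sequentially. s N < 1"
          using order_tendstoD(1)[OF s, of 0] order_tendstoD(2)[OF s, of 1] v True by auto
        with good have "\<forall>\<^sub>F N in sequentially. ennreal (\<phi> N (s N)) = ennreal (c N (cell_index (X N *\<^sub>R v)))"
        proof eventually_elim
          case (elim N)
          then have "X N > 0" by (simp add: good_def)
          then show ?case using elim by (auto simp: c_def s_def punctured_disc_def field_simps)
        qed
        moreover have "(\<lambda>N. ennreal (\<phi> N (s N))) \<longlonglongrightarrow> ennreal (\<phi>' (norm v))"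
          by (intro tendsto_ennrealI conv s) (use v in simp)
        ultimately show ?thesis using True by (simp add: tendsto_cong)
      next
        case False
        then have "norm v > 1" using v by simp
        from order_tendstoD(1)[OF s this] good
        have "\<forall>\<^sub>F N in sequentially. 0 = ennreal (c N (cell_index (X N *\<^sub>R v)))"
        proof eventually_elim
          case (elim N)
          then have "X N > 0" by (simp add: good_def)
          then show ?case using elim by (auto simp: c_def s_def punctured_disc_def field_simps)
        qed
        then have "(\<lambda>N. ennreal (c N (cell_index (X N *\<^sub>R v)))) \<longlonglongrightarrow> 0" by (rule tendsto_eventually[OF eventually_mono]) simp
        then show ?thesis using \<open>norm v > 1\<close> by simp
      qed
    qed
  qed simp_all
  then have lim: "(\<lambda>N. \<integral>\<^sup>+v. ennreal (c N (cell_index (X N *\<^sub>R v))) \<partial>lborel) \<longlonglongrightarrow> ennreal L" unfolding L .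
  define \<sigma> where "\<sigma> N = (\<Sum>p\<in>punctured_disc (X N). \<phi> N (norm (point p) / X N)) / (X N)\<^sup>2" for N
  have "\<forall>\<^sub>F N in sequentially. (\<integral>\<^sup>+v. ennreal (c N (cell_index (X N *\<^sub>R v))) \<partial>lborel) = ennreal (y * \<sigma> N) \<and> 0 \<le> y * \<sigma> N"
    using good
  proof eventually_elim
    case (elim N)
    then have X1: "X N \<ge> 1" and pos: "\<And>r. 0 < r \<Longrightarrow> r \<le> 1 \<Longrightarrow> 0 \<le> \<phi> N r" by (auto simp: good_def)
    have cp: "0 \<le> c N p" for p
    proof (cases "p \<in> punctured_disc (X N)")
      case True
      then have "0 < norm (point p) / X N" "norm (point p) / X N \<le> 1" using X1 by (auto simp: punctured_disc_def)
      then show ?thesis using pos by (simp add: c_def)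
    qed (simp add: c_def)
    have sum: "(\<Sum>p\<in>punctured_disc (X N). c N p) = (\<Sum>p\<in>punctured_disc (X N). \<phi> N (norm (point p) / X N))"
      using elim by (intro sum.cong) (auto simp: c_def)
    have "ennreal ((X N)\<^sup>2) * (\<integral>\<^sup>+v. ennreal (c N (cell_index (X N *\<^sub>R v))) \<partial>lborel) = (\<integral>\<^sup>+v. ennreal (c N (cell_index v)) \<partial>lborel)"
      by (rule nn_integral_plane_scale[symmetric]) (use X1 in auto)
    also have "\<dots> = ennreal y * (\<Sum>p\<in>punctured_disc (X N). ennreal (c N p))"
      by (rule nn_integral_cell_index[OF finite_punctured_disc]) (auto simp: c_def)
    also have "\<dots> = ennreal (y * (\<Sum>p\<in>punctured_disc (X N). c N p))"
      using y_pos by (simp add: cp ennreal_mult' sum_nonneg)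
    also have "\<dots> = ennreal ((X N)\<^sup>2 * (y * \<sigma> N))" using X1 by (simp add: sum \<sigma>_def)
    also have "\<dots> = ennreal ((X N)\<^sup>2) * ennreal (y * \<sigma> N)" by (rule ennreal_mult') simp
    finally have "(\<integral>\<^sup>+v. ennreal (c N (cell_index (X N *\<^sub>R v))) \<partial>lborel) = ennreal (y * \<sigma> N)"
      using X1 by (simp add: ennreal_mult_cancel_left)
    moreover have "0 \<le> y * \<sigma> N" using y_pos cp by (simp add: \<sigma>_def sum_nonneg flip: sum)
    ultimately show ?case by simp
  qed
  then have ev: "\<forall>\<^sub>F N in sequentially. (\<integral>\<^sup>+v. ennreal (c N (cell_index (X N *\<^sub>R v))) \<partial>lborel) = ennreal (y * \<sigma> N)"
    "\<forall>\<^sub>F N in sequentially. 0 \<le> y * \<sigma> N" by (auto elim: eventually_mono)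
  have "(\<lambda>N. ennreal (y * \<sigma> N)) \<longlonglongrightarrow> ennreal L" using lim ev(1) by (simp add: tendsto_cong)
  then have "(\<lambda>N. y * \<sigma> N) \<longlonglongrightarrow> L" using ev(2) L(2) by (subst (asm) tendsto_ennreal_iff) auto
  then have "(\<lambda>N. y * \<sigma> N / y) \<longlonglongrightarrow> L / y" using y_pos by (intro tendsto_divide tendsto_const) auto
  then show ?thesis using y_pos by (simp add: \<sigma>_def)
qed

end

section \<open>Linearization of the logarithmic gap\<close>

text \<open>The inversion \<open>z / |z|^2\<close> multiplies the distance of two points by \<open>1 / (|z| |u|)\<close>.\<close>

lemma norm_inversion_diff:
  fixes z u :: "'a :: real_inner"
  assumes "z \<noteq> 0" "u \<noteq> 0"
  shows "norm (z /\<^sub>R (norm z)\<^sup>2 - u /\<^sub>R (norm u)\<^sup>2) = norm (z - u) / (norm z * norm u)"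
proof -
  have p: "norm z > 0" "norm u > 0" using assms by auto
  have e: "(norm (a *\<^sub>R z - b *\<^sub>R u))\<^sup>2 = a\<^sup>2 * (norm z)\<^sup>2 + b\<^sup>2 * (norm u)\<^sup>2 - 2 * (a * b) * (z \<bullet> u)" for a b
    unfolding power2_norm_eq_inner
    by (simp add: inner_diff_left inner_diff_right inner_commute power2_eq_square algebra_simps)
  have e1: "(norm (z - u))\<^sup>2 = (norm z)\<^sup>2 + (norm u)\<^sup>2 - 2 * (z \<bullet> u)" using e[of 1 1] by simp
  have "(norm (z /\<^sub>R (norm z)\<^sup>2 - u /\<^sub>R (norm u)\<^sup>2))\<^sup>2 = (norm (z - u) / (norm z * norm u))\<^sup>2"
    unfolding e power_divide e1 using p by (simp add: field_simps power2_eq_square)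
  then show ?thesis by (rule power2_eq_imp_eq) auto
qed

text \<open>With \<open>1 + x = |z + h|^2 / |z|^2\<close>, three errors add up: the quadratic remainder of the logarithm, the
  term \<open>|h|^2 / |z|^2\<close> of \<open>x\<close>, and the change from \<open>z\<close> to the nearby point \<open>u\<close>, which the inversion
  formula controls.\<close>

lemma log_ratio_linearization:
  fixes z u h :: "'a :: real_inner"
  assumes z: "z \<noteq> 0" and u: "u \<noteq> 0" and h: "8 * norm h \<le> norm z"
  shows "\<bar>ln ((norm (z + h))\<^sup>2 / (norm z)\<^sup>2) - 2 * (u \<bullet> h) / (norm u)\<^sup>2\<bar>
    \<le> 19 * (norm h / norm z)\<^sup>2 + 2 * norm h * norm (z - u) / (norm z * norm u)"
proof -
  define t where "t = norm h / norm z"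
  define x where "x = 2 * (z \<bullet> h) / (norm z)\<^sup>2 + t\<^sup>2"
  have nz: "norm z > 0" using z by simp
  have t: "0 \<le> t" "t \<le> 1 / 8" using h nz by (simp_all add: t_def field_simps)
  have "(norm (z + h))\<^sup>2 = (norm z)\<^sup>2 * (1 + x)"
    using nz by (simp add: x_def t_def power_divide field_simps power2_norm_eq_inner inner_add inner_commute)
  then have ratio: "(norm (z + h))\<^sup>2 / (norm z)\<^sup>2 = 1 + x" using nz by simp
  have "\<bar>2 * (z \<bullet> h) / (norm z)\<^sup>2\<bar> \<le> 2 * (norm z * norm h) / (norm z)\<^sup>2"
    using Cauchy_Schwarz_ineq2[of z h] nz by (simp add: abs_mult divide_right_mono)
  also have "\<dots> = 2 * t" using nz by (simp add: t_def power2_eq_square)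
  finally have a: "\<bar>2 * (z \<bullet> h) / (norm z)\<^sup>2\<bar> \<le> 2 * t" .
  have t2: "t\<^sup>2 \<le> t" using t by (simp add: power2_eq_square mult_left_le)
  then have x3: "\<bar>x\<bar> \<le> 3 * t" using a abs_triangle_ineq[of "2 * (z \<bullet> h) / (norm z)\<^sup>2" "t\<^sup>2"]
    unfolding x_def abs_of_nonneg[OF zero_le_power2] by linarith
  then have "\<bar>x\<bar> \<le> 1 / 2" using t by linarith
  then have ln: "\<bar>ln (1 + x) - x\<bar> \<le> 2 * x\<^sup>2" by (rule abs_ln_one_plus_x_minus_x_bound)
  have "x\<^sup>2 \<le> (3 * t)\<^sup>2" using power_mono[OF x3, of 2] by simp
  then have x2: "2 * x\<^sup>2 \<le> 18 * t\<^sup>2" by (simp add: power_mult_distrib)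
  have "2 * (z \<bullet> h) / (norm z)\<^sup>2 - 2 * (u \<bullet> h) / (norm u)\<^sup>2 = 2 * ((z /\<^sub>R (norm z)\<^sup>2 - u /\<^sub>R (norm u)\<^sup>2) \<bullet> h)"
    by (simp add: inner_diff_left divide_inverse mult_ac right_diff_distrib)
  also have "\<bar>\<dots>\<bar> \<le> 2 * (norm (z /\<^sub>R (norm z)\<^sup>2 - u /\<^sub>R (norm u)\<^sup>2) * norm h)"
    using Cauchy_Schwarz_ineq2[of "z /\<^sub>R (norm z)\<^sup>2 - u /\<^sub>R (norm u)\<^sup>2" h] by (simp add: abs_mult)
  also have "\<dots> = 2 * norm h * norm (z - u) / (norm z * norm u)"
    unfolding norm_inversion_diff[OF z u] by simp
  finally have d: "\<bar>2 * (z \<bullet> h) / (norm z)\<^sup>2 - 2 * (u \<bullet> h) / (norm u)\<^sup>2\<bar> \<le> 2 * norm h * norm (z - u) / (norm z * norm u)" .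
  have "ln (1 + x) - 2 * (u \<bullet> h) / (norm u)\<^sup>2 = (ln (1 + x) - x) + t\<^sup>2 + (2 * (z \<bullet> h) / (norm z)\<^sup>2 - 2 * (u \<bullet> h) / (norm u)\<^sup>2)"
    by (simp add: x_def)
  then have "\<bar>ln (1 + x) - 2 * (u \<bullet> h) / (norm u)\<^sup>2\<bar> \<le> 18 * t\<^sup>2 + t\<^sup>2 + 2 * norm h * norm (z - u) / (norm z * norm u)"
    using ln x2 d zero_le_power2[of t] by linarith
  then show ?thesis unfolding ratio t_def by simp
qed

section \<open>Asymptotics of the pair sums\<close>

text \<open>
  A pair of lattice points is described by its base point \<open>q\<close> and the difference \<open>p\<close>. The
  renormalization is \<open>\<psi> N = N^(2 + 2 \<alpha>) / \<mu> N\<close>. The factor \<open>\<mu>\<close> separates the regimes: it is 1 as long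
  as the typical gap \<open>gap_scale N = N^(\<alpha> + \<beta> - 1)\<close> stays bounded, and it equals the gap scale when that
  scale tends to infinity, since only a proportion \<open>1 / gap_scale N\<close> of the pairs then has a bounded
  gap. The condition on \<open>2 \<alpha> + \<beta>\<close> makes the quadratic terms of the logarithm negligible.\<close>

locale pair_sums = rectangular_lattice y + test_function f M B
  for y :: real and f M B +
  fixes \<alpha> \<beta> :: real and \<mu> :: "nat \<Rightarrow> real"
  assumes \<alpha>_pos: "0 < \<alpha>" and \<alpha>_less: "\<alpha> < 1 / 2" and \<beta>_pos: "0 < \<beta>"
    and exponents: "2 * \<alpha> + \<beta> < 2"
    and \<mu>_cases: "(\<forall>N. \<mu> N = 1) \<or> (1 < \<alpha> + \<beta> \<and> (\<forall>N. \<mu> N = real N powr (\<alpha> + \<beta> - 1)))"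
begin

definition X :: "nat \<Rightarrow> real" where "X N = real N powr \<alpha>"

definition gap_scale :: "nat \<Rightarrow> real" where "gap_scale N = real N powr (\<alpha> + \<beta> - 1)"

definition \<psi> :: "nat \<Rightarrow> real" where "\<psi> N = (real N)\<^sup>2 * (X N)\<^sup>2 / \<mu> N"

abbreviation C\<^sub>2 :: real where "C\<^sub>2 \<equiv> pi * B + 4 * M * B"

definition log_gap :: "nat \<Rightarrow> int \<times> int \<Rightarrow> int \<times> int \<Rightarrow> real" where
  "log_gap N p q = real N powr \<beta> * ln ((norm (point q + point p))\<^sup>2 / (norm (point q))\<^sup>2)"

abbreviation linear_gap :: "nat \<Rightarrow> int \<times> int \<Rightarrow> real \<times> real \<Rightarrow> real" where
  "linear_gap N p u \<equiv> 2 * real N powr \<beta> * (u \<bullet> point p) / (norm u)\<^sup>2"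

text \<open>For a difference \<open>p\<close>: the base points that enter the pair sum, those with a gap in a slight
  enlargement of the support of \<open>f\<close>, and those that the condition \<open>a \<noteq> b\<close> removes.\<close>

definition starts :: "nat \<Rightarrow> int \<times> int \<Rightarrow> (int \<times> int) set" where
  "starts N p = {q. q \<noteq> 0 \<and> q + p \<noteq> 0 \<and> norm (point q) \<le> real N \<and> norm (point q + point p) \<le> real N
     \<and> norm (point q + point p) \<noteq> norm (point q)}"

definition near_starts :: "nat \<Rightarrow> real \<Rightarrow> int \<times> int \<Rightarrow> (int \<times> int) set" where
  "near_starts N \<kappa> p = {q. q \<noteq> 0 \<and> q + p \<noteq> 0 \<and> norm (point q) \<le> \<kappa> * real N \<and> \<bar>log_gap N p q\<bar> \<le> M + 1}"

definition equal_starts :: "nat \<Rightarrow> int \<times> int \<Rightarrow> (int \<times> int) set" where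
  "equal_starts N p = {q. norm (point q) \<le> real N \<and> norm (point q + point p) = norm (point q)}"

definition pair_sum :: "nat \<Rightarrow> real" where
  "pair_sum N = (\<Sum>p\<in>punctured_disc (X N). \<Sum>q\<in>starts N p. f (log_gap N p q))"

abbreviation main_term :: "nat \<Rightarrow> int \<times> int \<Rightarrow> real \<Rightarrow> real" where
  "main_term N p R \<equiv> R\<^sup>2 * disc_integral (real N powr \<beta> * norm (point p) / R)"

text \<open>The prediction for the pair sum, up to the factor \<open>1 / y\<close>: for each difference, the sum over base
  points is replaced by an integral over the disc of radius \<open>R\<close>.\<close>

definition disc_sum :: "nat \<Rightarrow> real \<Rightarrow> real" where
  "disc_sum N R = (\<Sum>p\<in>punctured_disc (X N). main_term N p R)"

abbreviation near_total :: "nat \<Rightarrow> real \<Rightarrow> real" where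
  "near_total N \<kappa> \<equiv> (\<Sum>p\<in>punctured_disc (X N). real (card (near_starts N \<kappa> p)))"

abbreviation equal_total :: "nat \<Rightarrow> real" where
  "equal_total N \<equiv> (\<Sum>p\<in>punctured_disc (X N). real (card (equal_starts N p)))"

lemma finite_starts: "finite (starts N p)" "finite (near_starts N \<kappa> p)" "finite (equal_starts N p)"
  unfolding starts_def near_starts_def equal_starts_def
  by (rule finite_subset[OF _ finite_disc[of "real N"]] finite_subset[OF _ finite_disc[of "\<kappa> * real N"]]; blast)+

lemma filterlim_nat_powr_at_top:
  assumes "0 < a"
  shows "filterlim (\<lambda>N. real N powr a) at_top sequentially"
proof -
  have "filterlim (\<lambda>N. exp (a * ln (real N))) at_top sequentially"
    by (intro filterlim_compose[OF exp_at_top] filterlim_tendsto_pos_mult_at_top[OF tendsto_const assms]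
        filterlim_compose[OF ln_at_top] filterlim_real_sequentially)
  moreover have "\<forall>\<^sub>F N in sequentially. exp (a * ln (real N)) = real N powr a"
    using eventually_gt_at_top[of 0] by eventually_elim (simp add: powr_def)
  ultimately show ?thesis by (simp add: filterlim_cong)
qed

lemma X_at_top: "filterlim X at_top sequentially"
  unfolding X_def[abs_def] by (rule filterlim_nat_powr_at_top[OF \<alpha>_pos])

lemma eventually_X_ge_1: "\<forall>\<^sub>F N in sequentially. X N \<ge> 1"
  using X_at_top by (simp add: filterlim_at_top)

lemma tendsto_powr_neg_real: "a < 0 \<Longrightarrow> (\<lambda>N. real N powr a) \<longlonglongrightarrow> 0"
  by (rule tendsto_neg_powr[OF _ filterlim_real_sequentially])

lemma \<mu>_ge_1: "1 \<le> N \<Longrightarrow> 1 \<le> \<mu> N"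
  using \<mu>_cases by (auto intro!: ge_one_powr_ge_zero)

lemma \<psi>_pos: "1 \<le> N \<Longrightarrow> 0 < \<psi> N"
  using \<mu>_ge_1[of N] by (simp add: \<psi>_def X_def)

lemma powr_\<beta>_eq:
  assumes "1 \<le> N"
  shows "real N powr \<beta> = gap_scale N * real N / X N"
proof -
  have "gap_scale N * real N / X N = real N powr (\<alpha> + \<beta> - 1) * real N powr 1 / real N powr \<alpha>"
    using assms by (simp add: gap_scale_def X_def)
  also have "\<dots> = real N powr \<beta>" unfolding powr_add[symmetric] powr_diff[symmetric] by simp
  finally show ?thesis by simp
qed

lemma \<mu>_over_N: "(\<lambda>N. \<mu> N / real N) \<longlonglongrightarrow> 0"
  using \<mu>_cases
proof
  assume "\<forall>N. \<mu> N = 1"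
  then show ?thesis by (simp add: lim_inverse_n')
next
  assume a: "1 < \<alpha> + \<beta> \<and> (\<forall>N. \<mu> N = real N powr (\<alpha> + \<beta> - 1))"
  have "\<forall>\<^sub>F N in sequentially. real N powr (\<alpha> + \<beta> - 2) = \<mu> N / real N"
    using eventually_ge_at_top[of 1]
  proof eventually_elim
    case (elim N)
    have "real N powr (\<alpha> + \<beta> - 2) = real N powr (\<alpha> + \<beta> - 1) / real N powr 1"
      by (subst powr_diff[symmetric]) simp
    then show ?case using a elim by simp
  qed
  moreover have "(\<lambda>N. real N powr (\<alpha> + \<beta> - 2)) \<longlonglongrightarrow> 0"
    using exponents \<alpha>_pos by (intro tendsto_powr_neg_real) simp
  ultimately show ?thesis by (simp add: tendsto_cong)
qed

text \<open>The two bounds on \<open>disc_integral\<close>, one for each choice of \<open>\<mu>\<close>, in a common form. The singularity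
  \<open>1 / t\<close> is the one that \<open>radial_riemann_sum\<close> tolerates.\<close>

lemma \<mu>_disc_integral_le:
  assumes "1 \<le> N" "0 < t"
  shows "\<mu> N * disc_integral (gap_scale N * t) \<le> C\<^sub>2 * (1 + 1 / t)"
  using \<mu>_cases
proof
  assume "\<forall>N. \<mu> N = 1"
  then have "\<mu> N * disc_integral (gap_scale N * t) \<le> pi * B" using disc_integral_le by simp
  also have "\<dots> \<le> C\<^sub>2 * (1 + 1 / t)"
    using B_nonneg M_pos assms mult_mono[of "pi * B" "C\<^sub>2" 1 "1 + 1 / t"] by simp
  finally show ?thesis .
next
  assume "1 < \<alpha> + \<beta> \<and> (\<forall>N. \<mu> N = real N powr (\<alpha> + \<beta> - 1))"
  then have m: "\<mu> N = gap_scale N" by (simp add: gap_scale_def)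
  have l: "gap_scale N > 0" using assms by (simp add: gap_scale_def)
  have "\<mu> N * disc_integral (gap_scale N * t) = (gap_scale N * t * disc_integral (gap_scale N * t)) / t" using assms m by simp
  also have "\<dots> \<le> 4 * M * B / t"
    using assms l by (intro divide_right_mono mult_disc_integral_le) auto
  also have "\<dots> = 4 * M * B * (1 / t)" by simp
  also have "\<dots> \<le> C\<^sub>2 * (1 + 1 / t)"
    using B_nonneg M_pos assms by (intro mult_mono) auto
  finally show ?thesis .
qed

text \<open>All error terms are bounded, for each difference \<open>p\<close>, by multiples of \<open>1 + X N / |p|\<close> and of 1 with
  factors that depend on \<open>N\<close> only; the sums of these weights over \<open>p\<close> are \<open>O((X N)^2)\<close>.\<close>

definition weight_sum :: "nat \<Rightarrow> real" where
  "weight_sum N = (\<Sum>p\<in>punctured_disc (X N). 1 + X N / norm (point p))"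

text \<open>
  The weights are at most \<open>2 X N / |p|\<close>, and \<open>2 \<pi> 2 / y\<close> is the limit of the normalized sum of these.\<close>

definition C\<^sub>1 :: real where "C\<^sub>1 = 2 * pi * 2 / y + 1"

lemma C\<^sub>1_pos: "0 < C\<^sub>1"
  using y_pos by (simp add: C\<^sub>1_def add_pos_pos)

lemma weight_sum_bound: "\<forall>\<^sub>F N in sequentially. weight_sum N \<le> C\<^sub>1 * (X N)\<^sup>2"
proof -
  have "(\<lambda>N. (\<Sum>p\<in>punctured_disc (X N). (\<lambda>r. 2 / r) (norm (point p) / X N)) / (X N)\<^sup>2) \<longlonglongrightarrow> (2 * pi * 2) / y"
  proof (rule radial_riemann_sum[OF X_at_top, where \<phi>' = "\<lambda>r. 2 / r" and D = 2])
    show "\<forall>\<^sub>F N in sequentially. \<forall>r::real. 0 < r \<and> r \<le> 1 \<longrightarrow> 0 \<le> 2 / r \<and> 2 / r \<le> 2 / r" by simp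
    show "(\<lambda>N. 2 / s N) \<longlonglongrightarrow> 2 / r" if "0 < r" "s \<longlonglongrightarrow> r" for r :: real and s
      using that by (intro tendsto_intros) auto
    show "(\<integral>\<^sup>+v. ennreal (2 / norm v) * indicator unit_disc v \<partial>lborel) = ennreal (2 * pi * 2)"
      by (rule nn_integral_radial_const_over) simp
  qed simp_all
  then have "\<forall>\<^sub>F N in sequentially. (\<Sum>p\<in>punctured_disc (X N). 2 / (norm (point p) / X N)) / (X N)\<^sup>2 < C\<^sub>1"
    by (rule order_tendstoD) (simp add: C\<^sub>1_def)
  then show ?thesis using eventually_X_ge_1
  proof eventually_elim
    case (elim N)
    have "weight_sum N \<le> (\<Sum>p\<in>punctured_disc (X N). 2 / (norm (point p) / X N))"
      unfolding weight_sum_def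
    proof (rule sum_mono)
      fix p assume "p \<in> punctured_disc (X N)"
      then have "0 < norm (point p)" "norm (point p) \<le> X N" by (simp_all add: punctured_disc_def)
      then show "1 + X N / norm (point p) \<le> 2 / (norm (point p) / X N)" by (simp add: field_simps)
    qed
    also have "\<dots> < C\<^sub>1 * (X N)\<^sup>2" using elim by (simp add: divide_less_eq)
    finally show ?case by simp
  qed
qed

lemma card_le_weight_sum: "0 \<le> X N \<Longrightarrow> real (card (punctured_disc (X N))) \<le> weight_sum N"
proof -
  assume "0 \<le> X N"
  then have "(\<Sum>p\<in>punctured_disc (X N). 1) \<le> weight_sum N" unfolding weight_sum_def by (intro sum_mono) simp
  then show ?thesis by simp
qed

text \<open>A common upper bound for the constants from counting in a disc and in a strip.\<close>

definition C\<^sub>0 :: real where "C\<^sub>0 = 24 * (1 + 1 / y) * (M + 2)"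

lemma C\<^sub>0_pos: "C\<^sub>0 > 0"
  using y_pos M_pos by (simp add: C\<^sub>0_def add_pos_pos)

text \<open>A bounded gap forces \<open>|z + h|^2 / |z|^2\<close> to within \<open>O(N^(- \<beta>))\<close> of 1, that is, \<open>z\<close> lies in a strip
  perpendicular to \<open>h\<close> and centred on the line of points equidistant from 0 and \<open>- h\<close>.\<close>

lemma log_gap_strip:
  assumes "q \<noteq> 0" "q + p \<noteq> 0" and N: "M + 1 \<le> real N powr \<beta>" and g: "\<bar>log_gap N p q\<bar> \<le> M + 1"
  shows "\<bar>2 * (point q \<bullet> point p) + (norm (point p))\<^sup>2\<bar> \<le> 2 * (M + 1) * (norm (point q))\<^sup>2 / real N powr \<beta>"
proof -
  let ?z = "point q" and ?h = "point p" and ?T = "real N powr \<beta>"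
  have z: "norm ?z > 0" using assms by simp
  have zh: "norm (?z + ?h) > 0" using assms by (simp flip: point_add)
  have T: "?T > 0" using N M_pos by linarith
  define l where "l = ln ((norm (?z + ?h))\<^sup>2 / (norm ?z)\<^sup>2)"
  have l: "\<bar>l\<bar> \<le> (M + 1) / ?T" using g T by (simp add: log_gap_def l_def abs_mult field_simps)
  also have "\<dots> \<le> 1" using N T by simp
  finally have l1: "\<bar>l\<bar> \<le> 1" .
  have el: "exp l = (norm (?z + ?h))\<^sup>2 / (norm ?z)\<^sup>2" using z zh by (simp add: l_def)
  have "\<bar>exp l - 1\<bar> \<le> 2 * \<bar>l\<bar>"
  proof -
    have "exp l \<le> 1 + l + l\<^sup>2" if "0 \<le> l" using exp_bound[of l] that l1 by simp
    moreover have "l\<^sup>2 \<le> l" if "0 \<le> l" using that l1 by (simp add: power2_eq_square mult_left_le)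
    moreover have "1 + l \<le> exp l" by (rule exp_ge_add_one_self)
    moreover have "exp l \<le> 1" if "l \<le> 0" using that by simp
    ultimately show ?thesis by (smt (verit))
  qed
  then have "\<bar>exp l - 1\<bar> \<le> 2 * ((M + 1) / ?T)" using l by linarith
  then have "(norm ?z)\<^sup>2 * \<bar>exp l - 1\<bar> \<le> (norm ?z)\<^sup>2 * (2 * ((M + 1) / ?T))" by (rule mult_left_mono) simp
  moreover have "(norm ?z)\<^sup>2 * (exp l - 1) = 2 * (?z \<bullet> ?h) + (norm ?h)\<^sup>2"
    using z unfolding el by (simp add: field_simps power2_norm_eq_inner inner_add inner_commute)
  then have "\<bar>2 * (?z \<bullet> ?h) + (norm ?h)\<^sup>2\<bar> = (norm ?z)\<^sup>2 * \<bar>exp l - 1\<bar>" by (simp add: abs_mult flip: \<open>_ = 2 * (?z \<bullet> ?h) + _\<close>)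
  ultimately show ?thesis by (simp add: mult_ac)
qed

lemma eventually_powr_ge: "0 < a \<Longrightarrow> \<forall>\<^sub>F N in sequentially. c \<le> real N powr a"
  using filterlim_nat_powr_at_top by (simp add: filterlim_at_top)

text \<open>For \<open>\<mu> = 1\<close> all lattice points of the disc are counted. In the other regime the strip of half-width
  about \<open>\<kappa>^2 N^(2 - \<beta>) / |h|\<close> is counted; its area inside the disc is
  \<open>O(\<kappa>^3 N^(3 - \<beta>) / |h|)\<close>, and \<open>N^(1 - \<beta>) = X N / gap_scale N\<close>. The power of \<open>\<kappa>\<close> makes the points
  close to the origin negligible.\<close>

lemma card_near_starts_le:
  assumes \<kappa>: "0 < \<kappa>" "\<kappa> \<le> 1"
  shows "\<forall>\<^sub>F N in sequentially. \<forall>p. p \<noteq> 0 \<longrightarrow>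
    real (card (near_starts N \<kappa> p)) \<le> C\<^sub>0 * (\<kappa>\<^sup>2 * (real N)\<^sup>2 / \<mu> N * (1 + X N / norm (point p)) + real N)"
proof -
  have "\<forall>\<^sub>F N in sequentially. 1 / \<kappa> \<le> real N" using eventually_nat_real[OF eventually_ge_at_top] by simp
  with eventually_powr_ge[OF \<beta>_pos, of "M + 1"] eventually_ge_at_top[of 1] show ?thesis
  proof eventually_elim
    case (elim N)
    then have N: "1 \<le> \<kappa> * real N" "1 \<le> N" and NM: "M + 1 \<le> real N powr \<beta>" using \<kappa> by (simp_all add: field_simps)
    show ?case
    proof safe
      fix p :: "int \<times> int" assume p: "p \<noteq> 0"
      then have h: "norm (point p) > 0" by simp
      have X0: "0 < X N" using N by (simp add: X_def)
      show "real (card (near_starts N \<kappa> p)) \<le> C\<^sub>0 * (\<kappa>\<^sup>2 * (real N)\<^sup>2 / \<mu> N * (1 + X N / norm (point p)) + real N)"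
        using \<mu>_cases
      proof
        assume m: "\<forall>N. \<mu> N = 1"
        have "card (near_starts N \<kappa> p) \<le> card {q. norm (point q) \<le> \<kappa> * real N}"
          by (rule card_mono[OF finite_disc]) (auto simp: near_starts_def)
        then have "real (card (near_starts N \<kappa> p)) \<le> 24 * (1 + 1 / y) * (\<kappa> * real N)\<^sup>2"
          using card_disc_le[OF N(1)] by linarith
        also have "\<dots> \<le> C\<^sub>0 * (\<kappa> * real N)\<^sup>2"
          unfolding C\<^sub>0_def using y_pos M_pos by (intro mult_right_mono) (auto simp: field_simps)
        also have "\<dots> \<le> C\<^sub>0 * (\<kappa>\<^sup>2 * (real N)\<^sup>2 / \<mu> N * (1 + X N / norm (point p)) + real N)"
        proof (rule mult_left_mono)
          have "(\<kappa> * real N)\<^sup>2 * 1 \<le> (\<kappa> * real N)\<^sup>2 * (1 + X N / norm (point p))"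
            using X0 h by (intro mult_left_mono) auto
          then show "(\<kappa> * real N)\<^sup>2 \<le> \<kappa>\<^sup>2 * (real N)\<^sup>2 / \<mu> N * (1 + X N / norm (point p)) + real N"
            using m by (simp add: power_mult_distrib)
        qed (use C\<^sub>0_pos in simp)
        finally show ?thesis .
      next
        assume m: "1 < \<alpha> + \<beta> \<and> (\<forall>N. \<mu> N = real N powr (\<alpha> + \<beta> - 1))"
        \<comment> \<open>The strip is centred at \<open>z \<bullet> h = - |h|^2 / 2\<close>.\<close>
        let ?W = "(M + 1) * (\<kappa> * real N)\<^sup>2 / real N powr \<beta>"
        have W: "0 \<le> ?W" using M_pos by simp
        have "near_starts N \<kappa> p \<subseteq> {q. norm (point q) \<le> \<kappa> * real N \<and> \<bar>point q \<bullet> point p - (- (norm (point p))\<^sup>2 / 2)\<bar> \<le> ?W}"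
        proof safe
          fix q assume q: "q \<in> near_starts N \<kappa> p"
          then show le: "norm (point q) \<le> \<kappa> * real N" by (simp add: near_starts_def)
          have "\<bar>2 * (point q \<bullet> point p) + (norm (point p))\<^sup>2\<bar> \<le> 2 * (M + 1) * (norm (point q))\<^sup>2 / real N powr \<beta>"
            using q NM by (intro log_gap_strip) (auto simp: near_starts_def)
          also have "\<dots> \<le> 2 * (M + 1) * (\<kappa> * real N)\<^sup>2 / real N powr \<beta>"
            using M_pos le by (intro divide_right_mono mult_left_mono power_mono) auto
          also have "\<dots> = 2 * ?W" by (simp only: times_divide_eq_right mult.assoc)
          also have "2 * (point q \<bullet> point p) + (norm (point p))\<^sup>2 = 2 * (point q \<bullet> point p - (- (norm (point p))\<^sup>2 / 2))" by simp
          finally have "\<bar>2 * (point q \<bullet> point p - (- (norm (point p))\<^sup>2 / 2))\<bar> \<le> 2 * ?W" .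
          then have "2 * \<bar>point q \<bullet> point p - (- (norm (point p))\<^sup>2 / 2)\<bar> \<le> 2 * ?W"
            unfolding abs_mult abs_numeral .
          then show "\<bar>point q \<bullet> point p - (- (norm (point p))\<^sup>2 / 2)\<bar> \<le> ?W" by simp
        qed
        then have "card (near_starts N \<kappa> p) \<le> card {q. norm (point q) \<le> \<kappa> * real N \<and> \<bar>point q \<bullet> point p - (- (norm (point p))\<^sup>2 / 2)\<bar> \<le> ?W}"
          by (rule card_mono[rotated]) (rule finite_subset[OF _ finite_disc[of "\<kappa> * real N"]], blast)
        then have "real (card (near_starts N \<kappa> p)) \<le> 12 * (1 + 1 / y) * (\<kappa> * real N) * (?W / norm (point p) + 1)"
          using card_strip_le[OF _ N(1) W, of "point p" "- (norm (point p))\<^sup>2 / 2"] p by fastforce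
        also have "\<dots> \<le> C\<^sub>0 * (\<kappa>\<^sup>2 * (real N)\<^sup>2 / \<mu> N * (1 + X N / norm (point p)) + real N)"
        proof -
          have pw: "real N / real N powr \<beta> = X N / \<mu> N"
          proof -
            have "real N / real N powr \<beta> = real N powr 1 / real N powr \<beta>" using N by simp
            also have "\<dots> = real N powr \<alpha> / real N powr (\<alpha> + \<beta> - 1)" unfolding powr_diff[symmetric] by simp
            finally show ?thesis using m by (simp add: X_def)
          qed
          have "\<kappa> * real N * (?W / norm (point p)) = (M + 1) * \<kappa> * (\<kappa>\<^sup>2 * (real N)\<^sup>2) * (real N / real N powr \<beta>) / norm (point p)"
            by (simp add: power_mult_distrib)
          also have "\<dots> = ((M + 1) * \<kappa>) * (\<kappa>\<^sup>2 * (real N)\<^sup>2 / \<mu> N * (X N / norm (point p)))" unfolding pw by simp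
          also have "\<dots> \<le> (2 * (M + 2)) * (\<kappa>\<^sup>2 * (real N)\<^sup>2 / \<mu> N * (1 + X N / norm (point p)))"
          proof (rule mult_mono)
            show "\<kappa>\<^sup>2 * (real N)\<^sup>2 / \<mu> N * (X N / norm (point p)) \<le> \<kappa>\<^sup>2 * (real N)\<^sup>2 / \<mu> N * (1 + X N / norm (point p))"
              using \<mu>_ge_1[OF N(2)] by (intro mult_left_mono) auto
            have "(M + 1) * \<kappa> \<le> (M + 1) * 1" using M_pos \<kappa> by (intro mult_left_mono) auto
            also have "\<dots> \<le> 2 * (M + 2)" using M_pos by simp
            finally show "(M + 1) * \<kappa> \<le> 2 * (M + 2)" .
          qed (use M_pos \<mu>_ge_1[OF N(2)] X0 h in auto)
          finally have 1: "\<kappa> * real N * (?W / norm (point p)) \<le> (2 * (M + 2)) * (\<kappa>\<^sup>2 * (real N)\<^sup>2 / \<mu> N * (1 + X N / norm (point p)))" .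
          have "\<kappa> * real N \<le> 1 * real N" using \<kappa> by (intro mult_right_mono) auto
          also have "\<dots> \<le> (2 * (M + 2)) * real N" using M_pos by (intro mult_right_mono) auto
          finally have "\<kappa> * real N * (?W / norm (point p) + 1) \<le> (2 * (M + 2)) * (\<kappa>\<^sup>2 * (real N)\<^sup>2 / \<mu> N * (1 + X N / norm (point p)) + real N)"
            using 1 unfolding distrib_left by linarith
          then have "12 * (1 + 1 / y) * (\<kappa> * real N * (?W / norm (point p) + 1)) \<le> 12 * (1 + 1 / y) * ((2 * (M + 2)) * (\<kappa>\<^sup>2 * (real N)\<^sup>2 / \<mu> N * (1 + X N / norm (point p)) + real N))"
            using y_pos by (intro mult_left_mono) auto
          moreover have "12 * (1 + 1 / y) * ((2 * (M + 2)) * t) = C\<^sub>0 * t" for t by (simp add: C\<^sub>0_def algebra_simps add_divide_distrib)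
          ultimately show ?thesis by (simp only: mult.assoc)
        qed
        finally show ?thesis .
      qed
    qed
  qed
qed

abbreviation near_bound :: "nat \<Rightarrow> real \<Rightarrow> real" where
  "near_bound N \<kappa> \<equiv> C\<^sub>1 * (C\<^sub>0 * \<kappa>\<^sup>2 + C\<^sub>0 * (\<mu> N / real N))"

abbreviation equal_bound :: "nat \<Rightarrow> real" where
  "equal_bound N \<equiv> C\<^sub>1 * (12 * (1 + 1 / y) * (\<mu> N / real N))"

abbreviation small_bound :: "real \<Rightarrow> real" where
  "small_bound \<epsilon> \<equiv> C\<^sub>1 * (4 * C\<^sub>2 * \<epsilon>\<^sup>2)"

lemma sum_bound_over_\<psi>:
  assumes N: "1 \<le> N" and w: "weight_sum N \<le> C\<^sub>1 * (X N)\<^sup>2" and K: "0 \<le> a" "0 \<le> b"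
    and c: "\<And>p. p \<in> punctured_disc (X N) \<Longrightarrow> c p \<le> a * ((real N)\<^sup>2 / \<mu> N) * (1 + X N / norm (point p)) + b * real N"
  shows "(\<Sum>p\<in>punctured_disc (X N). c p) / \<psi> N \<le> C\<^sub>1 * (a + b * (\<mu> N / real N))"
proof -
  have X0: "0 < X N" using N by (simp add: X_def)
  have m: "0 < \<mu> N" using \<mu>_ge_1[OF N] by simp
  have "(\<Sum>p\<in>punctured_disc (X N). c p) \<le> (\<Sum>p\<in>punctured_disc (X N). a * ((real N)\<^sup>2 / \<mu> N) * (1 + X N / norm (point p)) + b * real N)"
    by (rule sum_mono[OF c])
  also have "\<dots> = a * ((real N)\<^sup>2 / \<mu> N) * weight_sum N + b * real N * card (punctured_disc (X N))"
    unfolding weight_sum_def sum_distrib_left by (simp add: sum.distrib)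
  also have "\<dots> \<le> a * ((real N)\<^sup>2 / \<mu> N) * (C\<^sub>1 * (X N)\<^sup>2) + b * real N * (C\<^sub>1 * (X N)\<^sup>2)"
    using w card_le_weight_sum[of N] X0 m K by (intro add_mono mult_left_mono) auto
  also have "\<dots> = C\<^sub>1 * (a + b * (\<mu> N / real N)) * \<psi> N"
    using N m by (simp add: \<psi>_def field_simps power2_eq_square)
  finally show ?thesis using \<psi>_pos[OF N] by (simp add: divide_le_eq)
qed

lemma near_starts_sum_le:
  assumes \<kappa>: "0 < \<kappa>" "\<kappa> \<le> 1"
  shows "\<forall>\<^sub>F N in sequentially. near_total N \<kappa> / \<psi> N
    \<le> near_bound N \<kappa>"
  using card_near_starts_le[OF \<kappa>] weight_sum_bound eventually_ge_at_top[of 1]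
proof eventually_elim
  case (elim N)
  show ?case
  proof (rule sum_bound_over_\<psi>)
    fix p assume "p \<in> punctured_disc (X N)"
    then have "p \<noteq> 0" by (simp add: punctured_disc_def)
    with elim(1) have "real (card (near_starts N \<kappa> p)) \<le> C\<^sub>0 * (\<kappa>\<^sup>2 * (real N)\<^sup>2 / \<mu> N * (1 + X N / norm (point p)) + real N)"
      by blast
    then show "real (card (near_starts N \<kappa> p)) \<le> C\<^sub>0 * \<kappa>\<^sup>2 * ((real N)\<^sup>2 / \<mu> N) * (1 + X N / norm (point p)) + C\<^sub>0 * real N"
      by (simp add: distrib_left mult.assoc)
  qed (use elim C\<^sub>0_pos in simp_all)
qed

lemma equal_starts_sum_le:
  "\<forall>\<^sub>F N in sequentially. equal_total N / \<psi> N \<le> equal_bound N"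
  using weight_sum_bound eventually_ge_at_top[of 1]
proof eventually_elim
  case (elim N)
  have "equal_total N / \<psi> N \<le> C\<^sub>1 * (0 + 12 * (1 + 1 / y) * (\<mu> N / real N))"
  proof (rule sum_bound_over_\<psi>)
    fix p assume "p \<in> punctured_disc (X N)"
    then have p: "point p \<noteq> 0" by (simp add: punctured_disc_def)
    have "equal_starts N p \<subseteq> {q. norm (point q) \<le> real N \<and> \<bar>point q \<bullet> point p - (- (norm (point p))\<^sup>2 / 2)\<bar> \<le> 0}"
    proof safe
      fix q assume q: "q \<in> equal_starts N p"
      then show "norm (point q) \<le> real N" by (simp add: equal_starts_def)
      have "(norm (point q + point p))\<^sup>2 = (norm (point q))\<^sup>2" using q by (simp add: equal_starts_def)
      then have "2 * (point q \<bullet> point p) + (norm (point p))\<^sup>2 = 0"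
        by (simp add: power2_norm_eq_inner inner_add inner_commute)
      then show "\<bar>point q \<bullet> point p - (- (norm (point p))\<^sup>2 / 2)\<bar> \<le> 0" by simp
    qed
    then have "card (equal_starts N p) \<le> card {q. norm (point q) \<le> real N \<and> \<bar>point q \<bullet> point p - (- (norm (point p))\<^sup>2 / 2)\<bar> \<le> 0}"
      by (rule card_mono[rotated]) (rule finite_subset[OF _ finite_disc[of "real N"]], blast)
    then have "real (card (equal_starts N p)) \<le> 12 * (1 + 1 / y) * real N * (0 / norm (point p) + 1)"
      using card_strip_le[OF p, of "real N" 0 "- (norm (point p))\<^sup>2 / 2"] elim by linarith
    then show "real (card (equal_starts N p)) \<le> 0 * ((real N)\<^sup>2 / \<mu> N) * (1 + X N / norm (point p)) + 12 * (1 + 1 / y) * real N"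
      by simp
  qed (use elim y_pos in simp_all)
  then show ?case by simp
qed

lemma disc_sum_small_le:
  assumes \<epsilon>: "0 < \<epsilon>" "\<epsilon> \<le> 1 / 2"
  shows "\<forall>\<^sub>F N in sequentially. disc_sum N (2 * \<epsilon> * real N) / \<psi> N \<le> small_bound \<epsilon>"
  using weight_sum_bound eventually_ge_at_top[of 1]
proof eventually_elim
  case (elim N)
  have "disc_sum N (2 * \<epsilon> * real N) / \<psi> N \<le> C\<^sub>1 * (4 * C\<^sub>2 * \<epsilon>\<^sup>2 + 0 * (\<mu> N / real N))"
    unfolding disc_sum_def
  proof (rule sum_bound_over_\<psi>)
    fix p assume "p \<in> punctured_disc (X N)"
    then have h: "norm (point p) > 0" by (simp add: punctured_disc_def)
    have X0: "0 < X N" and N0: "0 < real N" using elim by (simp_all add: X_def)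
    have m: "0 < \<mu> N" using \<mu>_ge_1[of N] elim by simp
    \<comment> \<open>On the disc of radius \<open>2 \<epsilon> N\<close> the gap scale is \<open>1 / (2 \<epsilon>)\<close> times larger.\<close>
    define t where "t = norm (point p) / (X N * (2 * \<epsilon>))"
    have t: "0 < t" using h X0 \<epsilon> by (simp add: t_def)
    have arg: "real N powr \<beta> * norm (point p) / (2 * \<epsilon> * real N) = gap_scale N * t"
      unfolding powr_\<beta>_eq[OF elim(2)] using N0 \<epsilon> by (simp add: t_def)
    have "\<mu> N * disc_integral (gap_scale N * t) \<le> C\<^sub>2 * (1 + 1 / t)"
      by (rule \<mu>_disc_integral_le) (use elim t in auto)
    also have "1 / t = 2 * \<epsilon> * (X N / norm (point p))" using h X0 \<epsilon> by (simp add: t_def)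
    also have "C\<^sub>2 * (1 + 2 * \<epsilon> * (X N / norm (point p))) \<le> C\<^sub>2 * (1 + 1 * (X N / norm (point p)))"
      using \<epsilon> h X0 B_nonneg M_pos by (intro mult_left_mono add_mono mult_right_mono) auto
    finally have "disc_integral (gap_scale N * t) \<le> C\<^sub>2 * (1 + X N / norm (point p)) / \<mu> N"
      using m by (simp add: pos_le_divide_eq mult.commute)
    then have "(2 * \<epsilon> * real N)\<^sup>2 * disc_integral (gap_scale N * t) \<le> (2 * \<epsilon> * real N)\<^sup>2 * (C\<^sub>2 * (1 + X N / norm (point p)) / \<mu> N)"
      by (rule mult_left_mono) simp
    also have "\<dots> = 4 * C\<^sub>2 * \<epsilon>\<^sup>2 * ((real N)\<^sup>2 / \<mu> N) * (1 + X N / norm (point p)) + 0 * real N"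
      by (simp add: power_mult_distrib)
    finally show "main_term N p (2 * \<epsilon> * real N)
      \<le> 4 * C\<^sub>2 * \<epsilon>\<^sup>2 * ((real N)\<^sup>2 / \<mu> N) * (1 + X N / norm (point p)) + 0 * real N"
      unfolding arg .
  qed (use elim B_nonneg M_pos in simp_all)
  then show ?case by simp
qed

text \<open>After division by \<open>\<psi> N\<close> the sum is a radial Riemann sum in \<open>r = |p| / X N\<close>, because
  \<open>N^\<beta> |p| = gap_scale N * N * r\<close>. Any radius asymptotic to \<open>N\<close> gives the same limit.\<close>

lemma disc_sum_tendsto:
  assumes conv: "\<And>r s. 0 < r \<Longrightarrow> s \<longlonglongrightarrow> r \<Longrightarrow> (\<lambda>N. \<mu> N * disc_integral (gap_scale N * s N)) \<longlonglongrightarrow> \<phi> r"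
    and m: "\<phi> \<in> borel_measurable borel"
    and L: "(\<integral>\<^sup>+v. ennreal (\<phi> (norm v)) * indicator unit_disc v \<partial>lborel) = ennreal L" "0 \<le> L"
    and R: "(\<lambda>N. R N / real N) \<longlonglongrightarrow> 1"
  shows "(\<lambda>N. disc_sum N (R N) / \<psi> N) \<longlonglongrightarrow> L / y"
proof -
  define \<rho> where "\<rho> N = R N / real N" for N
  have \<rho>: "\<rho> \<longlonglongrightarrow> 1" using R by (simp add: \<rho>_def[abs_def])
  define \<Phi> where "\<Phi> N r = (\<rho> N)\<^sup>2 * (\<mu> N * disc_integral (gap_scale N * (r / \<rho> N)))" for N r
  have K: "0 \<le> C\<^sub>2" using B_nonneg M_pos by simp
  have "(\<lambda>N. (\<Sum>p\<in>punctured_disc (X N). \<Phi> N (norm (point p) / X N)) / (X N)\<^sup>2) \<longlonglongrightarrow> L / y"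
  proof (rule radial_riemann_sum[OF X_at_top _ _ m L, where D = "12 * C\<^sub>2"])
    have "\<forall>\<^sub>F N in sequentially. \<rho> N > 0" "\<forall>\<^sub>F N in sequentially. \<rho> N < 2"
      using order_tendstoD[OF \<rho>] by auto
    then show "\<forall>\<^sub>F N in sequentially. \<forall>r. 0 < r \<and> r \<le> 1 \<longrightarrow> 0 \<le> \<Phi> N r \<and> \<Phi> N r \<le> 12 * C\<^sub>2 / r"
      using eventually_ge_at_top[of 1]
    proof eventually_elim
      case (elim N)
      have mu: "0 \<le> \<mu> N" using \<mu>_ge_1[of N] elim by simp
      show ?case
      proof (intro allI impI conjI)
        fix r :: real assume r: "0 < r \<and> r \<le> 1"
        show "0 \<le> \<Phi> N r" using mu disc_integral_nonneg by (simp add: \<Phi>_def)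
        have "\<mu> N * disc_integral (gap_scale N * (r / \<rho> N)) \<le> C\<^sub>2 * (1 + 1 / (r / \<rho> N))"
          by (rule \<mu>_disc_integral_le) (use elim r in auto)
        also have "\<dots> \<le> C\<^sub>2 * (3 / r)"
        proof (rule mult_left_mono[OF _ K])
          have "1 + 1 / (r / \<rho> N) = (r + \<rho> N) / r" using r elim by (simp add: field_simps)
          also have "\<dots> \<le> 3 / r" using r elim by (intro divide_right_mono) auto
          finally show "1 + 1 / (r / \<rho> N) \<le> 3 / r" .
        qed
        finally have le: "\<mu> N * disc_integral (gap_scale N * (r / \<rho> N)) \<le> C\<^sub>2 * (3 / r)" .
        have "(\<rho> N)\<^sup>2 \<le> 2\<^sup>2" using elim by (intro power_mono) auto
        then have "\<Phi> N r \<le> 2\<^sup>2 * (C\<^sub>2 * (3 / r))"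
          unfolding \<Phi>_def by (rule mult_mono[OF _ le]) (use mu disc_integral_nonneg in simp_all)
        then show "\<Phi> N r \<le> 12 * C\<^sub>2 / r" by simp
      qed
    qed
    show "(\<lambda>N. \<Phi> N (s N)) \<longlonglongrightarrow> \<phi> r" if "0 < r" "s \<longlonglongrightarrow> r" for r s
    proof -
      have "(\<lambda>N. s N / \<rho> N) \<longlonglongrightarrow> r / 1" using that \<rho> by (intro tendsto_divide) auto
      then have "(\<lambda>N. s N / \<rho> N) \<longlonglongrightarrow> r" by simp
      then have "(\<lambda>N. \<mu> N * disc_integral (gap_scale N * (s N / \<rho> N))) \<longlonglongrightarrow> \<phi> r" by (rule conv[OF that(1)])
      then have "(\<lambda>N. \<Phi> N (s N)) \<longlonglongrightarrow> 1\<^sup>2 * \<phi> r" unfolding \<Phi>_def by (intro tendsto_mult tendsto_power \<rho>)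
      then show ?thesis by simp
    qed
  qed (use K in simp)
  moreover have "\<forall>\<^sub>F N in sequentially. (\<Sum>p\<in>punctured_disc (X N). \<Phi> N (norm (point p) / X N)) / (X N)\<^sup>2 = disc_sum N (R N) / \<psi> N"
    using eventually_ge_at_top[of 1]
  proof eventually_elim
    case (elim N)
    have X0: "0 < X N" and N0: "0 < real N" using elim by (simp_all add: X_def)
    have mu: "0 < \<mu> N" using \<mu>_ge_1[of N] elim by simp
    have "\<Phi> N (norm (point p) / X N) / (X N)\<^sup>2 = (R N)\<^sup>2 * disc_integral (real N powr \<beta> * norm (point p) / R N) / \<psi> N" for p
    proof -
      have a: "gap_scale N * (norm (point p) / X N / \<rho> N) = real N powr \<beta> * norm (point p) / R N"
        unfolding powr_\<beta>_eq[OF elim] \<rho>_def using N0 X0 by simp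
      show ?thesis unfolding \<Phi>_def a unfolding \<rho>_def \<psi>_def using N0 mu by (simp add: power_divide)
    qed
    then show ?case unfolding disc_sum_def sum_divide_distrib by simp
  qed
  ultimately show ?thesis by (simp add: tendsto_cong)
qed

text \<open>Away from the origin the gap is approximated uniformly by its linear part, evaluated at any point
  \<open>u\<close> of the cell: the quadratic terms are \<open>O(N^(2 \<alpha> + \<beta> - 2))\<close> and so is the effect of moving \<open>u\<close>.\<close>

lemma log_gap_linear:
  assumes \<epsilon>: "0 < \<epsilon>" and \<delta>: "0 < \<delta>"
  shows "\<forall>\<^sub>F N in sequentially. \<forall>p q u. p \<in> punctured_disc (X N) \<longrightarrow> \<epsilon> * real N \<le> norm (point q) \<longrightarrow>
    norm (point q - u) \<le> 1 + y \<longrightarrow>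
    \<bar>log_gap N p q - linear_gap N p u\<bar> \<le> \<delta>"
proof -
  define K where "K = (19 + 4 * (1 + y)) / \<epsilon>\<^sup>2"
  have "(\<lambda>N. K * real N powr (2 * \<alpha> + \<beta> - 2)) \<longlonglongrightarrow> K * 0"
    using exponents by (intro tendsto_mult tendsto_const tendsto_powr_neg_real) simp
  then have e1: "\<forall>\<^sub>F N in sequentially. K * real N powr (2 * \<alpha> + \<beta> - 2) < \<delta>"
    using \<delta> by (auto dest: order_tendstoD)
  have "(\<lambda>N. real N powr (\<alpha> - 1)) \<longlonglongrightarrow> 0" using \<alpha>_less by (intro tendsto_powr_neg_real) simp
  then have e2: "\<forall>\<^sub>F N in sequentially. real N powr (\<alpha> - 1) < \<epsilon> / 8"
    by (rule order_tendstoD) (use \<epsilon> in simp)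
  have e3: "\<forall>\<^sub>F N in sequentially. 2 * (1 + y) / \<epsilon> \<le> real N" using eventually_nat_real[OF eventually_ge_at_top] by simp
  from e1 e2 e3 eventually_X_ge_1 eventually_ge_at_top[of 1] show ?thesis
  proof eventually_elim
    case (elim N)
    have N0: "0 < real N" using elim by simp
    have "real N powr (\<alpha> - 1) = X N / real N" using N0 by (simp add: X_def powr_diff)
    then have "X N / real N < \<epsilon> / 8" using elim(2) by simp
    then have "X N < \<epsilon> / 8 * real N" using N0 by (simp only: pos_divide_less_eq)
    then have X8: "8 * X N \<le> \<epsilon> * real N" by linarith
    have y2: "2 * (1 + y) \<le> \<epsilon> * real N" using elim(3) \<epsilon> by (simp add: field_simps)
    show ?case
    proof (intro allI impI)
      fix p q u assume p: "p \<in> punctured_disc (X N)" and q: "\<epsilon> * real N \<le> norm (point q)" and u: "norm (point q - u) \<le> 1 + y"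
      let ?z = "point q" and ?h = "point p"
      have h: "norm ?h \<le> X N" using p by (simp add: punctured_disc_def)
      have eN: "0 < \<epsilon> * real N" using \<epsilon> N0 by simp
      have un: "\<epsilon> * real N / 2 \<le> norm u"
      proof -
        define E where "E = \<epsilon> * real N"
        have "E \<le> norm ?z" "2 * (1 + y) \<le> E" using q y2 by (simp_all add: E_def)
        then have "E / 2 \<le> norm u" using u norm_triangle_ineq2[of ?z u] by argo
        then show ?thesis by (simp add: E_def)
      qed
      have z0: "?z \<noteq> 0" and u0: "u \<noteq> 0" using q un eN by auto
      have "norm ?h / norm ?z \<le> X N / (\<epsilon> * real N)" using h q eN elim by (intro frac_le) auto
      then have "(norm ?h / norm ?z)\<^sup>2 \<le> (X N / (\<epsilon> * real N))\<^sup>2" by (intro power_mono) auto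
      moreover have "2 * norm ?h * norm (?z - u) / (norm ?z * norm u) \<le> 2 * X N * (1 + y) / ((\<epsilon> * real N) * (\<epsilon> * real N / 2))"
        using h u q un eN elim y_pos by (intro frac_le mult_mono) auto
      moreover have "2 * X N * (1 + y) / ((\<epsilon> * real N) * (\<epsilon> * real N / 2)) \<le> 4 * (1 + y) * (X N / (\<epsilon> * real N))\<^sup>2"
      proof -
        have "X N \<le> (X N)\<^sup>2" using elim by (simp add: power2_eq_square)
        then have "4 * (1 + y) * X N / (\<epsilon> * real N)\<^sup>2 \<le> 4 * (1 + y) * (X N)\<^sup>2 / (\<epsilon> * real N)\<^sup>2"
          using y_pos by (intro divide_right_mono mult_left_mono) auto
        moreover have "2 * a * c / (e * (e / 2)) = 4 * c * a / e\<^sup>2" "4 * c * (a / e)\<^sup>2 = 4 * c * a\<^sup>2 / e\<^sup>2" for a c e :: real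
          by (simp_all add: power2_eq_square)
        ultimately show ?thesis by presburger
      qed
      ultimately have "\<bar>ln ((norm (?z + ?h))\<^sup>2 / (norm ?z)\<^sup>2) - 2 * (u \<bullet> ?h) / (norm u)\<^sup>2\<bar>
        \<le> 19 * (X N / (\<epsilon> * real N))\<^sup>2 + 4 * (1 + y) * (X N / (\<epsilon> * real N))\<^sup>2"
        using log_ratio_linearization[OF z0 u0, of ?h] h X8 q by linarith
      also have "\<dots> = K * (X N)\<^sup>2 / (real N)\<^sup>2" by (simp add: K_def power_divide power_mult_distrib flip: distrib_right add_divide_distrib)
      finally have "real N powr \<beta> * \<bar>ln ((norm (?z + ?h))\<^sup>2 / (norm ?z)\<^sup>2) - 2 * (u \<bullet> ?h) / (norm u)\<^sup>2\<bar>
         \<le> real N powr \<beta> * (K * (X N)\<^sup>2 / (real N)\<^sup>2)" by (rule mult_left_mono) simp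
      also have "\<dots> = K * real N powr (2 * \<alpha> + \<beta> - 2)"
      proof -
        have "real N powr \<alpha> * real N powr \<alpha> * real N powr \<beta> / real N powr 2 = real N powr (2 * \<alpha> + \<beta> - 2)"
          unfolding powr_add[symmetric] powr_diff[symmetric] by simp
        moreover have "real N powr 2 = (real N)\<^sup>2" using N0 by simp
        moreover have "b * (K * a\<^sup>2 / c) = K * (a * a * b / c)" for a b c :: real
          by (simp add: power2_eq_square)
        ultimately show ?thesis unfolding X_def by metis
      qed
      finally have "real N powr \<beta> * \<bar>ln ((norm (?z + ?h))\<^sup>2 / (norm ?z)\<^sup>2) - 2 * (u \<bullet> ?h) / (norm u)\<^sup>2\<bar> \<le> \<delta>" using elim(1) by linarith
      moreover have "log_gap N p q - 2 * real N powr \<beta> * (u \<bullet> ?h) / (norm u)\<^sup>2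
         = real N powr \<beta> * (ln ((norm (?z + ?h))\<^sup>2 / (norm ?z)\<^sup>2) - 2 * (u \<bullet> ?h) / (norm u)\<^sup>2)"
        by (simp add: log_gap_def right_diff_distrib)
      ultimately show "\<bar>log_gap N p q - 2 * real N powr \<beta> * (u \<bullet> ?h) / (norm u)\<^sup>2\<bar> \<le> \<delta>"
        by (simp add: abs_mult)
    qed
  qed
qed

lemma modulus_of_continuity:
  assumes "0 < \<eta>"
  obtains \<delta> where "0 < \<delta>" "\<delta> \<le> 1" "\<And>a b. \<bar>a - b\<bar> \<le> \<delta> \<Longrightarrow> \<bar>f a - f b\<bar> \<le> \<eta>"
proof -
  have "uniformly_continuous_on {- (M + 1)..M + 1} f"
    by (rule compact_uniformly_continuous) (auto intro: continuous_on_subset[OF continuous])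
  then obtain d where d: "d > 0" "\<And>a b. a \<in> {- (M + 1)..M + 1} \<Longrightarrow> b \<in> {- (M + 1)..M + 1} \<Longrightarrow> dist b a < d \<Longrightarrow> dist (f b) (f a) < \<eta>"
    unfolding uniformly_continuous_on_def using assms by metis
  show ?thesis
  proof (rule that[of "min 1 (d / 2)"])
    fix a b assume ab: "\<bar>a - b\<bar> \<le> min 1 (d / 2)"
    show "\<bar>f a - f b\<bar> \<le> \<eta>"
    proof (cases "\<bar>a\<bar> \<le> M + 1 \<and> \<bar>b\<bar> \<le> M + 1")
      case True
      then show ?thesis using d(2)[of b a] ab d(1) by (auto simp: dist_real_def abs_le_iff)
    next
      case False
      then have "M < \<bar>a\<bar>" "M < \<bar>b\<bar>" using ab by linarith+
      then show ?thesis using support assms by simp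
    qed
  qed (use d in auto)
qed

lemma nn_cell_sum:
  assumes "finite S" and "\<And>q. 0 \<le> c q"
  shows "(\<integral>\<^sup>+v. ennreal (if cell_index v \<in> S then c (cell_index v) else 0) \<partial>lborel) = ennreal (y * (\<Sum>q\<in>S. c q))"
proof -
  have "(\<integral>\<^sup>+v. ennreal (if cell_index v \<in> S then c (cell_index v) else 0) \<partial>lborel)
     = ennreal y * (\<Sum>q\<in>S. ennreal (if q \<in> S then c q else 0))"
    by (rule nn_integral_cell_index[OF assms(1), of "\<lambda>q. ennreal (if q \<in> S then c q else 0)"]) simp
  also have "(\<Sum>q\<in>S. ennreal (if q \<in> S then c q else 0)) = ennreal (\<Sum>q\<in>S. c q)"
    using assms by simp
  finally show ?thesis using y_pos assms by (simp add: ennreal_mult' sum_nonneg)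
qed

lemma measurable_cell_fun: "(\<lambda>v. ennreal (g (cell_index v))) \<in> borel_measurable lborel"
  using measurable_compose[OF measurable_cell_index, of "\<lambda>q. ennreal (g q)" borel] by simp

definition kernel :: "nat \<Rightarrow> int \<times> int \<Rightarrow> real \<times> real \<Rightarrow> real" where
  "kernel N p v = f (linear_gap N p v)"

lemma measurable_kernel: "(\<lambda>v. ennreal (kernel N p v) * indicator (cball 0 R) v) \<in> borel_measurable lborel"
  unfolding kernel_def
  by (intro borel_measurable_times_ennreal measurable_compose[OF _ measurable_ennreal]
      borel_measurable_indicator measurable_compose[OF _ measurable_f] borel_measurable_divide
      borel_measurable_times borel_measurable_power borel_measurable_norm borel_measurable_inner) simp_all

lemma nn_kernel:
  assumes "0 < R"
  shows "(\<integral>\<^sup>+v. ennreal (kernel N p v) * indicator (cball 0 R) v \<partial>lborel)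
    = ennreal (main_term N p R)"
  unfolding kernel_def nn_integral_disc_inner[OF assms] by simp

text \<open>Pointwise on the cells: the value of \<open>f\<close> at the gap of the lattice point is at most its value at the
  linearized gap of \<open>v\<close>, plus \<open>\<eta>\<close> on the points with bounded gap, plus \<open>B\<close> on those close to the
  origin, where the linearization fails. The cells of points in the disc of radius \<open>N\<close> lie in the disc
  of radius \<open>N + 1 + y\<close>.\<close>

lemma starts_sum_le:
  assumes lin: "\<And>q u. \<epsilon> * real N \<le> norm (point q) \<Longrightarrow> norm (point q - u) \<le> 1 + y \<Longrightarrow>
      \<bar>log_gap N p q - linear_gap N p u\<bar> \<le> \<delta>"
    and \<delta>: "\<And>a b. \<bar>a - b\<bar> \<le> \<delta> \<Longrightarrow> \<bar>f a - f b\<bar> \<le> \<eta>" and \<eta>: "0 \<le> \<eta>"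
  shows "y * (\<Sum>q\<in>starts N p. f (log_gap N p q)) \<le>
    main_term N p (real N + (1 + y))
    + y * (\<eta> * real (card (near_starts N 1 p)) + B * real (card (near_starts N \<epsilon> p)))"
proof -
  let ?R = "real N + (1 + y)"
  have R: "0 < ?R" using y_pos by simp
  let ?c1 = "\<lambda>q. if q \<in> near_starts N 1 p then \<eta> else 0" and ?c2 = "\<lambda>q. if q \<in> near_starts N \<epsilon> p then B else 0"
  have "ennreal (if cell_index v \<in> starts N p then f (log_gap N p (cell_index v)) else 0)
     \<le> ennreal (kernel N p v) * indicator (cball 0 ?R) v + (ennreal (?c1 (cell_index v)) + ennreal (?c2 (cell_index v)))" for v
  proof (cases "cell_index v \<in> starts N p \<and> f (log_gap N p (cell_index v)) \<noteq> 0")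
    case True
    let ?q = "cell_index v"
    have s: "?q \<noteq> 0" "?q + p \<noteq> 0" "norm (point ?q) \<le> real N" using True by (auto simp: starts_def)
    have M: "\<bar>log_gap N p ?q\<bar> \<le> M + 1" using True support[of "log_gap N p ?q"] by (cases "M < \<bar>log_gap N p ?q\<bar>") auto
    have n1: "?q \<in> near_starts N 1 p" using s M by (simp add: near_starts_def)
    show ?thesis
    proof (cases "norm (point ?q) < \<epsilon> * real N")
      case small: True
      then have "?q \<in> near_starts N \<epsilon> p" using s M by (simp add: near_starts_def)
      then have "ennreal (f (log_gap N p ?q)) \<le> ennreal (?c2 ?q)" using bounded by (simp add: ennreal_leI)
      then show ?thesis using True by (simp add: add_increasing)
    next
      case False
      have d: "norm (point ?q - v) \<le> 1 + y" by (rule norm_cell_index)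
      have "norm v \<le> ?R" using d s(3) norm_triangle_ineq3[of "point ?q" v] by linarith
      moreover have "f (log_gap N p ?q) \<le> kernel N p v + \<eta>"
        using \<delta>[OF lin[OF _ d]] False unfolding kernel_def by (simp add: abs_le_iff)
      then have "ennreal (f (log_gap N p ?q)) \<le> ennreal (kernel N p v) + ennreal \<eta>"
        by (simp add: kernel_def nonneg \<eta> ennreal_leI flip: ennreal_plus)
      ultimately show ?thesis using True n1 by (simp add: add_increasing2 flip: add.assoc)
    qed
  qed auto
  then have "(\<integral>\<^sup>+v. ennreal (if cell_index v \<in> starts N p then f (log_gap N p (cell_index v)) else 0) \<partial>lborel)
    \<le> (\<integral>\<^sup>+v. ennreal (kernel N p v) * indicator (cball 0 ?R) v + (ennreal (?c1 (cell_index v)) + ennreal (?c2 (cell_index v))) \<partial>lborel)"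
    by (intro nn_integral_mono)
  also have "\<dots> = (\<integral>\<^sup>+v. ennreal (kernel N p v) * indicator (cball 0 ?R) v \<partial>lborel)
     + ((\<integral>\<^sup>+v. ennreal (?c1 (cell_index v)) \<partial>lborel) + (\<integral>\<^sup>+v. ennreal (?c2 (cell_index v)) \<partial>lborel))"
    by (subst nn_integral_add[OF measurable_kernel], intro borel_measurable_add measurable_cell_fun[of ?c1] measurable_cell_fun[of ?c2])
       (subst nn_integral_add[OF measurable_cell_fun[of ?c1] measurable_cell_fun[of ?c2]], rule refl)
  also have "\<dots> = ennreal (main_term N p ?R)
     + (ennreal (y * (\<Sum>q\<in>near_starts N 1 p. \<eta>)) + ennreal (y * (\<Sum>q\<in>near_starts N \<epsilon> p. B)))"
    by (simp only: nn_kernel[OF R] nn_cell_sum[OF finite_starts(2), of "\<lambda>_. \<eta>", OF \<eta>] nn_cell_sum[OF finite_starts(2), of "\<lambda>_. B", OF B_nonneg])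
  also have "\<dots> = ennreal (main_term N p ?R
     + (y * (\<Sum>q\<in>near_starts N 1 p. \<eta>) + y * (\<Sum>q\<in>near_starts N \<epsilon> p. B)))"
    using \<eta> B_nonneg y_pos disc_integral_nonneg by simp
  finally have "ennreal (y * (\<Sum>q\<in>starts N p. f (log_gap N p q))) \<le> ennreal (main_term N p ?R
     + (y * (\<Sum>q\<in>near_starts N 1 p. \<eta>) + y * (\<Sum>q\<in>near_starts N \<epsilon> p. B)))"
    by (simp only: nn_cell_sum[OF finite_starts(1), of "\<lambda>q. f (log_gap N p q)", OF nonneg])
  then have "y * (\<Sum>q\<in>starts N p. f (log_gap N p q)) \<le> main_term N p ?R
     + (y * (\<Sum>q\<in>near_starts N 1 p. \<eta>) + y * (\<Sum>q\<in>near_starts N \<epsilon> p. B))"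
    using \<eta> B_nonneg y_pos disc_integral_nonneg by (subst (asm) ennreal_le_iff) (auto intro!: add_nonneg_nonneg)
  then show ?thesis by (simp add: mult_ac distrib_left)
qed

text \<open>The reverse comparison starts from points \<open>v\<close> of a disc so small that the lattice point of the cell
  and its translate by \<open>p\<close> both lie in the disc of radius \<open>N\<close>. Such a lattice point is then either one
  of the \<open>starts\<close>, or of the same norm as its translate, or close to 0; the contribution of the last
  kind is bounded by the integral over the disc of radius \<open>2 \<epsilon> N\<close>.\<close>

lemma starts_sum_ge:
  assumes lin: "\<And>q u. \<epsilon> * real N \<le> norm (point q) \<Longrightarrow> norm (point q - u) \<le> 1 + y \<Longrightarrow>
      \<bar>log_gap N p q - linear_gap N p u\<bar> \<le> \<delta>"
    and \<delta>: "\<And>a b. \<bar>a - b\<bar> \<le> \<delta> \<Longrightarrow> \<bar>f a - f b\<bar> \<le> \<eta>" "\<delta> \<le> 1" and \<eta>: "0 \<le> \<eta>"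
    and \<epsilon>: "0 < \<epsilon>" and N: "0 < real N" and p: "norm (point p) \<le> X N" and X: "X N < \<epsilon> * real N"
    and small: "1 + y \<le> \<epsilon> * real N" and R: "0 < real N - X N - (1 + y)"
  shows "main_term N p (real N - X N - (1 + y))
    \<le> y * (\<Sum>q\<in>starts N p. f (log_gap N p q)) + y * (\<eta> * real (card (near_starts N 1 p)) + B * real (card (equal_starts N p)))
      + main_term N p (2 * \<epsilon> * real N)"
proof -
  let ?R = "real N - X N - (1 + y)" and ?r = "2 * \<epsilon> * real N"
  have r: "0 < ?r" using \<epsilon> N by simp
  let ?c0 = "\<lambda>q. if q \<in> starts N p then f (log_gap N p q) else 0"
  let ?c1 = "\<lambda>q. if q \<in> near_starts N 1 p then \<eta> else 0" and ?c2 = "\<lambda>q. if q \<in> equal_starts N p then B else 0"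
  have "ennreal (kernel N p v) * indicator (cball 0 ?R) v \<le>
     ennreal (kernel N p v) * indicator (cball 0 ?r) v +
     (ennreal (?c0 (cell_index v)) + (ennreal (?c1 (cell_index v)) + ennreal (?c2 (cell_index v))))" for v
  proof (cases "kernel N p v \<noteq> 0 \<and> norm v \<le> ?R \<and> \<not> norm v \<le> ?r")
    case True
    let ?q = "cell_index v"
    have d: "norm (point ?q - v) \<le> 1 + y" by (rule norm_cell_index)
    have ge: "\<epsilon> * real N \<le> norm (point ?q)"
      using d True small norm_triangle_ineq3[of "point ?q" v] by linarith
    have qN: "norm (point ?q) \<le> real N - X N" using d True norm_triangle_ineq3[of "point ?q" v] by linarith
    have qp: "norm (point ?q + point p) \<le> real N" using qN p norm_triangle_ineq[of "point ?q" "point p"] by linarith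
    have q0: "?q \<noteq> 0" using ge \<epsilon> N by (metis linorder_not_less mult_pos_pos norm_zero point_0)
    have "norm (point ?q + point p) \<noteq> 0"
      using ge p X norm_diff_ineq[of "point ?q" "point p"] by linarith
    then have qp0: "?q + p \<noteq> 0" by (metis norm_zero point_0 point_add)
    have X0: "0 \<le> X N" by (simp add: X_def)
    let ?l = "linear_gap N p v"
    have l: "\<bar>log_gap N p ?q - ?l\<bar> \<le> \<delta>" by (rule lin[OF ge d])
    have "\<bar>?l\<bar> \<le> M" using True support[of ?l] unfolding kernel_def by (cases "M < \<bar>?l\<bar>") auto
    then have "\<bar>log_gap N p ?q\<bar> \<le> M + 1" using l \<delta>(2) by linarith
    then have n1: "?q \<in> near_starts N 1 p" using q0 qp0 qN X0 by (simp add: near_starts_def)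
    have "ennreal (kernel N p v) \<le> ennreal (?c0 ?q) + (ennreal (?c1 ?q) + ennreal (?c2 ?q))"
    proof (cases "norm (point ?q + point p) = norm (point ?q)")
      case True
      then have "?q \<in> equal_starts N p" using qN X0 by (simp add: equal_starts_def)
      then have "ennreal (kernel N p v) \<le> ennreal (?c2 ?q)" using bounded by (simp add: ennreal_leI kernel_def)
      then show ?thesis by (simp add: add_increasing)
    next
      case False
      then have s: "?q \<in> starts N p" using q0 qp0 qN qp X0 by (simp add: starts_def)
      have "kernel N p v \<le> f (log_gap N p ?q) + \<eta>"
        using \<delta>(1)[OF l] unfolding kernel_def by (simp add: abs_le_iff)
      then have "ennreal (kernel N p v) \<le> ennreal (f (log_gap N p ?q)) + ennreal \<eta>"
        by (simp add: nonneg \<eta> ennreal_leI flip: ennreal_plus)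
      then show ?thesis using s n1 by (simp add: add_increasing2 flip: add.assoc)
    qed
    then show ?thesis using True by (simp add: add_increasing)
  qed (auto simp: indicator_def)
  then have "(\<integral>\<^sup>+v. ennreal (kernel N p v) * indicator (cball 0 ?R) v \<partial>lborel)
    \<le> (\<integral>\<^sup>+v. ennreal (kernel N p v) * indicator (cball 0 ?r) v +
     (ennreal (?c0 (cell_index v)) + (ennreal (?c1 (cell_index v)) + ennreal (?c2 (cell_index v)))) \<partial>lborel)"
    by (intro nn_integral_mono)
  also have "\<dots> = (\<integral>\<^sup>+v. ennreal (kernel N p v) * indicator (cball 0 ?r) v \<partial>lborel)
     + ((\<integral>\<^sup>+v. ennreal (?c0 (cell_index v)) \<partial>lborel)
     + ((\<integral>\<^sup>+v. ennreal (?c1 (cell_index v)) \<partial>lborel) + (\<integral>\<^sup>+v. ennreal (?c2 (cell_index v)) \<partial>lborel)))"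
    by (subst nn_integral_add[OF measurable_kernel], intro borel_measurable_add measurable_cell_fun[of ?c0] measurable_cell_fun[of ?c1] measurable_cell_fun[of ?c2])
       (subst nn_integral_add[OF measurable_cell_fun[of ?c0]], intro borel_measurable_add measurable_cell_fun[of ?c1] measurable_cell_fun[of ?c2],
        subst nn_integral_add[OF measurable_cell_fun[of ?c1] measurable_cell_fun[of ?c2]], rule refl)
  also have "\<dots> = ennreal (main_term N p ?r)
     + (ennreal (y * (\<Sum>q\<in>starts N p. f (log_gap N p q)))
     + (ennreal (y * (\<Sum>q\<in>near_starts N 1 p. \<eta>)) + ennreal (y * (\<Sum>q\<in>equal_starts N p. B))))"
    by (simp only: nn_kernel[OF r] nn_cell_sum[OF finite_starts(2), of "\<lambda>_. \<eta>", OF \<eta>] nn_cell_sum[OF finite_starts(3), of "\<lambda>_. B", OF B_nonneg]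
        nn_cell_sum[OF finite_starts(1), of "\<lambda>q. f (log_gap N p q)", OF nonneg])
  also have "\<dots> = ennreal (main_term N p ?r
     + (y * (\<Sum>q\<in>starts N p. f (log_gap N p q)) + (y * (\<Sum>q\<in>near_starts N 1 p. \<eta>) + y * (\<Sum>q\<in>equal_starts N p. B))))"
    using \<eta> B_nonneg y_pos disc_integral_nonneg by (simp add: sum_nonneg nonneg)
  finally have "ennreal (main_term N p ?R) \<le> ennreal (main_term N p ?r
     + (y * (\<Sum>q\<in>starts N p. f (log_gap N p q)) + (y * (\<Sum>q\<in>near_starts N 1 p. \<eta>) + y * (\<Sum>q\<in>equal_starts N p. B))))"
    by (simp only: nn_kernel[OF R])
  then have "main_term N p ?R \<le> main_term N p ?r
     + (y * (\<Sum>q\<in>starts N p. f (log_gap N p q)) + (y * (\<Sum>q\<in>near_starts N 1 p. \<eta>) + y * (\<Sum>q\<in>equal_starts N p. B)))"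
    using \<eta> B_nonneg y_pos disc_integral_nonneg by (subst (asm) ennreal_le_iff) (auto intro!: add_nonneg_nonneg mult_nonneg_nonneg sum_nonneg nonneg)
  then show ?thesis by (simp add: mult_ac distrib_left)
qed

lemma pair_sum_sandwich:
  assumes \<eta>: "0 < \<eta>" and \<epsilon>: "0 < \<epsilon>" "\<epsilon> \<le> 1 / 2"
  shows "\<forall>\<^sub>F N in sequentially.
    y * (pair_sum N / \<psi> N) \<le> disc_sum N (real N + (1 + y)) / \<psi> N
      + y * (\<eta> * near_bound N 1 + B * near_bound N \<epsilon>) \<and>
    disc_sum N (real N - X N - (1 + y)) / \<psi> N \<le> y * (pair_sum N / \<psi> N)
      + y * (\<eta> * near_bound N 1 + B * equal_bound N)
      + small_bound \<epsilon>"
proof -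
  obtain \<delta> where \<delta>: "0 < \<delta>" "\<delta> \<le> 1" "\<And>a b. \<bar>a - b\<bar> \<le> \<delta> \<Longrightarrow> \<bar>f a - f b\<bar> \<le> \<eta>"
    using modulus_of_continuity[OF \<eta>] by metis
  have e1: "\<forall>\<^sub>F N in sequentially. (1 + y) / \<epsilon> \<le> real N" using eventually_nat_real[OF eventually_ge_at_top] by simp
  have e3: "\<forall>\<^sub>F N in sequentially. 4 * (1 + y) \<le> real N" using eventually_nat_real[OF eventually_ge_at_top] by simp
  have "(\<lambda>N. real N powr (\<alpha> - 1)) \<longlonglongrightarrow> 0" using \<alpha>_less by (intro tendsto_powr_neg_real) simp
  then have e2: "\<forall>\<^sub>F N in sequentially. real N powr (\<alpha> - 1) < \<epsilon>" by (rule order_tendstoD) (use \<epsilon> in simp)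
  have n1: "\<forall>\<^sub>F N in sequentially. near_total N 1 / \<psi> N
    \<le> near_bound N 1" by (rule near_starts_sum_le) auto
  have n2: "\<forall>\<^sub>F N in sequentially. near_total N \<epsilon> / \<psi> N
    \<le> near_bound N \<epsilon>" by (rule near_starts_sum_le) (use \<epsilon> in auto)
  from log_gap_linear[OF \<epsilon>(1) \<delta>(1)] n1 n2 equal_starts_sum_le disc_sum_small_le[OF \<epsilon>] e1 e2 e3 eventually_ge_at_top[of 1]
  show ?thesis
  proof eventually_elim
    case (elim N)
    let ?P = "punctured_disc (X N)"
    have N0: "0 < real N" "1 \<le> N" using elim by simp_all
    have lin: "\<bar>log_gap N p q - linear_gap N p u\<bar> \<le> \<delta>"
      if "p \<in> ?P" "\<epsilon> * real N \<le> norm (point q)" "norm (point q - u) \<le> 1 + y" for p q u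
      using elim(1) that by blast
    have "real N powr (\<alpha> - 1) = X N / real N" using N0 by (simp add: X_def powr_diff)
    then have "X N / real N < \<epsilon>" using elim(7) by simp
    then have Xe: "X N < \<epsilon> * real N" using N0 by (simp only: pos_divide_less_eq)
    have ye: "1 + y \<le> \<epsilon> * real N" using elim(6) \<epsilon> by (simp add: field_simps)
    have "\<epsilon> * real N \<le> 1 / 2 * real N" using \<epsilon> by (intro mult_right_mono) auto
    then have "X N < real N / 2" using Xe by linarith
    then have R: "0 < real N - X N - (1 + y)" using elim(8) y_pos by argo
    have ps: "0 < \<psi> N" by (rule \<psi>_pos[OF N0(2)])
    have "y * pair_sum N \<le> (\<Sum>p\<in>?P. main_term N p (real N + (1 + y))
      + y * (\<eta> * real (card (near_starts N 1 p)) + B * real (card (near_starts N \<epsilon> p))))"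
      unfolding pair_sum_def
      by (subst sum_distrib_left, rule sum_mono, rule starts_sum_le[OF lin]) (use \<delta> \<eta> in auto)
    also have "\<dots> = disc_sum N (real N + (1 + y)) + y * (\<eta> * near_total N 1 + B * near_total N \<epsilon>)"
      by (simp only: sum.distrib sum_distrib_left disc_sum_def distrib_left)
    finally have "y * pair_sum N / \<psi> N \<le> (disc_sum N (real N + (1 + y)) + y * (\<eta> * near_total N 1 + B * near_total N \<epsilon>)) / \<psi> N"
      by (rule divide_right_mono) (use ps in simp)
    also have "\<dots> = disc_sum N (real N + (1 + y)) / \<psi> N + y * (\<eta> * (near_total N 1 / \<psi> N) + B * (near_total N \<epsilon> / \<psi> N))"
      by (simp add: add_divide_distrib distrib_left)
    also have "\<dots> \<le> disc_sum N (real N + (1 + y)) / \<psi> N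
      + y * (\<eta> * near_bound N 1 + B * near_bound N \<epsilon>)"
      by (rule add_left_mono, rule mult_left_mono, rule add_mono; (rule mult_left_mono[OF elim(2)] mult_left_mono[OF elim(3)])?) (use \<eta> B_nonneg y_pos in auto)
    finally have up: "y * (pair_sum N / \<psi> N) \<le> disc_sum N (real N + (1 + y)) / \<psi> N
      + y * (\<eta> * near_bound N 1 + B * near_bound N \<epsilon>)"
      by simp
    have "disc_sum N (real N - X N - (1 + y)) \<le> (\<Sum>p\<in>?P. y * (\<Sum>q\<in>starts N p. f (log_gap N p q)) + y * (\<eta> * real (card (near_starts N 1 p)) + B * real (card (equal_starts N p)))
      + main_term N p (2 * \<epsilon> * real N))"
      unfolding disc_sum_def
      by (rule sum_mono, rule starts_sum_ge[OF lin]) (use \<delta> \<eta> \<epsilon> N0 Xe ye R in \<open>auto simp: punctured_disc_def\<close>)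
    also have "\<dots> = y * pair_sum N + y * (\<eta> * near_total N 1 + B * equal_total N) + disc_sum N (2 * \<epsilon> * real N)"
      by (simp only: sum.distrib sum_distrib_left disc_sum_def pair_sum_def distrib_left)
    finally have "disc_sum N (real N - X N - (1 + y)) / \<psi> N \<le> (y * pair_sum N + y * (\<eta> * near_total N 1 + B * equal_total N) + disc_sum N (2 * \<epsilon> * real N)) / \<psi> N"
      by (rule divide_right_mono) (use ps in simp)
    also have "\<dots> = y * (pair_sum N / \<psi> N) + y * (\<eta> * (near_total N 1 / \<psi> N) + B * (equal_total N / \<psi> N)) + disc_sum N (2 * \<epsilon> * real N) / \<psi> N"
      by (simp add: add_divide_distrib distrib_left)
    also have "\<dots> \<le> y * (pair_sum N / \<psi> N)
      + y * (\<eta> * near_bound N 1 + B * equal_bound N)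
      + small_bound \<epsilon>"
      by (rule add_mono[OF add_left_mono elim(5)], rule mult_left_mono, rule add_mono; (rule mult_left_mono[OF elim(2)] mult_left_mono[OF elim(4)])?) (use \<eta> B_nonneg y_pos in auto)
    finally show ?case using up by blast
  qed
qed

text \<open>Letting first \<open>N\<close> tend to infinity and then \<open>\<eta>\<close> and \<open>\<epsilon>\<close> to 0 in the two-sided estimate. The
  hypotheses isolate what depends on the regime, namely the limit \<open>\<phi>\<close> of the rescaled disc
  integrals.\<close>

theorem pair_sum_tendsto:
  assumes conv: "\<And>r s. 0 < r \<Longrightarrow> s \<longlonglongrightarrow> r \<Longrightarrow> (\<lambda>N. \<mu> N * disc_integral (gap_scale N * s N)) \<longlonglongrightarrow> \<phi> r"
    and m: "\<phi> \<in> borel_measurable borel"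
    and L: "(\<integral>\<^sup>+v. ennreal (\<phi> (norm v)) * indicator unit_disc v \<partial>lborel) = ennreal L" "0 \<le> L"
  shows "(\<lambda>N. pair_sum N / \<psi> N) \<longlonglongrightarrow> L / y\<^sup>2"
proof -
  have inv: "(\<lambda>N. (1 + y) / real N) \<longlonglongrightarrow> 0" by (rule lim_const_over_n)
  have Xn: "(\<lambda>N. real N powr (\<alpha> - 1)) \<longlonglongrightarrow> 0" using \<alpha>_less by (intro tendsto_powr_neg_real) simp
  have "(\<lambda>N. 1 + (1 + y) / real N) \<longlonglongrightarrow> 1 + 0" by (intro tendsto_add tendsto_const inv)
  moreover have "\<forall>\<^sub>F N in sequentially. 1 + (1 + y) / real N = (real N + (1 + y)) / real N"
    using eventually_ge_at_top[of 1] by eventually_elim (simp add: field_simps)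
  ultimately have Rp: "(\<lambda>N. (real N + (1 + y)) / real N) \<longlonglongrightarrow> 1" by (simp add: tendsto_cong)
  have "(\<lambda>N. 1 - real N powr (\<alpha> - 1) - (1 + y) / real N) \<longlonglongrightarrow> 1 - 0 - 0" by (intro tendsto_diff tendsto_const inv Xn)
  moreover have "\<forall>\<^sub>F N in sequentially. 1 - real N powr (\<alpha> - 1) - (1 + y) / real N = (real N - X N - (1 + y)) / real N"
    using eventually_ge_at_top[of 1]
    by eventually_elim (simp add: X_def powr_diff diff_divide_distrib)
  ultimately have Rm: "(\<lambda>N. (real N - X N - (1 + y)) / real N) \<longlonglongrightarrow> 1" by (simp add: tendsto_cong)
  have Jp: "(\<lambda>N. disc_sum N (real N + (1 + y)) / \<psi> N) \<longlonglongrightarrow> L / y" by (rule disc_sum_tendsto[OF conv m L Rp])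
  have Jm: "(\<lambda>N. disc_sum N (real N - X N - (1 + y)) / \<psi> N) \<longlonglongrightarrow> L / y" by (rule disc_sum_tendsto[OF conv m L Rm])
  have "(\<lambda>N. y * (pair_sum N / \<psi> N)) \<longlonglongrightarrow> L / y"
  proof (rule LIMSEQ_I)
    fix e :: real assume e: "0 < e"
    \<comment> \<open>\<open>K\<close> bounds every coefficient of \<open>\<eta>\<close> and \<open>\<epsilon>^2\<close> in the two estimates as \<open>\<mu> N / N\<close> tends to 0; at
      most two such terms occur in each, and each will be at most \<open>e / 4\<close>.\<close>
    define K where "K = y * (C\<^sub>1 * C\<^sub>0) + y * (B * (C\<^sub>1 * C\<^sub>0)) + C\<^sub>1 * (4 * C\<^sub>2) + 1"
    have K0: "0 < K" using y_pos C\<^sub>0_pos C\<^sub>1_pos B_nonneg M_pos by (simp add: K_def add_nonneg_pos)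
    define \<eta> where "\<eta> = e / (4 * K)"
    define \<epsilon> where "\<epsilon> = min (1 / 2) (e / (4 * K))"
    have \<eta>: "0 < \<eta>" using e K0 by (simp add: \<eta>_def)
    have \<epsilon>: "0 < \<epsilon>" "\<epsilon> \<le> 1 / 2" using e K0 by (simp_all add: \<epsilon>_def)
    have \<epsilon>2: "\<epsilon>\<^sup>2 \<le> e / (4 * K)"
    proof -
      have "\<epsilon> * \<epsilon> \<le> \<epsilon> * 1" using \<epsilon> by (intro mult_left_mono) auto
      also have "\<dots> \<le> e / (4 * K)" by (simp add: \<epsilon>_def)
      finally show ?thesis by (simp add: power2_eq_square)
    qed
    let ?U = "\<lambda>N. disc_sum N (real N + (1 + y)) / \<psi> N
      + y * (\<eta> * near_bound N 1 + B * near_bound N \<epsilon>)"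
    let ?D = "\<lambda>N. disc_sum N (real N - X N - (1 + y)) / \<psi> N
      - y * (\<eta> * near_bound N 1 + B * equal_bound N)
      - small_bound \<epsilon>"
    have U: "?U \<longlonglongrightarrow> L / y + y * (\<eta> * (C\<^sub>1 * (C\<^sub>0 * 1\<^sup>2 + C\<^sub>0 * 0)) + B * (C\<^sub>1 * (C\<^sub>0 * \<epsilon>\<^sup>2 + C\<^sub>0 * 0)))"
      by (intro tendsto_add tendsto_mult tendsto_const Jp \<mu>_over_N)
    have D: "?D \<longlonglongrightarrow> L / y - y * (\<eta> * (C\<^sub>1 * (C\<^sub>0 * 1\<^sup>2 + C\<^sub>0 * 0)) + B * (C\<^sub>1 * (12 * (1 + 1 / y) * 0)))
      - C\<^sub>1 * (4 * C\<^sub>2 * \<epsilon>\<^sup>2)"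
      by (intro tendsto_add tendsto_diff tendsto_mult tendsto_const Jm \<mu>_over_N)
    have Ke: "K * (e / (4 * K)) = e / 4" using K0 by simp
    have a1: "y * (C\<^sub>1 * C\<^sub>0) * \<eta> \<le> K * \<eta>" "y * (B * (C\<^sub>1 * C\<^sub>0)) * \<epsilon>\<^sup>2 \<le> K * \<epsilon>\<^sup>2" "C\<^sub>1 * (4 * C\<^sub>2) * \<epsilon>\<^sup>2 \<le> K * \<epsilon>\<^sup>2"
      using \<eta> y_pos C\<^sub>0_pos C\<^sub>1_pos B_nonneg M_pos by (intro mult_right_mono; simp add: K_def add_nonneg_nonneg)+
    have a2: "K * \<eta> = e / 4" "K * \<epsilon>\<^sup>2 \<le> e / 4"
      using Ke mult_left_mono[OF \<epsilon>2, of K] K0 by (simp_all add: \<eta>_def)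
    have "L / y + y * (\<eta> * (C\<^sub>1 * (C\<^sub>0 * 1\<^sup>2 + C\<^sub>0 * 0)) + B * (C\<^sub>1 * (C\<^sub>0 * \<epsilon>\<^sup>2 + C\<^sub>0 * 0)))
       = L / y + (y * (C\<^sub>1 * C\<^sub>0) * \<eta> + y * (B * (C\<^sub>1 * C\<^sub>0)) * \<epsilon>\<^sup>2)" by (simp add: distrib_left)
    also have "\<dots> < L / y + e" using a1 a2 e by linarith
    finally have "\<forall>\<^sub>F N in sequentially. ?U N < L / y + e" by (rule order_tendstoD(2)[OF U])
    moreover have "L / y - e < L / y - y * (\<eta> * (C\<^sub>1 * (C\<^sub>0 * 1\<^sup>2 + C\<^sub>0 * 0)) + B * (C\<^sub>1 * (12 * (1 + 1 / y) * 0)))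
      - C\<^sub>1 * (4 * C\<^sub>2 * \<epsilon>\<^sup>2)"
    proof -
      have "y * (\<eta> * (C\<^sub>1 * (C\<^sub>0 * 1\<^sup>2 + C\<^sub>0 * 0)) + B * (C\<^sub>1 * (12 * (1 + 1 / y) * 0))) = y * (C\<^sub>1 * C\<^sub>0) * \<eta>"
        "C\<^sub>1 * (4 * C\<^sub>2 * \<epsilon>\<^sup>2) = C\<^sub>1 * (4 * C\<^sub>2) * \<epsilon>\<^sup>2" by simp_all
      then show ?thesis using a1 a2 e by linarith
    qed
    then have "\<forall>\<^sub>F N in sequentially. L / y - e < ?D N" by (rule order_tendstoD(1)[OF D])
    ultimately have "\<forall>\<^sub>F N in sequentially. norm (y * (pair_sum N / \<psi> N) - L / y) < e"
      using pair_sum_sandwich[OF \<eta> \<epsilon>]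
    proof eventually_elim
      case (elim N)
      then have "y * (pair_sum N / \<psi> N) < L / y + e" "L / y - e < y * (pair_sum N / \<psi> N)" by linarith+
      then show ?case by (simp add: abs_less_iff)
    qed
    then show "\<exists>no. \<forall>n\<ge>no. norm (y * (pair_sum n / \<psi> n) - L / y) < e" by (simp add: eventually_sequentially)
  qed
  then have "(\<lambda>N. y * (pair_sum N / \<psi> N) / y) \<longlonglongrightarrow> L / y / y" using y_pos by (intro tendsto_divide tendsto_const) auto
  then show ?thesis using y_pos by (simp add: power2_eq_square)
qed

end

section \<open>The empirical measures\<close>

lemma integral_empirical_measure:
  assumes f: "f \<in> borel_measurable borel" and N: "0 < \<psi> N"
  shows "integrable (empirical_measure K \<alpha> \<beta> \<psi> N) f"
    and "(\<integral>x. f x \<partial>empirical_measure K \<alpha> \<beta> \<psi> N) =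
      (\<Sum>(a, b)\<in>pair_index N. real (pair_count K \<alpha> a b N) * f (real N powr \<beta> * (ln (real a) - ln (real b)))) / \<psi> N"
proof -
  let ?w = "\<lambda>x. 1 / \<psi> N * real (case x of (a, b) \<Rightarrow> pair_count K \<alpha> a b N)"
  let ?g = "\<lambda>x. real N powr \<beta> * (case x of (a, b) \<Rightarrow> ln (real a) - ln (real b))"
  have eq: "empirical_measure K \<alpha> \<beta> \<psi> N = distr (point_measure (pair_index N) ?w) borel ?g"
    unfolding empirical_measure_def by (intro arg_cong3[where f = distr] arg_cong2[where f = point_measure]) (auto simp: fun_eq_iff)
  have m: "?g \<in> measurable (point_measure (pair_index N) ?w) borel"
    by (simp add: measurable_point_measure_eq1)
  show "integrable (empirical_measure K \<alpha> \<beta> \<psi> N) f"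
    unfolding eq by (subst integrable_distr_eq[OF m f]) (rule integrable_point_measure_finite[OF finite_pair_index])
  have "(\<integral>x. f x \<partial>empirical_measure K \<alpha> \<beta> \<psi> N) = (\<integral>x. f (?g x) \<partial>point_measure (pair_index N) ?w)"
    unfolding eq by (rule integral_distr[OF m f])
  also have "\<dots> = (\<Sum>x\<in>pair_index N. ?w x *\<^sub>R f (?g x))"
    by (rule lebesgue_integral_point_measure_finite) (use finite_pair_index N in auto)
  also have "\<dots> = (\<Sum>(a, b)\<in>pair_index N. real (pair_count K \<alpha> a b N) * f (real N powr \<beta> * (ln (real a) - ln (real b)))) / \<psi> N"
    unfolding sum_divide_distrib by (intro sum.cong) auto
  finally show "(\<integral>x. f x \<partial>empirical_measure K \<alpha> \<beta> \<psi> N) =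
      (\<Sum>(a, b)\<in>pair_index N. real (pair_count K \<alpha> a b N) * f (real N powr \<beta> * (ln (real a) - ln (real b)))) / \<psi> N" .
qed

context pair_sums
begin

definition embed :: "int \<times> int \<Rightarrow> complex" where
  "embed p = Complex (of_int (fst p)) (y * of_int (snd p))"

lemma cmod_embed: "cmod (embed p) = norm (point p)"
  by (simp add: embed_def point_def norm_prod_def cmod_def)

lemma embed_diff: "embed (p - q) = embed p - embed q"
  by (simp add: embed_def complex_eq_iff algebra_simps)

lemma norm_form_eq: "norm_form z = (cmod z)\<^sup>2"
  by (simp add: norm_form_def cmod_power2) (simp add: power2_eq_square)

text \<open>The summation over norms \<open>(a, b)\<close> and then over the pairs of ring elements with these norms is a
  summation over pairs of lattice points, since each nonzero element has a positive integer as norm.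
  Pairs correspond to base points \<open>z\<close> and differences \<open>w - z\<close>.\<close>

lemma pair_count_sum:
  assumes bij: "bij_betw embed UNIV (ring_of_integers K)"
    and int: "\<And>p. (norm (point p))\<^sup>2 \<in> \<int>" and N: "1 \<le> N"
  shows "(\<Sum>(a, b)\<in>pair_index N. real (pair_count K \<alpha> a b N) * f (real N powr \<beta> * (ln (real a) - ln (real b)))) = pair_sum N"
proof -
  define P where "P x = {(w, z). w \<in> ring_of_integers K \<and> z \<in> ring_of_integers K \<and>
      norm_form w = real (fst x) \<and> norm_form z = real (snd x) \<and> norm_form (z - w) \<le> real N powr (2 * \<alpha>)}" for x :: "nat \<times> nat"
  define F where "F x = f (real N powr \<beta> * (ln (real (fst x)) - ln (real (snd x))))" for x :: "nat \<times> nat"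
  define nn where "nn p = nat \<lfloor>(norm (point p))\<^sup>2\<rfloor>" for p
  have nn: "real (nn p) = (norm (point p))\<^sup>2" for p
  proof -
    obtain k :: int where k: "(norm (point p))\<^sup>2 = of_int k" using int[of p] by (auto elim: Ints_cases)
    then have "0 \<le> k" by (metis of_int_0_le_iff zero_le_power2)
    then show ?thesis using k by (simp add: nn_def)
  qed
  have inj: "embed p = embed q \<longleftrightarrow> p = q" for p q
    using inj_eq[of embed p q] bij by (simp add: bij_betw_def)
  have ran: "embed p \<in> ring_of_integers K" for p using bij by (auto simp: bij_betw_def)
  define inv where "inv w = (THE p. embed p = w)" for w
  have inv1: "inv (embed p) = p" for p unfolding inv_def by (simp add: inj)
  have inv2: "embed (inv w) = w" if "w \<in> ring_of_integers K" for w
  proof -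
    have "w \<in> range embed" using that bij by (simp add: bij_betw_def)
    then obtain p where "w = embed p" by blast
    then show ?thesis by (simp add: inv1)
  qed
  have finP: "finite (P x)" for x
  proof (rule finite_subset)
    let ?T = "\<lambda>a::nat. embed ` {p. norm (point p) \<le> sqrt (real a)}"
    show "P x \<subseteq> ?T (fst x) \<times> ?T (snd x)"
    proof
      fix u assume u: "u \<in> P x"
      then obtain w z where wz: "u = (w, z)" "w \<in> ring_of_integers K" "z \<in> ring_of_integers K"
        "(cmod w)\<^sup>2 = real (fst x)" "(cmod z)\<^sup>2 = real (snd x)" by (auto simp: P_def norm_form_eq)
      have "norm (point (inv w)) = sqrt (real (fst x))" "norm (point (inv z)) = sqrt (real (snd x))"
        using wz by (simp_all add: inv2 flip: cmod_embed wz(4,5))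
      then show "u \<in> ?T (fst x) \<times> ?T (snd x)"
        using wz inv2[OF wz(2)] inv2[OF wz(3)] by (auto intro!: image_eqI[of w embed "inv w"] image_eqI[of z embed "inv z"])
    qed
    show "finite (?T (fst x) \<times> ?T (snd x))" by (intro finite_cartesian_product finite_imageI finite_disc)
  qed
  have sq: "(norm (point p))\<^sup>2 \<le> (real N)\<^sup>2 \<longleftrightarrow> norm (point p) \<le> real N" for p
    by (simp add: power2_le_iff_abs_le)
  have X2: "real N powr (2 * \<alpha>) = (X N)\<^sup>2" by (simp add: X_def power2_eq_square flip: powr_add)
  have sqX: "(norm (point p))\<^sup>2 \<le> (X N)\<^sup>2 \<longleftrightarrow> norm (point p) \<le> X N" for p
    by (simp add: power2_le_iff_abs_le X_def)
  have "(\<Sum>(a, b)\<in>pair_index N. real (pair_count K \<alpha> a b N) * f (real N powr \<beta> * (ln (real a) - ln (real b))))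
    = (\<Sum>x\<in>pair_index N. real (card (P x)) * F x)"
    by (intro sum.cong) (auto simp: P_def F_def pair_count_def)
  also have "\<dots> = (\<Sum>x\<in>pair_index N. \<Sum>u\<in>P x. F x)" by simp
  also have "\<dots> = (\<Sum>(x, u)\<in>Sigma (pair_index N) P. F x)"
    by (rule sum.Sigma) (use finite_pair_index finP in auto)
  also have "\<dots> = (\<Sum>(p, q)\<in>Sigma (punctured_disc (X N)) (starts N). f (log_gap N p q))"
  proof (rule sum.reindex_bij_witness[where i = "\<lambda>(p, q). ((nn (q + p), nn q), (embed (q + p), embed q))"
        and j = "\<lambda>(x, (w, z)). (inv w - inv z, inv z)"])
    fix u assume u: "u \<in> Sigma (pair_index N) P"
    then obtain a b w z where e: "u = ((a, b), (w, z))" and ab: "(a, b) \<in> pair_index N"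
      and w: "w \<in> ring_of_integers K" "norm_form w = real a" and z: "z \<in> ring_of_integers K" "norm_form z = real b"
      and d: "norm_form (z - w) \<le> real N powr (2 * \<alpha>)"
      by (cases u) (auto simp: P_def)
    obtain r q where rq: "w = embed r" "z = embed q" using inv2[OF w(1)] inv2[OF z(1)] by metis
    have a: "real a = (norm (point r))\<^sup>2" and b: "real b = (norm (point q))\<^sup>2"
      using w z by (simp_all add: rq norm_form_eq cmod_embed)
    have na: "nn r = a" and nb: "nn q = b" using a b nn[of r] nn[of q] by linarith+
    show "(case case u of (x, w, z) \<Rightarrow> (inv w - inv z, inv z) of (p, q) \<Rightarrow> ((nn (q + p), nn q), embed (q + p), embed q)) = u"
      by (simp add: e rq inv1 na nb)
    have "norm_form (z - w) = (norm (point (q - r)))\<^sup>2" by (simp add: norm_form_eq rq flip: embed_diff cmod_embed)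
    also have "norm (point (q - r)) = norm (point (r - q))"
      using point_add[of "q - r" r] point_add[of "r - q" q] by (simp add: norm_minus_commute eq_diff_eq[symmetric])
    finally have dX: "norm (point (r - q)) \<le> X N" using d sqX by (simp add: X2)
    have ab': "a \<noteq> b" "0 < a" "a \<le> N\<^sup>2" "0 < b" "b \<le> N\<^sup>2" using ab by (auto simp: pair_index_def)
    have ne: "norm (point r) \<noteq> norm (point q)" using ab'(1) a b by auto
    have r0: "r \<noteq> 0" "q \<noteq> 0" using ab' a b by auto
    have "real a \<le> (real N)\<^sup>2" "real b \<le> (real N)\<^sup>2" using ab' by (metis of_nat_le_iff of_nat_power)+
    then have le: "norm (point r) \<le> real N" "norm (point q) \<le> real N" by (simp_all add: a b sq)
    have pt: "point q + point (r - q) = point r" by (simp flip: point_add)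
    show "(case u of (x, w, z) \<Rightarrow> (inv w - inv z, inv z)) \<in> Sigma (punctured_disc (X N)) (starts N)"
      using r0 le ne dX by (auto simp: e rq inv1 punctured_disc_def starts_def pt)
    show "(case case u of (x, w, z) \<Rightarrow> (inv w - inv z, inv z) of (p, q) \<Rightarrow> f (log_gap N p q)) = (case u of (x, u) \<Rightarrow> F x)"
      using r0 by (simp add: e rq inv1 F_def log_gap_def pt a b ln_div)
  next
    fix u assume "u \<in> Sigma (punctured_disc (X N)) (starts N)"
    then obtain p q where e: "u = (p, q)" and p: "p \<noteq> 0" "norm (point p) \<le> X N" and q: "q \<in> starts N p"
      by (cases u) (auto simp: punctured_disc_def)
    have q': "q \<noteq> 0" "q + p \<noteq> 0" "norm (point q) \<le> real N" "norm (point (q + p)) \<le> real N" "norm (point (q + p)) \<noteq> norm (point q)"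
      using q by (auto simp: starts_def point_add)
    show "(case case u of (p, q) \<Rightarrow> ((nn (q + p), nn q), embed (q + p), embed q) of (x, w, z) \<Rightarrow> (inv w - inv z, inv z)) = u"
      by (simp add: e inv1)
    have "norm_form (embed q - embed (q + p)) \<le> real N powr (2 * \<alpha>)"
    proof -
      have "norm_form (embed q - embed (q + p)) = (cmod (embed (q + p) - embed q))\<^sup>2" by (simp add: norm_form_eq norm_minus_commute)
      also have "\<dots> = (norm (point p))\<^sup>2" by (simp add: cmod_embed flip: embed_diff)
      also have "\<dots> \<le> (X N)\<^sup>2" using p by (simp add: sqX)
      finally show ?thesis by (simp add: X2)
    qed
    moreover have "nn (q + p) \<noteq> nn q"
    proof
      assume "nn (q + p) = nn q"
      then have "(norm (point (q + p)))\<^sup>2 = (norm (point q))\<^sup>2" using nn by metis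
      then show False using q'(5) by simp
    qed
    moreover have "0 < nn r" if "r \<noteq> 0" for r
    proof -
      have "real (nn r) > 0" unfolding nn using that by simp
      then show ?thesis by simp
    qed
    moreover have "nn r \<le> N\<^sup>2" if "norm (point r) \<le> real N" for r
    proof -
      have "real (nn r) \<le> real (N\<^sup>2)" unfolding nn using that by (simp add: sq)
      then show ?thesis by (simp only: of_nat_le_iff)
    qed
    ultimately show "(case u of (p, q) \<Rightarrow> ((nn (q + p), nn q), embed (q + p), embed q)) \<in> Sigma (pair_index N) P"
      using q' ran by (auto simp: e P_def pair_index_def norm_form_eq cmod_embed nn)
  qed
  also have "\<dots> = pair_sum N"
    unfolding pair_sum_def by (rule sum.Sigma[symmetric]) (use finite_punctured_disc finite_starts in auto)
  finally show ?thesis .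
qed

lemma \<psi>_eq:
  assumes "1 \<le> N"
  shows "(\<forall>N. \<mu> N = 1) \<Longrightarrow> \<psi> N = real N powr (2 + 2 * \<alpha>)"
    and "(\<forall>N. \<mu> N = real N powr (\<alpha> + \<beta> - 1)) \<Longrightarrow> \<psi> N = real N powr (3 + \<alpha> - \<beta>)"
proof -
  have N: "0 < real N" using assms by simp
  have "(real N)\<^sup>2 * (X N)\<^sup>2 = real N powr 2 * (real N powr \<alpha> * real N powr \<alpha>)"
    using N by (simp add: X_def power2_eq_square)
  also have "\<dots> = real N powr (2 + 2 * \<alpha>)" unfolding powr_add[symmetric] by simp
  finally have e: "(real N)\<^sup>2 * (X N)\<^sup>2 = real N powr (2 + 2 * \<alpha>)" .
  show "(\<forall>N. \<mu> N = 1) \<Longrightarrow> \<psi> N = real N powr (2 + 2 * \<alpha>)" by (simp add: \<psi>_def e)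
  show "(\<forall>N. \<mu> N = real N powr (\<alpha> + \<beta> - 1)) \<Longrightarrow> \<psi> N = real N powr (3 + \<alpha> - \<beta>)"
    by (simp add: \<psi>_def e algebra_simps flip: powr_diff)
qed

end

text \<open>A continuous compactly supported function is the difference of its positive and negative parts,
  which are test functions with the same support bound.\<close>

lemma weak_star_tendsto_of_nonneg:
  assumes sets: "sets m = sets borel"
    and ev: "\<And>f :: real \<Rightarrow> real. f \<in> borel_measurable borel \<Longrightarrow> \<forall>\<^sub>F N in sequentially. integrable (Mu N) f"
    and test: "\<And>f M B. test_function f M B \<Longrightarrow>
      \<exists>l\<ge>0. (\<integral>\<^sup>+x. ennreal (f x) \<partial>m) = ennreal l \<and> (\<lambda>N. \<integral>x. f x \<partial>Mu N) \<longlonglongrightarrow> l"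
  shows "weak_star_tendsto Mu m"
  unfolding weak_star_tendsto_def
proof (intro allI impI)
  fix f :: "real \<Rightarrow> real" assume "continuous_on UNIV f \<and> compact (closure {x. f x \<noteq> 0})"
  then have f: "continuous_on UNIV f" and c: "compact (closure {x. f x \<noteq> 0})" by auto
  obtain M where M: "0 < M" "\<And>x. x \<in> closure {x. f x \<noteq> 0} \<Longrightarrow> norm x \<le> M"
    using compact_imp_bounded[OF c] unfolding bounded_pos by blast
  have out: "f x = 0" if "M < \<bar>x\<bar>" for x
    using M(2)[of x] that closure_subset[of "{x. f x \<noteq> 0}"] by fastforce
  have "compact (f ` {- M..M})" using f by (intro compact_continuous_image) (auto intro: continuous_on_subset)
  then obtain B where B: "0 < B" "\<And>x. x \<in> {- M..M} \<Longrightarrow> \<bar>f x\<bar> \<le> B"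
    using compact_imp_bounded[of "f ` {- M..M}"] unfolding bounded_pos by auto
  have bnd: "\<bar>f x\<bar> \<le> B" for x
  proof (cases "M < \<bar>x\<bar>")
    case True
    then show ?thesis using out[of x] B(1) by simp
  next
    case False
    then have "x \<in> {- M..M}" by auto
    then show ?thesis by (rule B(2))
  qed
  define g where "g x = max (f x) 0" for x
  define h where "h x = max (- f x) 0" for x
  have fgh: "f x = g x - h x" for x by (simp add: g_def h_def)
  have g: "test_function g M B"
  proof
    show "continuous_on UNIV g" unfolding g_def by (intro continuous_intros f)
    show "g x \<le> B" for x using bnd[of x] B(1) by (simp add: g_def abs_le_iff)
  qed (use out M in \<open>auto simp: g_def\<close>)
  have h: "test_function h M B"
  proof
    show "continuous_on UNIV h" unfolding h_def by (intro continuous_intros f)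
    show "h x \<le> B" for x using bnd[of x] B(1) by (simp add: h_def abs_le_iff)
  qed (use out M in \<open>auto simp: h_def\<close>)
  interpret g: test_function g M B by (rule g)
  interpret h: test_function h M B by (rule h)
  obtain a where a: "a \<ge> 0" "(\<integral>\<^sup>+x. ennreal (g x) \<partial>m) = ennreal a" "(\<lambda>N. \<integral>x. g x \<partial>Mu N) \<longlonglongrightarrow> a" using test[OF g] by blast
  obtain b where b: "b \<ge> 0" "(\<integral>\<^sup>+x. ennreal (h x) \<partial>m) = ennreal b" "(\<lambda>N. \<integral>x. h x \<partial>Mu N) \<longlonglongrightarrow> b" using test[OF h] by blast
  have "has_bochner_integral m g a"
    by (rule has_bochner_integral_nn_integral) (use a g.nonneg g.measurable_f sets in \<open>auto cong: measurable_cong_sets\<close>)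
  moreover have "has_bochner_integral m h b"
    by (rule has_bochner_integral_nn_integral) (use b h.nonneg h.measurable_f sets in \<open>auto cong: measurable_cong_sets\<close>)
  ultimately have "has_bochner_integral m (\<lambda>x. g x - h x) (a - b)" by (rule has_bochner_integral_diff)
  then have "(\<integral>x. f x \<partial>m) = a - b" unfolding fgh by (rule has_bochner_integral_integral_eq)
  moreover have "\<forall>\<^sub>F N in sequentially. (\<integral>x. g x \<partial>Mu N) - (\<integral>x. h x \<partial>Mu N) = (\<integral>x. f x \<partial>Mu N)"
    using ev[OF g.measurable_f] ev[OF h.measurable_f]
    by eventually_elim (simp add: fgh)
  moreover have "(\<lambda>N. (\<integral>x. g x \<partial>Mu N) - (\<integral>x. h x \<partial>Mu N)) \<longlonglongrightarrow> a - b" by (intro tendsto_diff a b)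
  ultimately show "(\<lambda>N. \<integral>x. f x \<partial>Mu N) \<longlonglongrightarrow> (\<integral>x. f x \<partial>m)" by (simp add: tendsto_cong)
qed

text \<open>Measurability follows from Fubini, since away from 0 the density is the value of an integral with
  parameter; this avoids the domain restrictions of \<open>arcsin\<close>.\<close>

lemma measurable_disc_density: "(\<lambda>t. ennreal (disc_density t)) \<in> borel_measurable borel"
proof -
  have [measurable]: "(norm :: real \<times> real \<Rightarrow> real) \<in> borel_measurable borel"
    by (intro borel_measurable_continuous_onI continuous_intros)
  have [measurable]: "(indicator unit_disc :: _ \<Rightarrow> ennreal) \<in> borel_measurable borel"
    by (intro borel_measurable_indicator) simp
  define g where "g t = (\<integral>\<^sup>+u. ennreal (norm u * semicircle (norm u * t / 2)) * indicator unit_disc u \<partial>lborel)" for t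
  have [measurable]: "g \<in> borel_measurable borel" unfolding g_def by measurable
  have "(\<lambda>t. ennreal (disc_density t)) = (\<lambda>t. if t = 0 then ennreal (disc_density 0) else g t)"
    by (auto simp: fun_eq_iff g_def nn_integral_disc_density)
  also have "\<dots> \<in> borel_measurable borel" by measurable
  finally show ?thesis .
qed

lemma (in test_function) measurable_disc_integral: "disc_integral \<in> borel_measurable borel"
proof -
  have "isCont disc_integral x" for x
    unfolding isCont_def using disc_integral_tendsto by (simp add: tendsto_at_iff_sequentially o_def)
  then show ?thesis by (intro borel_measurable_continuous_onI continuous_at_imp_continuous_on) auto
qed

section \<open>Weak-star limits\<close>

theorem theorem1p1:
  fixes K :: "complex set" and \<alpha> \<beta> :: real and \<psi> :: "nat \<Rightarrow> real"
  assumes "imaginary_quadratic_field K"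
    and "[discriminant K = 0] (mod 4)"
    and "0 < \<alpha>" and "\<alpha> < 1 / 2"
    and "0 < \<beta>" and "\<beta> < 1 + \<alpha> / 2"
    and "\<And>N. 0 < N \<Longrightarrow> 0 < \<psi> N"
  shows "(\<beta> < 1 - \<alpha> \<and> (\<forall>N>0. \<psi> N = real N powr (2 + 2 * \<alpha>)) \<longrightarrow>
           weak_star_tendsto (empirical_measure K \<alpha> \<beta> \<psi>)
             (scale_measure (ennreal (4 * pi\<^sup>2 / \<bar>real_of_int (discriminant K)\<bar>)) (return borel 0))) \<and>
         (\<beta> = 1 - \<alpha> \<and> (\<forall>N>0. \<psi> N = real N powr (2 + 2 * \<alpha>)) \<longrightarrow>
           weak_star_tendsto (empirical_measure K \<alpha> \<beta> \<psi>)
             (density lborel (\<lambda>t. ennreal (pair_density K t)))) \<and>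
         (1 - \<alpha> < \<beta> \<and> \<alpha> \<le> 1 / 6 \<and> (\<forall>N>0. \<psi> N = real N powr (3 + \<alpha> - \<beta>)) \<longrightarrow>
           weak_star_tendsto (empirical_measure K \<alpha> \<beta> \<psi>)
             (scale_measure (ennreal (8 * pi / (3 * \<bar>real_of_int (discriminant K)\<bar>))) lborel))"
proof -
  note K = assms(1) and \<alpha> = assms(3,4) and \<beta> = assms(5,6)
  obtain y where y: "0 < y" and D: "\<bar>real_of_int (discriminant K)\<bar> = 4 * y\<^sup>2"
    and bij: "bij_betw (\<lambda>(m::int, n::int). Complex (of_int m) (y * of_int n)) UNIV (ring_of_integers K)"
    using ring_of_integers_rectangular[OF assms(1,2)] by blast
  have y2: "y\<^sup>2 > 0" using y by simp
  have integrable: "\<forall>\<^sub>F N in sequentially. integrable (empirical_measure K \<alpha> \<beta> \<psi> N) f"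
    if "f \<in> borel_measurable borel" for f :: "real \<Rightarrow> real"
    using eventually_gt_at_top[of 0]
    by eventually_elim (rule integral_empirical_measure(1)[OF that], rule assms(7))
  have limit: "(\<lambda>N. \<integral>x. f x \<partial>empirical_measure K \<alpha> \<beta> \<psi> N) \<longlonglongrightarrow> L / y\<^sup>2"
    if ps: "pair_sums y f M B \<alpha> \<beta> \<mu>"
      and \<psi>: "\<forall>N>0. \<psi> N = pair_sums.\<psi> \<alpha> \<mu> N"
      and conv: "\<And>r s. 0 < r \<Longrightarrow> s \<longlonglongrightarrow> r \<Longrightarrow> (\<lambda>N. \<mu> N * test_function.disc_integral f (real N powr (\<alpha> + \<beta> - 1) * s N)) \<longlonglongrightarrow> \<phi> r"
      and m: "\<phi> \<in> borel_measurable borel"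
      and L: "(\<integral>\<^sup>+v. ennreal (\<phi> (norm v)) * indicator unit_disc v \<partial>lborel) = ennreal L" "0 \<le> L"
    for f M B \<mu> \<phi> L
  proof -
    interpret pair_sums y f M B \<alpha> \<beta> \<mu> by (rule ps)
    have emb: "embed = (\<lambda>(m::int, n::int). Complex (of_int m) (y * of_int n))"
      by (auto simp: embed_def fun_eq_iff)
    have bij': "bij_betw embed UNIV (ring_of_integers K)" unfolding emb by (rule bij)
    have int: "(norm (point p))\<^sup>2 \<in> \<int>" for p
    proof -
      have "embed p \<in> ring_of_integers K" using bij' by (auto simp: bij_betw_def)
      then show ?thesis using ring_of_integers_iff[OF K] by (simp add: cmod_embed)
    qed
    have "(\<lambda>N. pair_sum N / pair_sums.\<psi> \<alpha> \<mu> N) \<longlonglongrightarrow> L / y\<^sup>2"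
      by (rule pair_sum_tendsto[OF conv[folded gap_scale_def] m L])
    moreover have "\<forall>\<^sub>F N in sequentially. pair_sum N / pair_sums.\<psi> \<alpha> \<mu> N = (\<integral>x. f x \<partial>empirical_measure K \<alpha> \<beta> \<psi> N)"
      using eventually_gt_at_top[of 0]
    proof eventually_elim
      case (elim N)
      then have "1 \<le> N" by simp
      show ?case
        unfolding integral_empirical_measure(2)[where \<psi> = \<psi>, OF measurable_f assms(7)[OF elim]] pair_count_sum[OF bij' int \<open>1 \<le> N\<close>]
        using \<psi> elim by simp
    qed
    ultimately show ?thesis by (simp add: tendsto_cong)
  qed
  have pair_sums_1: "pair_sums y f M B \<alpha> \<beta> (\<lambda>_. 1)" if "test_function f M B" "\<beta> \<le> 1 - \<alpha>" for f M B
    using that \<alpha> \<beta> y by (auto intro!: pair_sums.intro pair_sums_axioms.intro rectangular_lattice.intro)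
  have pair_sums_scale: "pair_sums y f M B \<alpha> \<beta> (\<lambda>N. real N powr (\<alpha> + \<beta> - 1))" if "test_function f M B" "1 - \<alpha> < \<beta>" "\<alpha> \<le> 1 / 6" for f M B
    using that \<alpha> \<beta> y by (auto intro!: pair_sums.intro pair_sums_axioms.intro rectangular_lattice.intro)
  let ?m1 = "scale_measure (ennreal (4 * pi\<^sup>2 / \<bar>real_of_int (discriminant K)\<bar>)) (return borel 0)"
  let ?m2 = "density lborel (\<lambda>t. ennreal (pair_density K t))"
  let ?m3 = "scale_measure (ennreal (8 * pi / (3 * \<bar>real_of_int (discriminant K)\<bar>))) lborel"
  show ?thesis
  proof (intro conjI impI)
    assume a: "\<beta> < 1 - \<alpha> \<and> (\<forall>N>0. \<psi> N = real N powr (2 + 2 * \<alpha>))"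
    show "weak_star_tendsto (empirical_measure K \<alpha> \<beta> \<psi>)
             ?m1"
    proof (rule weak_star_tendsto_of_nonneg[OF _ integrable])
      fix f M B assume t: "test_function f M B"
      interpret test_function f M B by (rule t)
      interpret p: pair_sums y f M B \<alpha> \<beta> "\<lambda>_. 1" using pair_sums_1[OF t] a by simp
      have f0: "0 \<le> f 0" by (rule nonneg)
      \<comment> \<open>The gap scale tends to 0, so every pair eventually contributes \<open>f 0\<close>.\<close>
      have "(\<lambda>N. \<integral>x. f x \<partial>empirical_measure K \<alpha> \<beta> \<psi> N) \<longlonglongrightarrow> (pi\<^sup>2 * f 0) / y\<^sup>2"
      proof (rule limit[OF p.pair_sums_axioms, where \<phi> = "\<lambda>_. pi * f 0"])
        show "\<forall>N>0. \<psi> N = p.\<psi> N" using a p.\<psi>_eq(1) by simp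
        fix r :: real and s assume s: "s \<longlonglongrightarrow> r"
        have "(\<lambda>N. real N powr (\<alpha> + \<beta> - 1) * s N) \<longlonglongrightarrow> 0 * r"
          using a by (intro tendsto_mult s p.tendsto_powr_neg_real) simp
        then have "(\<lambda>N. disc_integral (real N powr (\<alpha> + \<beta> - 1) * s N)) \<longlonglongrightarrow> disc_integral 0" by (intro disc_integral_tendsto) simp
        then show "(\<lambda>N. 1 * disc_integral (real N powr (\<alpha> + \<beta> - 1) * s N)) \<longlonglongrightarrow> pi * f 0" by (simp add: disc_integral_0)
      next
        have "(\<integral>\<^sup>+v. ennreal (pi * f 0) * indicator unit_disc v \<partial>lborel) = ennreal (pi * f 0) * ennreal pi"
          by (subst nn_integral_cmult_indicator) (simp_all add: emeasure_unit_disc)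
        also have "\<dots> = ennreal (pi\<^sup>2 * f 0)" using f0 by (simp add: power2_eq_square mult_ac flip: ennreal_mult'')
        finally show "(\<integral>\<^sup>+v. ennreal (pi * f 0) * indicator unit_disc v \<partial>lborel) = ennreal (pi\<^sup>2 * f 0)" .
      qed (use f0 in simp_all)
      moreover have "(\<integral>\<^sup>+x. ennreal (f x) \<partial>?m1) = ennreal ((pi\<^sup>2 * f 0) / y\<^sup>2)"
        using f0 by (simp add: nn_integral_scale_measure nn_integral_return D flip: ennreal_mult'')
      moreover have "0 \<le> (pi\<^sup>2 * f 0) / y\<^sup>2" using f0 by simp
      ultimately show "\<exists>l\<ge>0. (\<integral>\<^sup>+x. ennreal (f x) \<partial>?m1) = ennreal l
          \<and> (\<lambda>N. \<integral>x. f x \<partial>empirical_measure K \<alpha> \<beta> \<psi> N) \<longlonglongrightarrow> l" by blast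
    qed simp
  next
    assume a: "\<beta> = 1 - \<alpha> \<and> (\<forall>N>0. \<psi> N = real N powr (2 + 2 * \<alpha>))"
    have pd: "ennreal (pair_density K t) = ennreal (disc_density t) * ennreal (1 / y\<^sup>2)" for t
    proof -
      have "pair_density K t = disc_density t * (1 / y\<^sup>2)"
        unfolding pair_density_def disc_density_def D by (simp add: field_simps)
      then show ?thesis by (simp only: ennreal_mult'' zero_le_divide_1_iff zero_le_power2)
    qed
    show "weak_star_tendsto (empirical_measure K \<alpha> \<beta> \<psi>) ?m2"
    proof (rule weak_star_tendsto_of_nonneg[OF _ integrable])
      fix f M B assume t: "test_function f M B"
      interpret test_function f M B by (rule t)
      interpret p: pair_sums y f M B \<alpha> \<beta> "\<lambda>_. 1" using pair_sums_1[OF t] a by simp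
      define I where "I = (\<integral>\<^sup>+t. ennreal (f t) * ennreal (disc_density t) \<partial>lborel)"
      have "I = (\<integral>\<^sup>+v. ennreal (disc_integral (norm v)) * indicator unit_disc v \<partial>lborel)"
        unfolding I_def by (rule nn_disc_integral_average[symmetric])
      also have "\<dots> \<le> (\<integral>\<^sup>+v. ennreal (pi * B) * indicator unit_disc v \<partial>lborel)"
        by (intro nn_integral_mono mult_right_mono ennreal_leI disc_integral_le) simp
      also have "\<dots> = ennreal (pi * B) * ennreal pi" by (subst nn_integral_cmult_indicator) (simp_all add: emeasure_unit_disc)
      also have "\<dots> < \<infinity>" by (simp add: ennreal_mult_less_top)
      finally have I: "I = ennreal (enn2real I)" by (simp add: less_top)
      \<comment> \<open>The gap scale is constantly 1.\<close>
      have "(\<lambda>N. \<integral>x. f x \<partial>empirical_measure K \<alpha> \<beta> \<psi> N) \<longlonglongrightarrow> enn2real I / y\<^sup>2"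
      proof (rule limit[OF p.pair_sums_axioms, where \<phi> = disc_integral])
        show "\<forall>N>0. \<psi> N = p.\<psi> N" using a p.\<psi>_eq(1) by simp
        fix r :: real and s assume s: "s \<longlonglongrightarrow> r"
        have "\<forall>\<^sub>F N in sequentially. 1 * disc_integral (s N) = 1 * disc_integral (real N powr (\<alpha> + \<beta> - 1) * s N)"
          using eventually_gt_at_top[of 0] by eventually_elim (use a in simp)
        moreover have "(\<lambda>N. 1 * disc_integral (s N)) \<longlonglongrightarrow> disc_integral r" using disc_integral_tendsto[OF s] by simp
        ultimately show "(\<lambda>N. 1 * disc_integral (real N powr (\<alpha> + \<beta> - 1) * s N)) \<longlonglongrightarrow> disc_integral r" by (rule Lim_transform_eventually[rotated])
      qed (use I nn_disc_integral_average measurable_disc_integral in \<open>simp_all add: I_def\<close>)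
      moreover have "(\<integral>\<^sup>+x. ennreal (f x) \<partial>?m2) = ennreal (enn2real I / y\<^sup>2)"
      proof -
        have "(\<integral>\<^sup>+x. ennreal (f x) \<partial>?m2) = (\<integral>\<^sup>+x. ennreal (disc_density x) * ennreal (1 / y\<^sup>2) * ennreal (f x) \<partial>lborel)"
          unfolding pd by (rule nn_integral_density) (use measurable_disc_density in measurable)
        also have "\<dots> = (\<integral>\<^sup>+x. ennreal (f x) * ennreal (disc_density x) * ennreal (1 / y\<^sup>2) \<partial>lborel)"
          by (intro nn_integral_cong) (simp add: mult_ac)
        also have "\<dots> = I * ennreal (1 / y\<^sup>2)"
          unfolding I_def by (rule nn_integral_multc) (use measurable_disc_density in measurable)
        also have "\<dots> = ennreal (enn2real I / y\<^sup>2)" by (subst I) (simp flip: ennreal_mult'')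
        finally show ?thesis .
      qed
      moreover have "0 \<le> enn2real I / y\<^sup>2" by simp
      ultimately show "\<exists>l\<ge>0. (\<integral>\<^sup>+x. ennreal (f x) \<partial>?m2) = ennreal l
          \<and> (\<lambda>N. \<integral>x. f x \<partial>empirical_measure K \<alpha> \<beta> \<psi> N) \<longlonglongrightarrow> l" by blast
    qed simp
  next
    assume a: "1 - \<alpha> < \<beta> \<and> \<alpha> \<le> 1 / 6 \<and> (\<forall>N>0. \<psi> N = real N powr (3 + \<alpha> - \<beta>))"
    show "weak_star_tendsto (empirical_measure K \<alpha> \<beta> \<psi>)
             ?m3"
    proof (rule weak_star_tendsto_of_nonneg[OF _ integrable])
      fix f M B assume t: "test_function f M B"
      interpret test_function f M B by (rule t)
      interpret p: pair_sums y f M B \<alpha> \<beta> "\<lambda>N. real N powr (\<alpha> + \<beta> - 1)" using pair_sums_scale[OF t] a by simp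
      define I where "I = (LINT x|lborel. f x)"
      have I0: "0 \<le> I" unfolding I_def by (rule integral_f_nonneg)
      \<comment> \<open>The gap scale tends to infinity, and \<open>s * disc_integral s\<close> to \<open>I / 3\<close>.\<close>
      have "(\<lambda>N. \<integral>x. f x \<partial>empirical_measure K \<alpha> \<beta> \<psi> N) \<longlonglongrightarrow> (2 * pi * (I / 3)) / y\<^sup>2"
      proof (rule limit[OF p.pair_sums_axioms, where \<phi> = "\<lambda>r. (I / 3) / r"])
        show "\<forall>N>0. \<psi> N = p.\<psi> N" using a p.\<psi>_eq(2) by simp
        fix r :: real and s assume r: "0 < r" and s: "s \<longlonglongrightarrow> r"
        have "filterlim (\<lambda>N. real N powr (\<alpha> + \<beta> - 1) * s N) at_top sequentially"
          using a by (intro filterlim_at_top_mult_tendsto_pos[OF s r] p.filterlim_nat_powr_at_top) simp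
        then have "(\<lambda>N. real N powr (\<alpha> + \<beta> - 1) * s N * disc_integral (real N powr (\<alpha> + \<beta> - 1) * s N)) \<longlonglongrightarrow> I / 3"
          unfolding I_def by (rule mult_disc_integral_tendsto)
        then have "(\<lambda>N. real N powr (\<alpha> + \<beta> - 1) * s N * disc_integral (real N powr (\<alpha> + \<beta> - 1) * s N) / s N) \<longlonglongrightarrow> (I / 3) / r"
          by (rule tendsto_divide[OF _ s]) (use r in simp)
        moreover have "\<forall>\<^sub>F N in sequentially. real N powr (\<alpha> + \<beta> - 1) * s N * disc_integral (real N powr (\<alpha> + \<beta> - 1) * s N) / s N
            = real N powr (\<alpha> + \<beta> - 1) * disc_integral (real N powr (\<alpha> + \<beta> - 1) * s N)"
          using order_tendstoD(1)[OF s r] by eventually_elim simp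
        ultimately show "(\<lambda>N. real N powr (\<alpha> + \<beta> - 1) * disc_integral (real N powr (\<alpha> + \<beta> - 1) * s N)) \<longlonglongrightarrow> (I / 3) / r"
          by (rule Lim_transform_eventually)
      next
        show "(\<integral>\<^sup>+v. ennreal ((I / 3) / norm v) * indicator unit_disc v \<partial>lborel) = ennreal (2 * pi * (I / 3))"
          by (rule nn_integral_radial_const_over) (use I0 in simp)
      qed (use I0 in simp_all)
      moreover have "(\<integral>\<^sup>+x. ennreal (f x) \<partial>?m3) = ennreal ((2 * pi * (I / 3)) / y\<^sup>2)"
        using I0 y2 by (simp add: nn_integral_scale_measure nn_integral_f I_def[symmetric] D flip: ennreal_mult'')
      moreover have "0 \<le> (2 * pi * (I / 3)) / y\<^sup>2" using I0 by simp
      ultimately show "\<exists>l\<ge>0. (\<integral>\<^sup>+x. ennreal (f x) \<partial>?m3) = ennreal l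
          \<and> (\<lambda>N. \<integral>x. f x \<partial>empirical_measure K \<alpha> \<beta> \<psi> N) \<longlonglongrightarrow> l" by blast
    qed simp
  qed
qed

end
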